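(* For each $p$ in an increasing sequence of positive integers tending to infinity, let $m=m(p)$ be a positive integer and let $X = X^{(p)}$ be a $p \times m$ random matrix whose columns are independent, and each column follows the block-independent model with blocks of sizes $d_j = d_j(p)$ (the same block partition for all columns of $X^{(p)}$), where $p=\sum_j d_j$. Assume that, as $p \to \infty$: (i) $p/m \to \lambda \in (0,\infty)$; (ii) $\max_j d_j = o(p)$; (iii) all entries of the random matrices $X^{(p)}$ have uniformly bounded fourth moments, i.e. $\sup_p \max_{i,k} \mathbb{E}(X^{(p)}_{ik})^4 < \infty$. Then, with probability $1$, the empirical spectral distribution of the sample covariance matrix $W = \frac{1}{m} X X^\mathsf{T}$ converges weakly to the Marchenko-Pastur distribution with parameter $\lambda$.
   Context: Block-independent model: a random vector $x \in \mathbb{R}^p$ follows the block-independent model with blocks of sizes $d_j$ if $\mathbb{E}x = 0$, $\mathbb{E} x x^\mathsf{T} = I_p$ (isotropy), and the coordinate index set $[p]$ is partitioned into disjoint blocks $I_1, I_2,\dots$ with $|I_j| = d_j$ such that the sub-vectors $(x_i)_{i \in I_j}$, $j=1,2,\dots$, are mutually independent (entries within the same block may be dependent). Empirical spectral distribution of a symmetric $p\times p$ matrix $W$ with eigenvalues $\lambda_1(W),\dots,\lambda_p(W)$: $F^W(x) = \frac{1}{p}\#\{1\le i\le p : \lambda_i(W) \le x\}$. Marchenko-Pastur distribution with parameter $\lambda\in(0,\infty)$: let $\lambda_\pm = (1\pm\sqrt{\lambda})^2$ and $f_\lambda(x) = \frac{1}{2\pi \lambda x}\sqrt{[(\lambda_+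 - x)(x-\lambda_-)]_+}$ for $x>0$. For $\lambda \le 1$ it is the probability distribution with density $f_\lambda$; for $\lambda > 1$ it is the probability distribution consisting of a point mass $1 - 1/\lambda$ at $0$ plus the absolutely continuous part with density $f_\lambda$. *)

theory Defs
  imports "HOL-Probability.Probability" "Jordan_Normal_Form.Char_Poly"
    "HOL-Library.Disjoint_Sets"
begin

definition sample_cov :: "nat \<Rightarrow> nat \<Rightarrow> (nat \<Rightarrow> nat \<Rightarrow> real) \<Rightarrow> real mat" where
  "sample_cov p m X = mat p p (\<lambda>(i, j). (1 / real m) * (\<Sum>k<m. X i k * X j k))"

definition esd :: "real mat \<Rightarrow> real \<Rightarrow> real" where
  "esd W x = (1 / real (dim_row W)) *
     real (\<Sum>a\<in>{a. a \<le> x \<and> poly (char_poly W) a = 0}. order a (char_poly W))"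

definition mp_density :: "real \<Rightarrow> real \<Rightarrow> real" where
  "mp_density lam x = (if x > 0 then
     1 / (2 * pi * lam * x) *
       sqrt (max 0 (((1 + sqrt lam)^2 - x) * (x - (1 - sqrt lam)^2))) else 0)"

definition mp_cdf :: "real \<Rightarrow> real \<Rightarrow> real" where
  "mp_cdf lam x = (if lam > 1 \<and> 0 \<le> x then 1 - 1 / lam else 0)
                  + (LINT t|lborel. indicator {0<..x} t * mp_density lam t)"

end

theory Submission
  imports Defs "Jordan_Normal_Form.Schur_Decomposition"
begin

text \<open>
  Weak convergence is read off the Stieltjes transform on the negative half line,
  \<open>s(t) = tr (W + t)\<^sup>-\<^sup>1 / p\<close> with \<open>t > 0\<close>, so that everything stays real and all resolvents are
  positive. With \<open>a\<^sub>k\<close> the quadratic form of the \<open>k\<close>-th column of \<open>X/\<surd>m\<close> in the resolvent of the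
  matrix without that column, the Sherman--Morrison formula gives \<open>1 = t s + (1/p) \<Sum>\<^sub>k a\<^sub>k / (1 + a\<^sub>k)\<close>.
  In the block-independent model a quadratic form \<open>x\<^sup>T A x\<close> has variance \<open>O(p max d\<^sub>j) = o(p\<^sup>2)\<close>,
  so \<open>a\<^sub>k\<close> is close to \<open>(p/m) s\<close>, and \<open>E s\<close> nearly solves \<open>1 = t s + s / (1 + \<lambda> s)\<close>, whose positive
  solution is the transform of the Marchenko--Pastur law. Changing one column moves the trace of the
  resolvent by at most \<open>1/t\<close>, so bounded differences give \<open>E (s - E s)\<^sup>4 = O(p\<^sup>-\<^sup>2)\<close>, which is
  summable because the dimensions are strictly increasing.
\<close>

section \<open>Resolvents of sums of rank one matrices\<close>

text \<open>Staying at \<open>-t\<close> with \<open>t > 0\<close> also supplies stability: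
  \<open>u -> t u + u / (1 + lam u)\<close> increases with slope at least \<open>t\<close>, so an
  approximate solution is automatically near the exact one. Fourth moments only yield a bound in
  mean for the quadratic forms, too weak to be summed over the dimensions. Hence they serve for
  \<open>E s\<close> alone, with \<open>a_k\<close> compared to the number \<open>(p/m) E s\<close>,
  while the almost sure statement rests on bounded differences, where a column of any size moves the
  trace by at most \<open>1/t\<close>. The obstacle in the quadratic form is the arbitrary
  dependence inside a block \<open>J\<close>. There positivity replaces a moment expansion: the
  principal block of a resolvent satisfies \<open>0 <= x^T A x <= |x|^2 / t\<close>, whose second
  moment is \<open>O(|J|^2)\<close>, and the squared block sizes sum to at most \<open>p\<close>
  times the largest one. Transforms at rational \<open>t\<close> determine weak limits because
  difference quotients in \<open>t\<close> produce the powers of \<open>1 / (x + t)\<close>, and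
  polynomials in \<open>1 / (x + 1)\<close> approximate uniformly every continuous function on the
  half line that has a limit at infinity.\<close>

definition dot :: "nat \<Rightarrow> (nat \<Rightarrow> real) \<Rightarrow> (nat \<Rightarrow> real) \<Rightarrow> real" where
  "dot p u v = (\<Sum>i<p. u i * v i)"

definition mat_app :: "nat \<Rightarrow> (nat \<Rightarrow> nat \<Rightarrow> real) \<Rightarrow> (nat \<Rightarrow> real) \<Rightarrow> nat \<Rightarrow> real" where
  "mat_app p A v i = (\<Sum>j<p. A i j * v j)"

text \<open>This is \<open>W + t\<close> acting on vectors, once \<open>Y\<close> holds the columns
  of \<open>X / sqrt m\<close>. The column index comes first, unlike in \<open>X\<close>, so that
  \<open>Y k\<close> is a vector and \<open>Y(k := y)\<close> exchanges a column.\<close>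

definition gram_op :: "nat \<Rightarrow> real \<Rightarrow> (nat \<Rightarrow> nat \<Rightarrow> real) \<Rightarrow> nat \<Rightarrow> (nat \<Rightarrow> real) \<Rightarrow> nat \<Rightarrow> real" where
  "gram_op p t Y n v i = t * v i + (\<Sum>k<n. Y k i * dot p (Y k) v)"

text \<open>Symmetry is carried along because the rank one update moves \<open>R\<close> across
  \<open>dot\<close>. Entries with an index of at least \<open>p\<close> are left free, so two
  resolvents are only ever compared below \<open>p\<close>.\<close>

definition is_resolvent :: "nat \<Rightarrow> real \<Rightarrow> (nat \<Rightarrow> nat \<Rightarrow> real) \<Rightarrow> nat \<Rightarrow> (nat \<Rightarrow> nat \<Rightarrow> real) \<Rightarrow> bool" where
  "is_resolvent p t Y n R \<longleftrightarrow> (\<forall>i<p. \<forall>j<p. R i j = R j i) \<and>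
     (\<forall>v. \<forall>i<p. gram_op p t Y n (mat_app p R v) i = v i)"

text \<open>The Sherman--Morrison update. Iterating it from \<open>1/t\<close> builds the resolvent by explicit
  formulas, so that its measurability in the columns is immediate.\<close>

definition rank_one_update :: "nat \<Rightarrow> (nat \<Rightarrow> nat \<Rightarrow> real) \<Rightarrow> (nat \<Rightarrow> real) \<Rightarrow> nat \<Rightarrow> nat \<Rightarrow> real" where
  "rank_one_update p R y i j = R i j - mat_app p R y i * mat_app p R y j / (1 + dot p y (mat_app p R y))"

primrec resolvent :: "nat \<Rightarrow> real \<Rightarrow> (nat \<Rightarrow> nat \<Rightarrow> real) \<Rightarrow> nat \<Rightarrow> nat \<Rightarrow> nat \<Rightarrow> real" where
  "resolvent p t Y 0 = (\<lambda>i j. if i = j then 1 / t else 0)"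
| "resolvent p t Y (Suc n) = rank_one_update p (resolvent p t Y n) (Y n)"

definition mat_tr :: "nat \<Rightarrow> (nat \<Rightarrow> nat \<Rightarrow> real) \<Rightarrow> real" where
  "mat_tr p A = (\<Sum>i<p. A i i)"

lemma dot_commute: "dot p u v = dot p v u"
  by (simp add: dot_def mult.commute)

lemma dot_diff_right: "dot p u (\<lambda>i. v i - w i) = dot p u v - dot p u w"
  by (simp add: dot_def algebra_simps sum_subtractf)

lemma dot_scale_right: "dot p u (\<lambda>i. c * v i) = c * dot p u v"
  by (simp add: dot_def sum_distrib_left mult_ac)

lemma dot_cong: "(\<And>i. i < p \<Longrightarrow> u i = u' i) \<Longrightarrow> (\<And>i. i < p \<Longrightarrow> v i = v' i) \<Longrightarrow> dot p u v = dot p u' v'"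
  by (simp add: dot_def)

lemma dot_self_nonneg: "0 \<le> dot p u u"
  by (simp add: dot_def sum_nonneg)

lemma dot_self_eq_0: "dot p u u = 0 \<Longrightarrow> i < p \<Longrightarrow> u i = 0"
  by (auto simp: dot_def sum_nonneg_eq_0_iff)

lemma dot_zero_right [simp]: "dot p u (\<lambda>_. 0) = 0"
  by (simp add: dot_def)

lemma dot_zero_left [simp]: "dot p (\<lambda>_. 0) u = 0"
  by (simp add: dot_def)

lemma dot_unit: "j < p \<Longrightarrow> dot p u (\<lambda>i. if i = j then 1 else 0) = u j"
  by (simp add: dot_def if_distrib sum.delta cong: if_cong)

lemma mat_app_unit: "j < p \<Longrightarrow> mat_app p A (\<lambda>i. if i = j then 1 else 0) i = A i j"
  by (simp add: mat_app_def if_distrib sum.delta cong: if_cong)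

lemma dot_Cauchy_Schwarz: "(dot p u v)\<^sup>2 \<le> dot p u u * dot p v v"
proof -
  have "(\<Sum>i<p. u i * v i)\<^sup>2 \<le> (\<Sum>i<p. (u i)\<^sup>2) * (\<Sum>i<p. (v i)\<^sup>2)"
    by (rule Cauchy_Schwarz_ineq_sum)
  then show ?thesis by (simp add: dot_def power2_eq_square)
qed

lemma mat_app_sym_ip:
  assumes "\<And>i j. i < p \<Longrightarrow> j < p \<Longrightarrow> R i j = R j i"
  shows "dot p u (mat_app p R v) = dot p (mat_app p R u) v"
proof -
  have "dot p u (mat_app p R v) = (\<Sum>i<p. \<Sum>j<p. u i * R i j * v j)"
    by (simp add: dot_def mat_app_def sum_distrib_left mult_ac)
  also have "\<dots> = (\<Sum>j<p. \<Sum>i<p. u i * R i j * v j)" by (rule sum.swap)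
  also have "\<dots> = (\<Sum>j<p. \<Sum>i<p. R j i * u i * v j)"
    using assms by (intro sum.cong refl) auto
  also have "\<dots> = dot p (mat_app p R u) v"
    by (simp add: dot_def mat_app_def sum_distrib_right)
  finally show ?thesis .
qed

text \<open>The quantitative form of positivity: dropping the sum of squares yields injectivity and
  all the bounds by powers of \<open>1 / t\<close> below.\<close>

lemma dot_gram_op:
  "dot p w (gram_op p t Y n w) = t * dot p w w + (\<Sum>k<n. (dot p (Y k) w)\<^sup>2)"
proof -
  have "dot p w (gram_op p t Y n w)
      = t * dot p w w + (\<Sum>i<p. \<Sum>k<n. w i * (Y k i * dot p (Y k) w))"
    by (simp add: dot_def gram_op_def algebra_simps sum.distrib sum_distrib_left)
  also have "(\<Sum>i<p. \<Sum>k<n. w i * (Y k i * dot p (Y k) w)) = (\<Sum>k<n. \<Sum>i<p. w i * (Y k i * dot p (Y k) w))"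
    by (rule sum.swap)
  also have "\<dots> = (\<Sum>k<n. (dot p (Y k) w)\<^sup>2)"
    by (intro sum.cong refl) (simp add: dot_def power2_eq_square sum_distrib_right mult_ac)
  finally show ?thesis .
qed

lemma gram_op_diff:
  "gram_op p t Y n (\<lambda>i. v i - w i) i = gram_op p t Y n v i - gram_op p t Y n w i"
  by (simp add: gram_op_def dot_diff_right algebra_simps sum_subtractf)

lemma gram_op_scale:
  "gram_op p t Y n (\<lambda>i. c * v i) i = c * gram_op p t Y n v i"
  by (simp add: gram_op_def dot_scale_right algebra_simps sum_distrib_left)

lemma gram_op_inj:
  assumes t: "t > 0" and eq: "\<And>i. i < p \<Longrightarrow> gram_op p t Y n v i = gram_op p t Y n w i" and i: "i < p"
  shows "v i = w i"
proof -
  let ?d = "\<lambda>i. v i - w i"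
  have "dot p ?d (gram_op p t Y n ?d) = dot p ?d (\<lambda>_. 0)"
    by (rule dot_cong) (auto simp: gram_op_diff eq)
  then have "t * dot p ?d ?d + (\<Sum>k<n. (dot p (Y k) ?d)\<^sup>2) = 0"
    by (simp add: dot_gram_op)
  moreover have "(\<Sum>k<n. (dot p (Y k) ?d)\<^sup>2) \<ge> 0" "t * dot p ?d ?d \<ge> 0"
    using t by (auto intro!: sum_nonneg mult_nonneg_nonneg dot_self_nonneg)
  ultimately have "dot p ?d ?d = 0" using t by (simp add: add_nonneg_eq_0_iff)
  from dot_self_eq_0[OF this i] show ?thesis by simp
qed

lemma mat_app_rank_one_update:
  "mat_app p (rank_one_update p R y) v i =
     mat_app p R v i - (dot p (mat_app p R y) v / (1 + dot p y (mat_app p R y))) * mat_app p R y i"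
proof -
  define u where "u = mat_app p R y"
  define a where "a = dot p y u"
  have "mat_app p (rank_one_update p R y) v i = (\<Sum>j<p. R i j * v j - u i / (1 + a) * (u j * v j))"
    unfolding mat_app_def[of p "rank_one_update p R y"] rank_one_update_def u_def[symmetric] a_def[symmetric]
    by (intro sum.cong refl) (simp add: algebra_simps)
  also have "\<dots> = mat_app p R v i - u i / (1 + a) * dot p u v"
    by (simp add: sum_subtractf mat_app_def dot_def sum_distrib_left)
  finally show ?thesis by (simp add: u_def a_def)
qed

section \<open>Bounds and identities for a fixed resolvent\<close>

context
  fixes p n :: nat and t :: real and Y R :: "nat \<Rightarrow> nat \<Rightarrow> real"
  assumes t: "t > 0" and R: "is_resolvent p t Y n R"
begin

lemma resolvent_sym: "i < p \<Longrightarrow> j < p \<Longrightarrow> R i j = R j i"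
  using R by (simp add: is_resolvent_def)

lemma resolvent_right_inv: "i < p \<Longrightarrow> gram_op p t Y n (mat_app p R v) i = v i"
  using R by (simp add: is_resolvent_def)

lemma resolvent_unique:
  assumes "\<And>i. i < p \<Longrightarrow> gram_op p t Y n w i = v i" "i < p"
  shows "w i = mat_app p R v i"
  by (rule gram_op_inj[OF t _ assms(2), where Y = Y and n = n]) (simp add: assms(1) resolvent_right_inv)

text \<open>For \<open>w = R v\<close> the vector \<open>v\<close> is the operator applied to
  \<open>w\<close>, so \<open>dot_gram_op\<close> applies to \<open>w\<close>. As an operator
  inequality this reads \<open>t R^2 <= R\<close>, which is what later caps the change of the
  trace.\<close>

lemma resolvent_quadratic: "dot p v (mat_app p R v) \<ge> t * dot p (mat_app p R v) (mat_app p R v)"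
proof -
  let ?w = "mat_app p R v"
  have "dot p v ?w = dot p ?w (gram_op p t Y n ?w)"
    by (subst dot_commute) (rule dot_cong, auto simp: resolvent_right_inv)
  also have "\<dots> \<ge> t * dot p ?w ?w"
    by (simp add: dot_gram_op sum_nonneg)
  finally show ?thesis .
qed

lemma resolvent_quadratic_nonneg: "0 \<le> dot p v (mat_app p R v)"
  using resolvent_quadratic[of v] dot_self_nonneg[of p "mat_app p R v"] t
  by (meson mult_nonneg_nonneg less_imp_le order_trans)

text \<open>From \<open>t |w|^2 <= <v, w> <= |v| |w|\<close> one factor \<open>|w|\<close> cancels;
  the argument is squared throughout to stay free of roots. It says that the operator norm of
  \<open>R\<close> is at most \<open>1 / t\<close>.\<close>

lemma resolvent_norm: "t\<^sup>2 * dot p (mat_app p R v) (mat_app p R v) \<le> dot p v v"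
proof -
  let ?w = "mat_app p R v"
  let ?x = "dot p ?w ?w"
  have x: "?x \<ge> 0" by (rule dot_self_nonneg)
  have "(t * ?x)\<^sup>2 \<le> (dot p v ?w)\<^sup>2"
    using resolvent_quadratic[of v] x t by (intro power_mono) auto
  also have "\<dots> \<le> dot p v v * ?x" by (rule dot_Cauchy_Schwarz)
  finally have "(t\<^sup>2 * ?x) * ?x \<le> dot p v v * ?x" by (simp add: power2_eq_square mult_ac)
  then show ?thesis
    using x dot_self_nonneg[of p v] by (cases "?x = 0") auto
qed

lemma resolvent_quadratic_le: "t * dot p v (mat_app p R v) \<le> dot p v v"
proof -
  let ?w = "mat_app p R v"
  have "(t * dot p v ?w)\<^sup>2 \<le> t\<^sup>2 * (dot p v v * dot p ?w ?w)"
    using dot_Cauchy_Schwarz[of p v ?w] by (simp add: power_mult_distrib mult_left_mono)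
  also have "\<dots> = dot p v v * (t\<^sup>2 * dot p ?w ?w)" by simp
  also have "\<dots> \<le> (dot p v v)\<^sup>2"
    using resolvent_norm[of v] dot_self_nonneg[of p v] by (simp add: power2_eq_square mult_left_mono)
  finally show ?thesis using dot_self_nonneg[of p v] by (rule power2_le_imp_le)
qed

lemma resolvent_diag_bounds:
  assumes "i < p" shows "0 \<le> R i i" "R i i \<le> 1 / t"
proof -
  let ?e = "\<lambda>l. if l = i then 1 else (0::real)"
  have "dot p ?e (mat_app p R ?e) = R i i"
    using assms by (subst dot_commute) (simp add: dot_unit mat_app_unit)
  moreover have "dot p ?e ?e = 1" using assms by (simp add: dot_unit)
  ultimately show "0 \<le> R i i" "R i i \<le> 1 / t"
    using resolvent_quadratic_nonneg[of ?e] resolvent_quadratic_le[of ?e] t by (auto simp: field_simps)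
qed

lemma resolvent_col_norm:
  assumes "j < p" shows "(\<Sum>i<p. (R i j)\<^sup>2) \<le> 1 / t\<^sup>2"
proof -
  let ?e = "\<lambda>l. if l = j then 1 else (0::real)"
  have "dot p (mat_app p R ?e) (mat_app p R ?e) = (\<Sum>i<p. (R i j)\<^sup>2)"
    using assms unfolding dot_def by (simp add: mat_app_unit power2_eq_square)
  moreover have "dot p ?e ?e = 1" using assms by (simp add: dot_unit)
  ultimately show ?thesis using resolvent_norm[of ?e] t by (simp add: field_simps)
qed

lemma resolvent_entry_bound:
  assumes "i < p" "j < p" shows "\<bar>R i j\<bar> \<le> 1 / t"
proof -
  have "(R i j)\<^sup>2 \<le> (\<Sum>i<p. (R i j)\<^sup>2)"
    using assms by (intro member_le_sum) auto
  also have "\<dots> \<le> 1 / t\<^sup>2" using assms by (intro resolvent_col_norm)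
  finally have "\<bar>R i j\<bar>\<^sup>2 \<le> (1 / t)\<^sup>2" by (simp add: power_divide)
  then show ?thesis by (rule power2_le_imp_le) (use t in simp)
qed

lemma resolvent_trace_bounds: "0 \<le> mat_tr p R" "mat_tr p R \<le> real p / t"
proof -
  show "0 \<le> mat_tr p R" unfolding mat_tr_def by (intro sum_nonneg) (auto simp: resolvent_diag_bounds)
  have "mat_tr p R \<le> (\<Sum>i<p. 1 / t)" unfolding mat_tr_def by (intro sum_mono) (auto simp: resolvent_diag_bounds)
  then show "mat_tr p R \<le> real p / t" by simp
qed

text \<open>Both sides are the trace of the operator composed with its inverse, evaluated on unit
  vectors; each rank one term contributes its quadratic form in \<open>R\<close>.\<close>

lemma resolvent_trace_identity:
  "t * mat_tr p R + (\<Sum>k<n. dot p (Y k) (mat_app p R (Y k))) = real p"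
proof -
  let ?e = "\<lambda>j l. if l = j then 1 else (0::real)"
  have "real p = (\<Sum>i<p. gram_op p t Y n (mat_app p R (?e i)) i)"
    by (simp add: resolvent_right_inv)
  also have "\<dots> = (\<Sum>i<p. t * R i i + (\<Sum>k<n. Y k i * (\<Sum>j<p. Y k j * R j i)))"
    by (intro sum.cong refl) (simp add: gram_op_def dot_def mat_app_unit)
  also have "\<dots> = t * mat_tr p R + (\<Sum>k<n. \<Sum>i<p. Y k i * (\<Sum>j<p. Y k j * R j i))"
    by (subst sum.swap) (simp add: sum.distrib mat_tr_def sum_distrib_left)
  also have "(\<Sum>k<n. \<Sum>i<p. Y k i * (\<Sum>j<p. Y k j * R j i)) = (\<Sum>k<n. dot p (Y k) (mat_app p R (Y k)))"
    unfolding dot_def mat_app_def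
    by (intro sum.cong refl) (use resolvent_sym in \<open>auto intro!: sum.cong simp: mult.commute\<close>)
  finally show ?thesis by simp
qed

text \<open>Sherman--Morrison. The hypothesis only asks that the two operators differ by the rank
  one term of \<open>y\<close>, so that it covers both appending a new column and restoring a column
  that was set to zero.\<close>

lemma rank_one_update_right_inv:
  assumes upd: "\<And>w i. i < p \<Longrightarrow> gram_op p t Y' n' w i = gram_op p t Y n w i + y i * dot p y w"
  shows "is_resolvent p t Y' n' (rank_one_update p R y)"
proof -
  let ?u = "mat_app p R y" and ?a = "dot p y (mat_app p R y)" and ?R = "rank_one_update p R y"
  have a: "1 + ?a \<noteq> 0" using resolvent_quadratic_nonneg[of y] by simp
  have mat_app: "mat_app p ?R v = (\<lambda>i. mat_app p R v i - (dot p ?u v / (1 + ?a)) * ?u i)" for v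
    by (rule ext) (rule mat_app_rank_one_update)
  have "gram_op p t Y' n' (mat_app p ?R v) i = v i" if i: "i < p" for v i
  proof -
    have ring: "(x - c * b) + b * (d - c * a) = x + b * (d - c * (1 + a))" for x c b d a :: real
      by (simp add: algebra_simps)
    have ring2: "g + b * d - c * (g' + b * a) = g - c * g' + b * (d - c * a)" for g g' c b d a :: real
      by (simp add: algebra_simps)
    have yv: "dot p y (mat_app p R v) = dot p ?u v"
      by (rule mat_app_sym_ip) (rule resolvent_sym)
    have "gram_op p t Y' n' (mat_app p ?R v) i
        = (gram_op p t Y n (mat_app p R v) i - (dot p ?u v / (1 + ?a)) * gram_op p t Y n ?u i)
          + y i * (dot p y (mat_app p R v) - (dot p ?u v / (1 + ?a)) * ?a)"
      unfolding upd[OF i] mat_app gram_op_diff gram_op_scale dot_diff_right dot_scale_right by (rule ring2)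
    also have "\<dots> = (v i - (dot p ?u v / (1 + ?a)) * y i) + y i * (dot p ?u v - (dot p ?u v / (1 + ?a)) * ?a)"
      unfolding yv resolvent_right_inv[OF i] ..
    also have "\<dots> = v i + y i * (dot p ?u v - (dot p ?u v / (1 + ?a)) * (1 + ?a))"
      by (rule ring)
    also have "\<dots> = v i" using a by simp
    finally show ?thesis .
  qed
  moreover have "?R i j = ?R j i" if "i < p" "j < p" for i j
    using resolvent_sym[OF that] by (simp add: rank_one_update_def mult.commute)
  ultimately show ?thesis by (simp add: is_resolvent_def)
qed

end

section \<open>Existence, uniqueness and removal of one column\<close>

lemma is_resolvent_resolvent:
  assumes "t > 0" shows "is_resolvent p t Y n (resolvent p t Y n)"
proof (induction n)
  case 0
  have "mat_app p (\<lambda>i j. if i = j then 1 / t else 0) v i = v i / t" if "i < p" for v i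
  proof -
    have "mat_app p (\<lambda>i j. if i = j then 1 / t else 0) v i = (\<Sum>j<p. if i = j then v j / t else 0)"
      unfolding mat_app_def by (intro sum.cong) auto
    then show ?thesis using that by (simp add: sum.delta)
  qed
  then show ?case using assms by (simp add: is_resolvent_def gram_op_def)
next
  case (Suc n)
  have "is_resolvent p t Y (Suc n) (rank_one_update p (resolvent p t Y n) (Y n))"
    by (rule rank_one_update_right_inv[OF assms Suc]) (simp add: gram_op_def)
  then show ?case by simp
qed

lemma is_resolvent_cong:
  assumes "is_resolvent p t Y n R" "\<And>k i. k < n \<Longrightarrow> i < p \<Longrightarrow> Y k i = Y' k i"
  shows "is_resolvent p t Y' n R"
proof -
  have "gram_op p t Y' n v i = gram_op p t Y n v i" if "i < p" for v i
    using assms(2) that by (simp add: gram_op_def dot_def)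
  then show ?thesis using assms(1) by (simp add: is_resolvent_def)
qed

lemma is_resolvent_unique:
  assumes "t > 0" "is_resolvent p t Y n R" "is_resolvent p t Y n R'" "i < p" "j < p"
  shows "R i j = R' i j"
  using resolvent_unique[OF assms(1,3) resolvent_right_inv[OF assms(1,2)] assms(4), of "\<lambda>l. if l = j then 1 else 0"]
    assms(5) by (simp add: mat_app_unit)

lemma resolvent_fn_cong:
  assumes "t > 0" "\<And>k i. k < n \<Longrightarrow> i < p \<Longrightarrow> Y k i = Y' k i" "i < p" "j < p"
  shows "resolvent p t Y n i j = resolvent p t Y' n i j"
  by (rule is_resolvent_unique[OF assms(1) is_resolvent_cong[OF is_resolvent_resolvent[OF assms(1)]] is_resolvent_resolvent[OF assms(1)]])
     (use assms in auto)

text \<open>Leaving out column \<open>k\<close> is expressed by replacing it with zero.\<close>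

lemma gram_op_drop_column:
  assumes "k < n"
  shows "gram_op p t Y n w i = gram_op p t (Y(k := \<lambda>_. 0)) n w i + Y k i * dot p (Y k) w"
  using assms by (simp add: gram_op_def sum.remove[of "{..<n}" k])

text \<open>The recursion inserts the columns in a fixed order, yet both sides are resolvents of the
  same operator. Uniqueness thus allows any column to be treated as if it had been inserted
  last.\<close>

lemma resolvent_fn_drop_column:
  assumes t: "t > 0" and "k < n" "i < p" "j < p"
  shows "resolvent p t Y n i j = rank_one_update p (resolvent p t (Y(k := \<lambda>_. 0)) n) (Y k) i j"
  by (rule is_resolvent_unique[OF t is_resolvent_resolvent[OF t]
      rank_one_update_right_inv[OF t is_resolvent_resolvent[OF t] gram_op_drop_column[OF \<open>k < n\<close>]]]) fact+

text \<open>With \<open>y\<close> the column and \<open>a = <y, R y>\<close> the difference equals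
  \<open>|R y|^2 / (1 + a)\<close>. Since \<open>t |R y|^2 <= a\<close>, it is at most
  \<open>a / (t (1 + a))\<close>, hence below \<open>1 / t\<close> however large the column
  is.\<close>

lemma resolvent_fn_drop_column_trace:
  assumes t: "t > 0" and k: "k < n"
  shows "0 \<le> mat_tr p (resolvent p t (Y(k := \<lambda>_. 0)) n) - mat_tr p (resolvent p t Y n)"
    and "mat_tr p (resolvent p t (Y(k := \<lambda>_. 0)) n) - mat_tr p (resolvent p t Y n) \<le> 1 / t"
proof -
  define R where "R = resolvent p t (Y(k := \<lambda>_. 0)) n"
  have R: "is_resolvent p t (Y(k := \<lambda>_. 0)) n R" unfolding R_def by (rule is_resolvent_resolvent[OF t])
  define a where "a = dot p (Y k) (mat_app p R (Y k))"
  have a: "a \<ge> 0" unfolding a_def by (rule resolvent_quadratic_nonneg[OF t R])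
  have q: "t * dot p (mat_app p R (Y k)) (mat_app p R (Y k)) \<le> a"
    unfolding a_def by (rule resolvent_quadratic[OF t R])
  have "mat_tr p (resolvent p t Y n) = (\<Sum>i<p. rank_one_update p R (Y k) i i)"
    unfolding mat_tr_def R_def by (intro sum.cong refl resolvent_fn_drop_column[OF t k]) auto
  also have "\<dots> = mat_tr p R - dot p (mat_app p R (Y k)) (mat_app p R (Y k)) / (1 + a)"
    by (simp add: rank_one_update_def mat_tr_def sum_subtractf dot_def[of p "mat_app p R (Y k)"] sum_divide_distrib a_def)
  finally have eq: "mat_tr p R - mat_tr p (resolvent p t Y n) = dot p (mat_app p R (Y k)) (mat_app p R (Y k)) / (1 + a)" by simp
  show "0 \<le> mat_tr p (resolvent p t (Y(k := \<lambda>_. 0)) n) - mat_tr p (resolvent p t Y n)"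
    unfolding R_def[symmetric] eq using a by (simp add: dot_self_nonneg)
  show "mat_tr p (resolvent p t (Y(k := \<lambda>_. 0)) n) - mat_tr p (resolvent p t Y n) \<le> 1 / t"
    unfolding R_def[symmetric] eq using a q t by (simp add: field_simps)
qed

text \<open>The update turns the form into \<open>a - a^2 / (1 + a)\<close>. Each summand of the
  trace identity is thereby expressed through \<open>a\<close>, whose matrix does not involve the
  column \<open>Y k\<close>.\<close>

lemma resolvent_fn_drop_column_quadratic:
  fixes p :: nat and Y :: "nat \<Rightarrow> nat \<Rightarrow> real"
  assumes t: "t > 0" and k: "k < n"
  defines "a \<equiv> dot p (Y k) (mat_app p (resolvent p t (Y(k := \<lambda>_. 0)) n) (Y k))"
  shows "dot p (Y k) (mat_app p (resolvent p t Y n) (Y k)) = a / (1 + a)"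
proof -
  define R where "R = resolvent p t (Y(k := \<lambda>_. 0)) n"
  have R: "is_resolvent p t (Y(k := \<lambda>_. 0)) n R" unfolding R_def by (rule is_resolvent_resolvent[OF t])
  have a: "a \<ge> 0" unfolding a_def R_def[symmetric] by (rule resolvent_quadratic_nonneg[OF t R])
  have drop: "resolvent p t Y n i j = rank_one_update p R (Y k) i j" if "i < p" "j < p" for i j
    unfolding R_def by (rule resolvent_fn_drop_column[OF t k that])
  have "dot p (Y k) (mat_app p (resolvent p t Y n) (Y k)) = dot p (Y k) (mat_app p (rank_one_update p R (Y k)) (Y k))"
    unfolding mat_app_def by (intro dot_cong refl sum.cong arg_cong2[where f = "(*)"] drop) auto
  also have "mat_app p (rank_one_update p R (Y k)) (Y k) = (\<lambda>i. mat_app p R (Y k) i - (a / (1 + a)) * mat_app p R (Y k) i)"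
    by (rule ext) (simp add: mat_app_rank_one_update a_def R_def dot_commute[of p _ "Y k"])
  finally have "dot p (Y k) (mat_app p (resolvent p t Y n) (Y k)) = a - (a / (1 + a)) * a"
    unfolding dot_diff_right dot_scale_right by (simp add: a_def R_def)
  then show ?thesis using a by (simp add: field_simps)
qed

text \<open>The two matrices coincide once column \<open>k\<close> is removed, and both traces lie
  within \<open>1 / t\<close> below that common trace.\<close>

lemma resolvent_fn_change_column_trace:
  assumes t: "t > 0" and k: "k < n"
  shows "\<bar>mat_tr p (resolvent p t (Y(k := y)) n) - mat_tr p (resolvent p t Y n)\<bar> \<le> 1 / t"
  using resolvent_fn_drop_column_trace[OF t k, of p Y] resolvent_fn_drop_column_trace[OF t k, of p "Y(k := y)"] by simp

lemma measurable_resolvent: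
  assumes Y: "\<And>k i. k < n \<Longrightarrow> i < p \<Longrightarrow> (\<lambda>x. Y x k i) \<in> borel_measurable N" and ij: "i < p" "j < p"
  shows "(\<lambda>x. resolvent p t (Y x) n i j) \<in> borel_measurable N"
proof -
  have "(\<lambda>x. resolvent p t (Y x) l i j) \<in> borel_measurable N" if "l \<le> n" "i < p" "j < p" for l i j
    using that
  proof (induction l arbitrary: i j)
    case 0
    then show ?case by simp
  next
    case (Suc l)
    define S where "S = (\<lambda>x. resolvent p t (Y x) l)"
    have IH: "(\<lambda>x. S x i j) \<in> borel_measurable N" if "i < p" "j < p" for i j
      unfolding S_def using Suc.IH[OF _ that] Suc.prems(1) by simp
    have Yl: "(\<lambda>x. Y x l i) \<in> borel_measurable N" if "i < p" for i
      by (rule Y[OF _ that]) (use Suc.prems(1) in simp)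
    define u where "u = (\<lambda>x. mat_app p (S x) (Y x l))"
    have u: "(\<lambda>x. u x i) \<in> borel_measurable N" if "i < p" for i
      unfolding u_def mat_app_def by (intro borel_measurable_sum borel_measurable_times IH[OF that] Yl) auto
    define a where "a = (\<lambda>x. dot p (Y x l) (u x))"
    have a: "a \<in> borel_measurable N"
      unfolding a_def dot_def by (intro borel_measurable_sum borel_measurable_times u Yl) auto
    note [measurable] = IH[OF Suc.prems(2,3)] u[OF Suc.prems(2)] u[OF Suc.prems(3)] a
    have "(\<lambda>x. S x i j - u x i * u x j / (1 + a x)) \<in> borel_measurable N" by measurable
    then show ?case by (simp add: rank_one_update_def S_def u_def a_def)
  qed
  from this[OF order_refl ij] show ?thesis .
qed

section \<open>Empirical spectral measure\<close>

lemma sample_cov_carrier: "sample_cov p m X \<in> carrier_mat p p"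
  by (simp add: sample_cov_def)

lemma sample_cov_index:
  "i < p \<Longrightarrow> j < p \<Longrightarrow> sample_cov p m X $$ (i, j) = (\<Sum>k<m. X i k / sqrt m * (X j k / sqrt m))"
  by (simp add: sample_cov_def sum_divide_distrib)

text \<open>A Rayleigh quotient. Pairing the eigenvector equation with \<open>v\<close> gives
  \<open>a N = q\<close>, where \<open>N\<close> is the squared norm of \<open>v\<close> and
  \<open>q\<close> that of the transpose of \<open>X / sqrt m\<close> applied to
  \<open>v\<close>.\<close>

lemma complex_eigenvalue_sample_cov:
  fixes a :: complex
  assumes ev: "eigenvalue (map_mat complex_of_real (sample_cov p m X)) a"
  shows "\<exists>e\<ge>0. a = complex_of_real e"
proof -
  let ?A = "map_mat complex_of_real (sample_cov p m X)"
  have A: "?A \<in> carrier_mat p p" by (simp add: sample_cov_def)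
  obtain v where v: "v \<in> carrier_vec p" "v \<noteq> 0\<^sub>v p" and Av: "?A *\<^sub>v v = a \<cdot>\<^sub>v v"
    using ev A unfolding eigenvalue_def eigenvector_def by (metis carrier_matD(1))
  define y where "y = (\<lambda>k i. complex_of_real (X i k / sqrt m))"
  define N where "N = (\<Sum>i<p. (cmod (v $ i))\<^sup>2)"
  define q where "q = (\<Sum>k<m. (cmod (\<Sum>i<p. y k i * v $ i))\<^sup>2)"
  have N: "N > 0"
  proof -
    obtain i where i: "i < p" "v $ i \<noteq> 0"
      using v by (metis carrier_vecD eq_vecI index_zero_vec(1) index_zero_vec(2))
    have "0 < (cmod (v $ i))\<^sup>2" using i by simp
    also have "\<dots> \<le> N" unfolding N_def using i by (intro member_le_sum) auto
    finally show ?thesis .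
  qed
  have row: "(\<Sum>j<p. (\<Sum>k<m. y k i * y k j) * v $ j) = a * v $ i" if i: "i < p" for i
  proof -
    have "(?A *\<^sub>v v) $ i = (\<Sum>j<p. ?A $$ (i, j) * v $ j)"
      using i v A by (simp add: mult_mat_vec_def scalar_prod_def atLeast0LessThan sample_cov_carrier[THEN carrier_matD(1)] sample_cov_carrier[THEN carrier_matD(2)])
    also have "\<dots> = (\<Sum>j<p. (\<Sum>k<m. y k i * y k j) * v $ j)"
    proof (intro sum.cong refl arg_cong2[where f = "(*)"])
      fix j assume j: "j \<in> {..<p}"
      have "?A $$ (i, j) = complex_of_real (sample_cov p m X $$ (i, j))"
        using i j sample_cov_carrier[of p m X] by (intro index_map_mat(1)) auto
      also have "\<dots> = (\<Sum>k<m. y k i * y k j)"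
        unfolding sample_cov_index[OF i j[unfolded lessThan_iff]] y_def by (simp only: of_real_sum of_real_mult)
      finally show "?A $$ (i, j) = (\<Sum>k<m. y k i * y k j)" .
    qed
    finally show ?thesis using i v unfolding Av by simp
  qed
  have "a * complex_of_real N = (\<Sum>i<p. cnj (v $ i) * (a * v $ i))"
    unfolding N_def of_real_sum complex_norm_square sum_distrib_left by (intro sum.cong refl) (simp add: mult_ac)
  also have "\<dots> = (\<Sum>i<p. cnj (v $ i) * (\<Sum>j<p. (\<Sum>k<m. y k i * y k j) * v $ j))"
    by (intro sum.cong refl) (simp add: row)
  also have "\<dots> = (\<Sum>i<p. \<Sum>j<p. \<Sum>k<m. cnj (v $ i) * y k i * (y k j * v $ j))"
    by (simp add: sum_distrib_left sum_distrib_right mult_ac)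
  also have "\<dots> = (\<Sum>i<p. \<Sum>k<m. \<Sum>j<p. cnj (v $ i) * y k i * (y k j * v $ j))"
    by (intro sum.cong refl sum.swap)
  also have "\<dots> = (\<Sum>k<m. \<Sum>i<p. \<Sum>j<p. cnj (v $ i) * y k i * (y k j * v $ j))"
    by (rule sum.swap)
  also have "\<dots> = (\<Sum>k<m. cnj (\<Sum>i<p. y k i * v $ i) * (\<Sum>j<p. y k j * v $ j))"
    unfolding sum_product cnj_sum by (intro sum.cong refl) (simp add: y_def)
  also have "\<dots> = complex_of_real q"
    unfolding q_def of_real_sum complex_norm_square by (intro sum.cong refl) (simp add: mult_ac)
  finally have "a = complex_of_real (q / N)" using N by (simp add: field_simps)
  moreover have "q / N \<ge> 0" using N by (auto simp: q_def intro!: divide_nonneg_pos sum_nonneg)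
  ultimately show ?thesis by blast
qed

text \<open>The characteristic polynomial factors over the complex numbers, its roots are real by
  the preceding lemma, and the factorization descends because the embedding of real polynomials is
  injective.\<close>

lemma char_poly_sample_cov_splits:
  obtains es where "length es = p" "\<And>e. e \<in> set es \<Longrightarrow> 0 \<le> e"
    "char_poly (sample_cov p m X) = (\<Prod>e\<leftarrow>es. [:- e, 1:])"
proof -
  let ?A = "map_mat complex_of_real (sample_cov p m X)"
  have A: "?A \<in> carrier_mat p p" by (simp add: sample_cov_def)
  obtain as where as: "char_poly ?A = (\<Prod>a\<leftarrow>as. [:- a, 1:])" "length as = p"
    using char_poly_factorized[OF A] by blast
  have "\<exists>e\<ge>0. a = complex_of_real e" if "a \<in> set as" for a
  proof (rule complex_eigenvalue_sample_cov)
    have "poly (char_poly ?A) a = 0"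
      unfolding as using that by (auto simp: poly_prod_list prod_list_zero_iff)
    then show "eigenvalue ?A a" using eigenvalue_root_char_poly[OF A] by simp
  qed
  then obtain f where f: "\<And>a. a \<in> set as \<Longrightarrow> f a \<ge> 0 \<and> a = complex_of_real (f a)" by metis
  let ?es = "map f as"
  interpret h: map_poly_inj_comm_ring_hom complex_of_real ..
  have "map complex_of_real ?es = as" using f by (auto intro!: map_idI simp: comp_def)
  then have "map_poly complex_of_real (char_poly (sample_cov p m X)) = (\<Prod>a\<leftarrow>map complex_of_real ?es. [:- a, 1:])"
    using as of_real_hom.char_poly_hom[OF sample_cov_carrier] by metis
  also have "\<dots> = map_poly complex_of_real (\<Prod>e\<leftarrow>?es. [:- e, 1:])"
    by (simp add: h.hom_prod_list o_def)
  finally have "char_poly (sample_cov p m X) = (\<Prod>e\<leftarrow>?es. [:- e, 1:])" by simp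
  then show ?thesis using f as(2) by (intro that[of ?es]) auto
qed

lemma trace_mult_commute:
  fixes U V :: "real mat"
  assumes "U \<in> carrier_mat p p" "V \<in> carrier_mat p p"
  shows "(\<Sum>i<p. (U * V) $$ (i, i)) = (\<Sum>i<p. (V * U) $$ (i, i))"
proof -
  have "(\<Sum>i<p. (U * V) $$ (i, i)) = (\<Sum>i<p. \<Sum>j<p. U $$ (i, j) * V $$ (j, i))"
    using assms by (simp add: scalar_prod_def atLeast0LessThan)
  also have "\<dots> = (\<Sum>j<p. \<Sum>i<p. U $$ (i, j) * V $$ (j, i))" by (rule sum.swap)
  also have "\<dots> = (\<Sum>i<p. (V * U) $$ (i, i))"
    using assms by (simp add: scalar_prod_def atLeast0LessThan mult.commute)
  finally show ?thesis .
qed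

text \<open>Back substitution from the last row upwards shows that \<open>S\<close> vanishes below
  the diagonal. Then only one product survives in each diagonal entry of
  \<open>T * S\<close>.\<close>

lemma upper_triangular_inverse_diag:
  fixes T S :: "real mat"
  assumes T: "T \<in> carrier_mat p p" and S: "S \<in> carrier_mat p p" and ut: "upper_triangular T"
    and inv: "T * S = 1\<^sub>m p" and nz: "\<And>i. i < p \<Longrightarrow> T $$ (i, i) \<noteq> 0" and i: "i < p"
  shows "S $$ (i, i) = 1 / T $$ (i, i)"
proof -
  have row: "(\<Sum>l<p. T $$ (i, l) * S $$ (l, j)) = (if i = j then 1 else 0)" if "i < p" "j < p" for i j
  proof -
    have "(T * S) $$ (i, j) = (\<Sum>l<p. T $$ (i, l) * S $$ (l, j))"
      using that T S by (simp add: scalar_prod_def atLeast0LessThan)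
    then show ?thesis using that unfolding inv by simp
  qed
  have collapse: "(\<Sum>l<p. T $$ (i, l) * S $$ (l, j)) = T $$ (i, i) * S $$ (i, j)"
    if "i < p" "\<And>l. i < l \<Longrightarrow> l < p \<Longrightarrow> S $$ (l, j) = 0" for i j
  proof -
    have "T $$ (i, l) * S $$ (l, j) = 0" if l: "l \<in> {..<p} - {i}" for l
    proof (cases "l < i")
      case True
      then show ?thesis using ut T \<open>i < p\<close> unfolding upper_triangular_def by auto
    next
      case False
      then show ?thesis using l that(1) \<open>\<And>l. i < l \<Longrightarrow> l < p \<Longrightarrow> S $$ (l, j) = 0\<close> by auto
    qed
    then have "(\<Sum>l\<in>{..<p} - {i}. T $$ (i, l) * S $$ (l, j)) = 0" by (intro sum.neutral) blast
    then show ?thesis using \<open>i < p\<close> by (subst sum.remove[of _ i]) auto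
  qed
  have low: "S $$ (i, j) = 0" if "j < i" "i < p" for i j
    using that
  proof (induction "p - i" arbitrary: i rule: less_induct)
    case less
    have "T $$ (i, i) * S $$ (i, j) = 0"
      using row[of i j] collapse[of i j] less by auto
    then show ?case using nz[of i] less.prems by simp
  qed
  have "T $$ (i, i) * S $$ (i, i) = 1"
    using row[OF i i] collapse[OF i, of i] low by auto
  then show ?thesis using nz[OF i] by (simp add: field_simps)
qed

text \<open>Triangularization is enough: with \<open>A = P T Q\<close> and \<open>es\<close> on the
  diagonal of \<open>T\<close>, conjugating the inverse of \<open>A + t\<close> yields an inverse of
  the triangular matrix \<open>T + t\<close>. Its diagonal is known and the conjugation preserves
  the trace.\<close>

lemma trace_resolvent_eigenvalues:
  assumes t: "t > 0" and es: "char_poly (sample_cov p m X) = (\<Prod>e\<leftarrow>es. [:- e, 1:])"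
    and nonneg: "\<And>e. e \<in> set es \<Longrightarrow> 0 \<le> e"
  shows "(\<Sum>e\<leftarrow>es. 1 / (e + t)) = mat_tr p (resolvent p t (\<lambda>k i. X i k / sqrt m) m)"
proof -
  define Y where "Y = (\<lambda>k i. X i k / sqrt m)"
  define R where "R = resolvent p t Y m"
  have isR: "is_resolvent p t Y m R" unfolding R_def by (rule is_resolvent_resolvent[OF t])
  let ?A = "sample_cov p m X"
  have A: "?A \<in> carrier_mat p p" by (rule sample_cov_carrier)
  define Rm where "Rm = mat p p (\<lambda>(i, j). R i j)"
  have Rm: "Rm \<in> carrier_mat p p" by (simp add: Rm_def)
  define At where "At = ?A + t \<cdot>\<^sub>m 1\<^sub>m p"
  have At: "At \<in> carrier_mat p p" using A by (simp add: At_def)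
  have inv: "At * Rm = 1\<^sub>m p"
  proof (rule eq_matI)
    fix i l assume "i < dim_row (1\<^sub>m p :: real mat)" "l < dim_col (1\<^sub>m p :: real mat)"
    then have il: "i < p" "l < p" by auto
    let ?e = "\<lambda>j. if j = l then 1 else (0::real)"
    have "(At * Rm) $$ (i, l) = (\<Sum>j<p. At $$ (i, j) * Rm $$ (j, l))"
      using il A Rm by (simp add: At_def scalar_prod_def atLeast0LessThan eq_commute[of i])
    also have "\<dots> = (\<Sum>j<p. (\<Sum>k<m. Y k i * Y k j) * R j l + (if i = j then t * R j l else 0))"
    proof (rule sum.cong[OF refl])
      fix j assume "j \<in> {..<p}"
      then have j: "j < p" by simp
      have "At $$ (i, j) = (\<Sum>k<m. Y k i * Y k j) + (if i = j then t else 0)"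
        using il j A sample_cov_index[OF il(1) j, of m X] by (simp add: Y_def At_def)
      then show "At $$ (i, j) * Rm $$ (j, l) = (\<Sum>k<m. Y k i * Y k j) * R j l + (if i = j then t * R j l else 0)"
        using il j by (simp add: Rm_def algebra_simps)
    qed
    also have "\<dots> = t * R i l + (\<Sum>j<p. \<Sum>k<m. Y k i * (Y k j * R j l))"
      using il by (simp add: sum.distrib sum_distrib_right sum_distrib_left mult_ac)
    also have "(\<Sum>j<p. \<Sum>k<m. Y k i * (Y k j * R j l)) = (\<Sum>k<m. Y k i * dot p (Y k) (mat_app p R ?e))"
      using il by (subst sum.swap) (simp add: dot_def mat_app_unit sum_distrib_left)
    also have "t * R i l + \<dots> = gram_op p t Y m (mat_app p R ?e) i"
      using il by (simp add: gram_op_def mat_app_unit)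
    also have "\<dots> = ?e i" by (rule resolvent_right_inv[OF t isR il(1)])
    finally show "(At * Rm) $$ (i, l) = 1\<^sub>m p $$ (i, l)" using il by simp
  qed (use At in \<open>auto simp: Rm_def\<close>)
  obtain T P Q where schur: "schur_decomposition ?A es = (T, P, Q)" by (cases "schur_decomposition ?A es") auto
  note sd = schur_decomposition[OF A es schur]
  have sim: "similar_mat_wit ?A T P Q" and ut: "upper_triangular T" and diag: "diag_mat T = es" using sd by auto
  note w = similar_mat_witD2[OF A sim]
  have T: "T \<in> carrier_mat p p" and P: "P \<in> carrier_mat p p" and Q: "Q \<in> carrier_mat p p"
    and PQ: "P * Q = 1\<^sub>m p" and QP: "Q * P = 1\<^sub>m p" and APTQ: "?A = P * T * Q" using w by auto
  define Tt where "Tt = T + t \<cdot>\<^sub>m 1\<^sub>m p"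
  have Tt: "Tt \<in> carrier_mat p p" using T by (simp add: Tt_def)
  have At_eq: "At = P * Tt * Q"
  proof -
    have "P * Tt * Q = (P * T + P * (t \<cdot>\<^sub>m 1\<^sub>m p)) * Q"
      unfolding Tt_def using P T by (subst mult_add_distrib_mat[of _ p p _ p]) auto
    also have "\<dots> = P * T * Q + P * (t \<cdot>\<^sub>m 1\<^sub>m p) * Q"
      using P T Q by (subst add_mult_distrib_mat[of _ p p _ _ p]) auto
    also have "P * (t \<cdot>\<^sub>m 1\<^sub>m p) = t \<cdot>\<^sub>m P" using P by (subst mult_smult_distrib[of _ p p _ p]) auto
    also have "(t \<cdot>\<^sub>m P) * Q = t \<cdot>\<^sub>m 1\<^sub>m p" using P Q PQ by (subst mult_smult_assoc_mat[of _ p p _ p]) auto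
    finally show ?thesis using APTQ by (simp add: At_def)
  qed
  define S where "S = Q * (Rm * P)"
  have S: "S \<in> carrier_mat p p" using Q Rm P by (simp add: S_def)
  have TS: "Tt * S = 1\<^sub>m p"
  proof -
    have Tt_eq: "Tt = Q * At * P"
    proof -
      have "Q * At * P = Q * (P * Tt * Q) * P" unfolding At_eq ..
      also have "\<dots> = (Q * P) * Tt * (Q * P)"
        using P Q Tt by (simp add: assoc_mult_mat[of _ p p _ p _ p])
      finally show ?thesis using QP Tt by simp
    qed
    have "Tt * S = Q * At * P * (Q * (Rm * P))" unfolding S_def by (subst Tt_eq) simp
    also have "\<dots> = Q * At * ((P * Q) * (Rm * P))"
      using P Q At Rm by (simp add: assoc_mult_mat[of _ p p _ p _ p])
    also have "\<dots> = Q * ((At * Rm) * P)"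
      unfolding PQ using P Q At Rm by (simp add: assoc_mult_mat[of _ p p _ p _ p])
    also have "\<dots> = 1\<^sub>m p" unfolding inv using P QP by simp
    finally show ?thesis .
  qed
  have Tdiag: "T $$ (i, i) = es ! i" if "i < p" for i
    using diag that T by (auto simp: diag_mat_def)
  have len: "length es = p" using diag T by (auto simp: diag_mat_def)
  have Sd: "S $$ (i, i) = 1 / (es ! i + t)" if i: "i < p" for i
  proof -
    have "S $$ (i, i) = 1 / Tt $$ (i, i)"
    proof (rule upper_triangular_inverse_diag[OF Tt S _ TS _ i])
      show "upper_triangular Tt" using ut T unfolding Tt_def upper_triangular_def by auto
      show "Tt $$ (i, i) \<noteq> 0" if "i < p" for i
        unfolding Tt_def using that T Tdiag[OF that] nonneg[of "es ! i"] t len by simp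
    qed
    then show ?thesis unfolding Tt_def using i T Tdiag by simp
  qed
  have "mat_tr p R = (\<Sum>i<p. Rm $$ (i, i))" by (simp add: mat_tr_def Rm_def)
  also have "\<dots> = (\<Sum>i<p. ((Rm * P) * Q) $$ (i, i))"
    using Rm P Q PQ by (simp add: assoc_mult_mat[of _ p p _ p _ p])
  also have "\<dots> = (\<Sum>i<p. S $$ (i, i))"
    unfolding S_def using Rm P Q by (intro trace_mult_commute) auto
  also have "\<dots> = (\<Sum>i<p. 1 / (es ! i + t))" by (intro sum.cong) (auto simp: Sd)
  also have "\<dots> = (\<Sum>e\<leftarrow>es. 1 / (e + t))"
    by (simp add: sum_list_sum_nth len atLeast0LessThan)
  finally show ?thesis unfolding R_def Y_def ..
qed

lemma order_linear_factors:
  fixes a :: real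
  shows "Polynomial.order a (\<Prod>e\<leftarrow>es. [:- e, 1:]) = count_list es a"
proof (induction es)
  case (Cons e es)
  have "(\<Prod>e\<leftarrow>es. [:- e, 1::real:]) \<noteq> 0" by (auto simp: prod_list_zero_iff)
  then have "Polynomial.order a (\<Prod>e\<leftarrow>e # es. [:- e, 1:]) = Polynomial.order a [:- e, 1:] + Polynomial.order a (\<Prod>e\<leftarrow>es. [:- e, 1:])"
    by (simp only: list.map prod_list.Cons) (intro order_mult, simp only: mult_eq_0_iff, simp)
  also have "Polynomial.order a [:- e, 1:] = (if e = a then 1 else 0)"
    using order_power_n_n[of a 1] by (auto intro!: order_0I)
  finally show ?case using Cons by simp
qed (simp add: order_0I)

text \<open>\<open>esd\<close> adds multiplicities over the distinct roots. The multiplicity of a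
  root is its number of repetitions in \<open>es\<close>, so the sum counts list positions.\<close>

lemma esd_eq_count:
  assumes A: "A \<in> carrier_mat p p" and es: "char_poly A = (\<Prod>e\<leftarrow>es. [:- e, 1:])"
  shows "esd A x = real (length (filter (\<lambda>e. e \<le> x) es)) / real p"
proof -
  have root: "poly (char_poly A) a = 0 \<longleftrightarrow> a \<in> set es" for a
    unfolding es by (auto simp: poly_prod_list prod_list_zero_iff)
  have "(\<Sum>a\<in>{a. a \<le> x \<and> poly (char_poly A) a = 0}. Polynomial.order a (char_poly A)) = (\<Sum>a\<in>{a \<in> set es. a \<le> x}. count_list es a)"
    unfolding root unfolding es order_linear_factors by (intro sum.cong) auto
  also have "\<dots> = (\<Sum>a\<in>set (filter (\<lambda>e. e \<le> x) es). count_list (filter (\<lambda>e. e \<le> x) es) a)"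
  proof (rule sum.cong)
    fix a assume "a \<in> set (filter (\<lambda>e. e \<le> x) es)"
    then have "a \<le> x" by simp
    then show "count_list es a = count_list (filter (\<lambda>e. e \<le> x) es) a"
      by (induction es) auto
  qed auto
  also have "\<dots> = length (filter (\<lambda>e. e \<le> x) es)" by (rule sum_count_set) auto
  finally show ?thesis using A by (simp add: esd_def)
qed

text \<open>The measure is the image of the uniform law on the positions of the eigenvalue list, so
  repeated eigenvalues get the right weight. It is the bridge from \<open>esd\<close>, its
  distribution function, to the resolvent trace, its Stieltjes transform.\<close>

lemma empirical_measure_sample_cov:
  assumes p: "p > 0"
  obtains \<mu> where "real_distribution \<mu>" "AE x in \<mu>. 0 \<le> x" "\<And>x. cdf \<mu> x = esd (sample_cov p m X) x"
    "\<And>t. t > 0 \<Longrightarrow> (\<integral>x. 1 / (x + t) \<partial>\<mu>) = mat_tr p (resolvent p t (\<lambda>k i. X i k / sqrt m) m) / p"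
proof -
  obtain es where len: "length es = p" and nonneg: "\<And>e. e \<in> set es \<Longrightarrow> 0 \<le> e"
    and cp: "char_poly (sample_cov p m X) = (\<Prod>e\<leftarrow>es. [:- e, 1:])"
    using char_poly_sample_cov_splits[of p m X] by blast
  let ?U = "measure_pmf (pmf_of_set {..<p})"
  have ne: "{..<p} \<noteq> {}" using p by auto
  define \<mu> where "\<mu> = distr ?U borel (\<lambda>i. es ! i)"
  have "prob_space \<mu>" unfolding \<mu>_def by (intro measure_pmf.prob_space_distr) simp
  then have "real_distribution \<mu>" by (simp add: real_distribution_def real_distribution_axioms_def \<mu>_def)
  moreover have "AE x in \<mu>. 0 \<le> x"
    unfolding \<mu>_def using ne nonneg len by (subst AE_distr_iff) (auto simp: AE_measure_pmf_iff)
  moreover have "cdf \<mu> x = esd (sample_cov p m X) x" for x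
  proof -
    have "cdf \<mu> x = measure ?U {i. es ! i \<le> x}"
      unfolding cdf_def \<mu>_def by (subst measure_distr) (auto intro!: arg_cong2[where f = measure])
    also have "\<dots> = real (card ({..<p} \<inter> {i. es ! i \<le> x})) / real p"
      using ne by (simp add: measure_pmf_of_set)
    also have "{..<p} \<inter> {i. es ! i \<le> x} = {i. i < length es \<and> es ! i \<le> x}" using len by auto
    also have "card \<dots> = length (filter (\<lambda>e. e \<le> x) es)" by (simp add: length_filter_conv_card)
    finally show ?thesis using esd_eq_count[OF sample_cov_carrier cp] by simp
  qed
  moreover have "(\<integral>x. 1 / (x + t) \<partial>\<mu>) = mat_tr p (resolvent p t (\<lambda>k i. X i k / sqrt m) m) / p" if t: "t > 0" for t
  proof -
    have "(\<integral>x. 1 / (x + t) \<partial>\<mu>) = (\<integral>i. 1 / (es ! i + t) \<partial>?U)"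
      unfolding \<mu>_def by (subst integral_distr) auto
    also have "\<dots> = (\<Sum>i<p. 1 / (es ! i + t)) / p"
      using ne by (subst integral_pmf_of_set) auto
    also have "(\<Sum>i<p. 1 / (es ! i + t)) = (\<Sum>e\<leftarrow>es. 1 / (e + t))"
      by (simp add: sum_list_sum_nth len atLeast0LessThan)
    also have "\<dots> = mat_tr p (resolvent p t (\<lambda>k i. X i k / sqrt m) m)"
      by (rule trace_resolvent_eigenvalues[OF t cp nonneg])
    finally show ?thesis .
  qed
  ultimately show ?thesis by (rule that)
qed

section \<open>Weak convergence from the Stieltjes transform\<close>

text \<open>A uniform error of size \<open>e\<close> costs at most \<open>e\<close> under every
  probability measure, simultaneously in \<open>n\<close>. This is used once for difference
  quotients and once for polynomial approximation.\<close>

lemma integral_conv_uniform_limit: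
  fixes \<mu> :: "nat \<Rightarrow> real measure"
  assumes \<mu>: "\<And>n. real_distribution (\<mu> n)" and M: "real_distribution M"
    and \<phi> [measurable]: "\<phi> \<in> borel_measurable borel"
    and approx: "\<And>e. e > 0 \<Longrightarrow> \<exists>\<psi>\<in>borel_measurable borel. (\<exists>C. \<forall>x. \<bar>\<psi> x\<bar> \<le> C) \<and> (\<forall>x. \<bar>\<phi> x - \<psi> x\<bar> \<le> e) \<and>
           (\<lambda>n. \<integral>x. \<psi> x \<partial>\<mu> n) \<longlonglongrightarrow> (\<integral>x. \<psi> x \<partial>M)"
  shows "(\<lambda>n. \<integral>x. \<phi> x \<partial>\<mu> n) \<longlonglongrightarrow> (\<integral>x. (\<phi> x :: real) \<partial>M)"
proof (rule LIMSEQ_I)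
  fix r :: real assume r: "r > 0"
  \<comment> \<open>A quarter of \<open>r\<close> each for the uniform error under
    \<open>\<mu> n\<close>, the uniform error under \<open>M\<close>, and the convergence of the
    approximant; the total stays strictly below \<open>r\<close>.\<close>
  obtain \<psi> C where \<psi> [measurable]: "\<psi> \<in> borel_measurable borel" and C: "\<And>x. \<bar>\<psi> x\<bar> \<le> C"
    and close: "\<And>x. \<bar>\<phi> x - \<psi> x\<bar> \<le> r / 4" and lim: "(\<lambda>n. \<integral>x. \<psi> x \<partial>\<mu> n) \<longlonglongrightarrow> (\<integral>x. \<psi> x \<partial>M)"
    using approx[of "r / 4"] r by auto
  have bound: "\<bar>(\<integral>x. \<phi> x \<partial>N) - (\<integral>x. \<psi> x \<partial>N)\<bar> \<le> r / 4" if "real_distribution N" for N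
  proof -
    interpret N: real_distribution N by fact
    have i\<psi>: "integrable N \<psi>"
      by (rule N.integrable_const_bound[where B = C]) (use C in auto)
    have i\<phi>: "integrable N \<phi>"
    proof (rule N.integrable_const_bound[where B = "C + r / 4"])
      show "AE x in N. norm (\<phi> x) \<le> C + r / 4"
      proof (rule AE_I2)
        fix x show "norm (\<phi> x) \<le> C + r / 4" using C[of x] close[of x] unfolding real_norm_def by linarith
      qed
    qed simp
    have "(\<integral>x. \<phi> x \<partial>N) - (\<integral>x. \<psi> x \<partial>N) = (\<integral>x. \<phi> x - \<psi> x \<partial>N)"
      using i\<psi> i\<phi> by simp
    also have "\<bar>\<dots>\<bar> \<le> (\<integral>x. \<bar>\<phi> x - \<psi> x\<bar> \<partial>N)"
      by (rule integral_abs_bound)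
    also have "\<dots> \<le> (\<integral>x. r / 4 \<partial>N)"
      using i\<psi> i\<phi> close by (intro integral_mono) auto
    also have "\<dots> = r / 4" using N.prob_space by simp
    finally show ?thesis .
  qed
  obtain n0 where n0: "\<And>n. n \<ge> n0 \<Longrightarrow> norm ((\<integral>x. \<psi> x \<partial>\<mu> n) - (\<integral>x. \<psi> x \<partial>M)) < r / 4"
    using LIMSEQ_D[OF lim, of "r / 4"] r by auto
  show "\<exists>no. \<forall>n\<ge>no. norm ((\<integral>x. \<phi> x \<partial>\<mu> n) - (\<integral>x. \<phi> x \<partial>M)) < r"
  proof (intro exI allI impI)
    fix n assume "n \<ge> n0"
    from n0[OF this] bound[OF \<mu>[of n]] bound[OF M] r
    show "norm ((\<integral>x. \<phi> x \<partial>\<mu> n) - (\<integral>x. \<phi> x \<partial>M)) < r" unfolding real_norm_def by linarith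
  qed
qed

text \<open>Mean value bounds: the slope of the \<open>k\<close>-th power between \<open>v\<close>
  and \<open>u\<close> lies between \<open>k v^(k-1)\<close> and \<open>k u^(k-1)\<close>.
  Multiplying by \<open>v\<close> and \<open>u\<close> avoids the exponent
  \<open>k - 1\<close>.\<close>

lemma power_diff_bounds:
  fixes u v :: real
  assumes "0 \<le> v" "v \<le> u"
  shows "u * (u ^ k - v ^ k) \<le> real k * u ^ k * (u - v)"
    and "real k * v ^ k * (u - v) \<le> v * (u ^ k - v ^ k)"
proof (induction k)
  case (Suc k)
  {
    case 1
    have "u * (u ^ Suc k - v ^ Suc k) = u * (u * (u ^ k - v ^ k)) + u * v ^ k * (u - v)"
      by (simp add: algebra_simps)
    also have "\<dots> \<le> u * (real k * u ^ k * (u - v)) + u * u ^ k * (u - v)"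
      using Suc(1) assms by (intro add_mono mult_left_mono mult_right_mono power_mono) auto
    finally show ?case by (simp add: algebra_simps)
  next
    case 2
    have "v * (v * (u ^ k - v ^ k)) + v * u ^ k * (u - v) = v * (u ^ Suc k - v ^ Suc k)"
      by (simp add: algebra_simps)
    moreover have "v * (real k * v ^ k * (u - v)) + v * v ^ k * (u - v) \<le> v * (v * (u ^ k - v ^ k)) + v * u ^ k * (u - v)"
      using Suc(2) assms by (intro add_mono mult_left_mono mult_right_mono power_mono) auto
    ultimately show ?case by (simp add: algebra_simps)
  }
qed auto

text \<open>Up to sign the first term is the derivative of the \<open>k\<close>-th inverse power.
  With \<open>u = 1/a\<close> and \<open>v = 1/(a + h)\<close>, it equals the upper end and the
  quotient lies inside the interval from \<open>k v^(k+1)\<close> to \<open>k u^(k+1)\<close>; the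
  identity \<open>u - v = h u v\<close> makes the length of that interval of order
  \<open>h\<close>.\<close>

lemma inverse_power_difference_quotient:
  fixes a h :: real
  assumes t: "t > 0" and a: "a \<ge> t" and h: "h > 0"
  shows "\<bar>real k * (1 / a) ^ Suc k - ((1 / a) ^ k - (1 / (a + h)) ^ k) / h\<bar> \<le> real k * real (Suc k) * (1 / t) ^ Suc (Suc k) * h"
proof -
  define u v where "u = 1 / a" and "v = 1 / (a + h)"
  have uv: "0 < v" "v \<le> u" "u \<le> 1 / t" "u > 0"
    using t a h by (auto simp: u_def v_def field_simps)
  have diff: "u - v = h * (u * v)"
    using t a h by (simp add: u_def v_def field_simps)
  have q1: "(u ^ k - v ^ k) / h \<le> real k * u ^ Suc k"
  proof -
    have "u * (u ^ k - v ^ k) \<le> u * (h * (real k * u ^ k * v))"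
      using power_diff_bounds(1)[of v u k] uv unfolding diff by (simp add: mult_ac)
    then have "u ^ k - v ^ k \<le> h * (real k * u ^ k * v)" using uv by simp
    also have "\<dots> \<le> h * (real k * u ^ k * u)" using uv h by (intro mult_left_mono) auto
    finally show ?thesis using h by (simp add: field_simps)
  qed
  have q2: "real k * v ^ Suc k \<le> (u ^ k - v ^ k) / h"
  proof -
    have "v * (h * (real k * v ^ k * u)) \<le> v * (u ^ k - v ^ k)"
      using power_diff_bounds(2)[of v u k] uv unfolding diff by (simp add: mult_ac)
    then have "h * (real k * v ^ k * u) \<le> u ^ k - v ^ k" using uv by simp
    moreover have "h * (real k * v ^ k * v) \<le> h * (real k * v ^ k * u)" using uv h by (intro mult_left_mono) auto
    ultimately have "h * (real k * v ^ k * v) \<le> u ^ k - v ^ k" by (rule order_trans[rotated])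
    then show ?thesis using h by (simp add: field_simps)
  qed
  have "u ^ Suc k - v ^ Suc k \<le> real (Suc k) * (1 / t) ^ Suc (Suc k) * h"
  proof -
    have "u * (u ^ Suc k - v ^ Suc k) \<le> u * (h * (real (Suc k) * u ^ Suc k * v))"
      using power_diff_bounds(1)[of v u "Suc k"] uv unfolding diff by (simp add: mult_ac)
    then have "u ^ Suc k - v ^ Suc k \<le> h * (real (Suc k) * u ^ Suc k * v)" using uv by simp
    also have "\<dots> \<le> h * (real (Suc k) * (1 / t) ^ Suc k * (1 / t))"
      using uv h t by (intro mult_left_mono mult_mono power_mono) auto
    finally show ?thesis by (simp add: mult_ac)
  qed
  then have "real k * (u ^ Suc k - v ^ Suc k) \<le> real k * (real (Suc k) * (1 / t) ^ Suc (Suc k) * h)"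
    by (intro mult_left_mono) auto
  then have "real k * u ^ Suc k - real k * v ^ Suc k \<le> real k * real (Suc k) * (1 / t) ^ Suc (Suc k) * h"
    by (simp add: algebra_simps)
  with q1 q2 show ?thesis unfolding u_def[symmetric] v_def[symmetric] by linarith
qed

text \<open>Continuous steps suffice for weak convergence, and on the half line they are continuous
  functions of \<open>1 / (x + 1)\<close> in the unit interval, hence uniform limits of polynomials
  in it. Restricting to rational \<open>t\<close> leaves countably many conditions, which can hold
  jointly outside one null set.\<close>

theorem stieltjes_conv_imp_weak_conv:
  fixes \<mu> :: "nat \<Rightarrow> real measure"
  assumes \<mu>: "\<And>n. real_distribution (\<mu> n)" and M: "real_distribution M"
    and \<mu>0: "\<And>n. AE x in \<mu> n. 0 \<le> x" and M0: "AE x in M. 0 \<le> x"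
    and conv: "\<And>t. t \<in> \<rat> \<Longrightarrow> t > 0 \<Longrightarrow> (\<lambda>n. \<integral>x. 1 / (x + t) \<partial>\<mu> n) \<longlonglongrightarrow> (\<integral>x. 1 / (x + t) \<partial>M)"
  shows "weak_conv_m \<mu> M"
proof (rule integral_cts_step_conv_imp_weak_conv[OF \<mu> M])
  \<comment> \<open>Cutting off at 0 bounds \<open>g t\<close> by \<open>1 / t\<close> on the whole
    line, while it agrees with \<open>1 / (x + t)\<close> almost everywhere for all the measures
    involved.\<close>
  define g where "g = (\<lambda>t x :: real. 1 / (max 0 x + t))"
  define cv where "cv = (\<lambda>\<psi> :: real \<Rightarrow> real. (\<lambda>n. \<integral>x. \<psi> x \<partial>\<mu> n) \<longlonglongrightarrow> (\<integral>x. \<psi> x \<partial>M))"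
  have g_meas [measurable]: "g t \<in> borel_measurable borel" for t
    unfolding g_def by measurable
  have g_bound: "\<bar>g t x ^ k\<bar> \<le> (1 / t) ^ k" if "t > 0" for t x k
    using that unfolding g_def power_abs by (intro power_mono) (auto simp: field_simps)
  have g_int: "integrable N (\<lambda>x. g t x ^ k)" if "real_distribution N" "t > 0" for N t k
  proof -
    interpret N: real_distribution N by fact
    show ?thesis
      by (rule N.integrable_const_bound[where B = "(1 / t) ^ k"]) (use g_bound[OF that(2)] in auto)
  qed
  have int_M: "integrable M (\<lambda>x. g t x ^ k)" if "t > 0" for t k using g_int[OF M that] .
  have int_\<mu>: "integrable (\<mu> n) (\<lambda>x. g t x ^ k)" if "t > 0" for t k n using g_int[OF \<mu> that] .
  \<comment> \<open>Difference quotients in \<open>t\<close> converge uniformly, so convergence passes from \<open>g t ^ k\<close> to \<open>g t ^ Suc k\<close>.\<close>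
  have powers: "cv (\<lambda>x. g t x ^ k)" if "t \<in> \<rat>" "t > 0" for t k
    using that
  proof (induction k arbitrary: t)
    case 0
    have "(\<integral>x. 1 \<partial>N) = (1::real)" if "real_distribution N" for N :: "real measure"
    proof -
      interpret N: real_distribution N by fact
      show ?thesis using N.prob_space by simp
    qed
    then show ?case using \<mu> M by (simp add: cv_def)
  next
    case (Suc k)
    show ?case
    \<comment> \<open>Difference quotients of the zeroth power vanish and carry no information, so
      the first power has to come from the hypothesis \<open>conv\<close>.\<close>
    proof (cases "k = 0")
      case True
      have "(\<integral>x. g t x ^ Suc 0 \<partial>N) = (\<integral>x. 1 / (x + t) \<partial>N)" if "AE x in N. 0 \<le> x" "sets N = sets borel" for N
        by (intro integral_cong_AE) (use that in \<open>auto simp: g_def measurable_cong_sets[OF that(2) refl]\<close>)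
      then have "(\<integral>x. g t x ^ Suc 0 \<partial>\<mu> n) = (\<integral>x. 1 / (x + t) \<partial>\<mu> n)"
        "(\<integral>x. g t x ^ Suc 0 \<partial>M) = (\<integral>x. 1 / (x + t) \<partial>M)" for n
        using \<mu>0 M0 \<mu> M by (auto simp: real_distribution_def real_distribution_axioms_def)
      then show ?thesis using conv[OF Suc.prems] True by (simp add: cv_def)
    next
      case False
      have "cv (\<lambda>x. real k * g t x ^ Suc k)"
        unfolding cv_def
      proof (rule integral_conv_uniform_limit[OF \<mu> M])
        fix e :: real assume e: "e > 0"
        define K where "K = real k * real (Suc k) * (1 / t) ^ Suc (Suc k)"
        have K: "K \<ge> 0" using Suc.prems by (simp add: K_def)
        obtain N0 :: nat where "K / e < real N0" using reals_Archimedean2 by blast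
        then obtain N :: nat where N: "K / e < real N" "N > 0"
          by (intro that[of "Suc N0"]) auto
        \<comment> \<open>A reciprocal integer, so that \<open>t + h\<close> is again rational and
          the induction hypothesis applies to it.\<close>
        define h where "h = 1 / real N"
        have h: "h > 0" "h \<in> \<rat>" using N by (auto simp: h_def)
        have Kh: "K * h \<le> e" using N e by (simp add: h_def field_simps)
        have th: "t + h \<in> \<rat>" "t + h > 0" using Suc.prems h by auto
        let ?\<psi> = "\<lambda>x. (g t x ^ k - g (t + h) x ^ k) / h"
        have "cv ?\<psi>"
        proof -
          have "(\<lambda>n. ((\<integral>x. g t x ^ k \<partial>\<mu> n) - (\<integral>x. g (t + h) x ^ k \<partial>\<mu> n)) / h) \<longlonglongrightarrow>
              ((\<integral>x. g t x ^ k \<partial>M) - (\<integral>x. g (t + h) x ^ k \<partial>M)) / h"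
            using Suc.IH[OF Suc.prems] Suc.IH[OF th] h unfolding cv_def by (intro tendsto_intros) auto
          then show ?thesis unfolding cv_def
            using int_M[OF Suc.prems(2)] int_M[OF th(2)] int_\<mu>[OF Suc.prems(2)] int_\<mu>[OF th(2)] by simp
        qed
        moreover have "\<bar>?\<psi> x\<bar> \<le> ((1 / t) ^ k + (1 / (t + h)) ^ k) / h" for x
        proof -
          have "\<bar>g t x ^ k - g (t + h) x ^ k\<bar> \<le> (1 / t) ^ k + (1 / (t + h)) ^ k"
            using g_bound[OF Suc.prems(2), of x k] g_bound[OF th(2), of x k] by linarith
          then show ?thesis using h by (simp add: divide_right_mono)
        qed
        moreover have "\<bar>real k * g t x ^ Suc k - ?\<psi> x\<bar> \<le> e" for x
        proof -
          have "\<bar>real k * g t x ^ Suc k - ?\<psi> x\<bar> \<le> K * h"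
            unfolding g_def K_def using inverse_power_difference_quotient[OF Suc.prems(2), of "max 0 x + t" h k] h
            by (simp add: add.assoc)
          with Kh show ?thesis by simp
        qed
        moreover have "?\<psi> \<in> borel_measurable borel" by measurable
        ultimately show "\<exists>\<psi>\<in>borel_measurable borel. (\<exists>C. \<forall>x. \<bar>\<psi> x\<bar> \<le> C) \<and>
            (\<forall>x. \<bar>real k * g t x ^ Suc k - \<psi> x\<bar> \<le> e) \<and> (\<lambda>n. \<integral>x. \<psi> x \<partial>\<mu> n) \<longlonglongrightarrow> (\<integral>x. \<psi> x \<partial>M)"
          unfolding cv_def by (intro bexI[where x = ?\<psi>] conjI exI allI)
      qed measurable
      then have "(\<lambda>n. real k * (\<integral>x. g t x ^ Suc k \<partial>\<mu> n)) \<longlonglongrightarrow> real k * (\<integral>x. g t x ^ Suc k \<partial>M)"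
        by (simp add: cv_def)
      then show ?thesis using False unfolding cv_def
        by (simp only: tendsto_mult_left_iff of_nat_eq_0_iff not_False_eq_True)
    qed
  qed
  have polys: "cv (\<lambda>x. \<Sum>i\<le>d. c i * g 1 x ^ i)" for c :: "nat \<Rightarrow> real" and d
  proof -
    have "(\<lambda>n. \<Sum>i\<le>d. c i * (\<integral>x. g 1 x ^ i \<partial>\<mu> n)) \<longlonglongrightarrow> (\<Sum>i\<le>d. c i * (\<integral>x. g 1 x ^ i \<partial>M))"
      using powers[of 1] by (intro tendsto_intros) (auto simp: cv_def)
    then show ?thesis unfolding cv_def by (simp add: int_M int_\<mu>)
  qed
  fix a b :: real assume ab: "a < b"
  \<comment> \<open>The value of \<open>g 1\<close> at the point \<open>\<bar>b\<bar>\<close>, to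
    the right of which the step is already 0. Truncating the variable of \<open>G\<close> there
    keeps \<open>G\<close> continuous down to 0, the image of infinity.\<close>
  define \<epsilon> where "\<epsilon> = 1 / (\<bar>b\<bar> + 1)"
  have \<epsilon>: "\<epsilon> > 0" by (auto simp: \<epsilon>_def)
  define G where "G = (\<lambda>u. cts_step a b (1 / max u \<epsilon> - 1))"
  have cont_step: "continuous_on UNIV (cts_step a b)"
    using uniformly_continuous_imp_continuous[OF cts_step_uniformly_continuous[OF ab]] .
  have G_cont: "continuous_on {0..1} G"
    unfolding G_def using \<epsilon>
    by (intro continuous_on_compose2[OF cont_step] continuous_intros) (auto simp: max_def)
  have G_g: "cts_step a b (max 0 x) = G (g 1 x)" for x
  proof (cases "g 1 x \<ge> \<epsilon>")
    case True
    then show ?thesis unfolding G_def by (simp add: max_def[of "g 1 x"] g_def)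
  next
    case False
    then have bx: "\<bar>b\<bar> < max 0 x" by (simp add: g_def \<epsilon>_def field_simps)
    then have "\<bar>b\<bar> < x" by (auto simp: max_def split: if_splits)
    then have "b \<le> x" "b \<le> \<bar>b\<bar>" "0 < x" by auto
    moreover have "1 / max (g 1 x) \<epsilon> - 1 = \<bar>b\<bar>" using False by (simp add: max_def \<epsilon>_def)
    ultimately show ?thesis using ab unfolding G_def by (simp add: cts_step_def)
  qed
  have step_meas [measurable]: "cts_step a b \<in> borel_measurable borel"
    using cont_step by (rule borel_measurable_continuous_onI)
  have "cv (\<lambda>x. cts_step a b (max 0 x))"
    unfolding cv_def
  proof (rule integral_conv_uniform_limit[OF \<mu> M])
    fix e :: real assume e: "e > 0"
    obtain q where q: "real_polynomial_function q" "\<And>x. x \<in> {0..1} \<Longrightarrow> \<bar>G x - q x\<bar> < e"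
      using Stone_Weierstrass_real_polynomial_function[OF _ G_cont e] by auto
    then obtain c d where qcd: "q = (\<lambda>x. \<Sum>i\<le>d. c i * x ^ i)"
      by (auto simp: real_polynomial_function_iff_sum)
    let ?\<psi> = "\<lambda>x. \<Sum>i\<le>d. c i * g 1 x ^ i"
    have g01: "g 1 x \<in> {0..1}" for x by (auto simp: g_def field_simps)
    have "\<bar>cts_step a b (max 0 x) - ?\<psi> x\<bar> \<le> e" for x
      using q(2)[OF g01[of x]] unfolding G_g by (simp add: qcd)
    moreover have "\<bar>?\<psi> x\<bar> \<le> (\<Sum>i\<le>d. \<bar>c i\<bar>)" for x
    proof -
      have "\<bar>?\<psi> x\<bar> \<le> (\<Sum>i\<le>d. \<bar>c i * g 1 x ^ i\<bar>)" by (rule sum_abs)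
      also have "\<dots> \<le> (\<Sum>i\<le>d. \<bar>c i\<bar>)"
        using g_bound[of 1 x] by (intro sum_mono) (simp add: abs_mult mult_left_le)
      finally show ?thesis .
    qed
    moreover have "?\<psi> \<in> borel_measurable borel" by measurable
    ultimately show "\<exists>\<psi>\<in>borel_measurable borel. (\<exists>C. \<forall>x. \<bar>\<psi> x\<bar> \<le> C) \<and>
            (\<forall>x. \<bar>cts_step a b (max 0 x) - \<psi> x\<bar> \<le> e) \<and> (\<lambda>n. \<integral>x. \<psi> x \<partial>\<mu> n) \<longlonglongrightarrow> (\<integral>x. \<psi> x \<partial>M)"
      using polys[of c d] unfolding cv_def by (intro bexI[where x = ?\<psi>] conjI exI allI)
  qed measurable
  moreover have "(\<integral>x. cts_step a b (max 0 x) \<partial>N) = (\<integral>x. cts_step a b x \<partial>N)"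
    if "AE x in N. 0 \<le> x" "real_distribution N" for N
  proof -
    interpret N: real_distribution N by fact
    show ?thesis by (rule integral_cong_AE) (use that in auto)
  qed
  ultimately show "(\<lambda>n. integral\<^sup>L (\<mu> n) (cts_step a b)) \<longlonglongrightarrow> integral\<^sup>L M (cts_step a b)"
    using \<mu>0 M0 \<mu> M by (simp add: cv_def)
qed

section \<open>The Marchenko--Pastur law\<close>

text \<open>With \<open>y = cos \<theta>\<close> the integrand \<open>sqrt (1 - y\<^sup>2) / (K + y)\<close> becomes \<open>sin\<^sup>2 \<theta> / (K + cos \<theta>)\<close>, which is a trigonometric
  polynomial plus a Poisson kernel of radius \<open>\<beta>\<close>; the arctangent is the primitive of the latter that is
  smooth on the whole half circle.\<close>

definition semicircle_antideriv :: "real \<Rightarrow> real \<Rightarrow> real" where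
  "semicircle_antideriv K y = (let s = sqrt (K\<^sup>2 - 1); \<beta> = K - s in
     sqrt (1 - y\<^sup>2) - \<beta> * arccos y - 2 * s * arctan (\<beta> * sqrt (1 - y\<^sup>2) / (1 + \<beta> * y)))"

lemma semicircle_antideriv_ends:
  "semicircle_antideriv K 1 = 0" "semicircle_antideriv K (-1) = - (K - sqrt (K\<^sup>2 - 1)) * pi"
  by (auto simp: semicircle_antideriv_def Let_def algebra_simps)

text \<open>The number is the smaller root of \<open>z^2 - 2 K z + 1\<close>, the larger one being
  its reciprocal \<open>K + sqrt (K\<^sup>2 - 1)\<close>.\<close>

lemma semicircle_beta_bounds:
  assumes "K \<ge> (1::real)"
  shows "0 < K - sqrt (K\<^sup>2 - 1)" "K - sqrt (K\<^sup>2 - 1) \<le> 1" "K > 1 \<Longrightarrow> K - sqrt (K\<^sup>2 - 1) < 1"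
proof -
  define s where "s = sqrt (K\<^sup>2 - 1)"
  have K2: "K\<^sup>2 \<ge> 1" using assms by (simp add: one_le_power)
  have s: "s \<ge> 0" "s\<^sup>2 = K\<^sup>2 - 1" using K2 by (auto simp: s_def)
  have prod: "(K - s) * (K + s) = 1" using s by (simp add: algebra_simps power2_eq_square)
  have "K + s \<ge> 1" using assms s by simp
  then show pos: "0 < K - sqrt (K\<^sup>2 - 1)"
    using prod zero_less_mult_pos2[of "K - s" "K + s"] unfolding s_def[symmetric] by simp
  show "K - sqrt (K\<^sup>2 - 1) \<le> 1"
  proof -
    have "(K - s) * 1 \<le> (K - s) * (K + s)" using pos \<open>K + s \<ge> 1\<close> unfolding s_def[symmetric] by (intro mult_left_mono) auto
    then show ?thesis using prod by (simp add: s_def)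
  qed
  show "K - sqrt (K\<^sup>2 - 1) < 1" if "K > 1"
  proof -
    have "(K - s) * 1 < (K - s) * (K + s)" using pos that s unfolding s_def[symmetric] by (intro mult_strict_left_mono) auto
    then show ?thesis using prod by (simp add: s_def)
  qed
qed

text \<open>Only the denominator \<open>1 + \<beta> * y\<close> could vanish. For
  \<open>K > 1\<close> the radius is below 1 and it does not; for \<open>K = 1\<close> it vanishes
  at \<open>y = -1\<close>, but then the arctangent carries the factor 0. The second case is needed
  for the total mass when \<open>lam = 1\<close>.\<close>

lemma semicircle_antideriv_continuous:
  assumes K: "K \<ge> 1"
  shows "continuous_on {-1..1} (semicircle_antideriv K)"
proof (cases "K = 1")
  case True
  then show ?thesis unfolding semicircle_antideriv_def Let_def
    by (auto intro!: continuous_intros)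
next
  case False
  with K have K1: "K > 1" by simp
  define \<beta> where "\<beta> = K - sqrt (K\<^sup>2 - 1)"
  have \<beta>: "0 < \<beta>" "\<beta> < 1" using semicircle_beta_bounds[OF K] K1 by (auto simp: \<beta>_def)
  have nz: "1 + \<beta> * y \<noteq> 0" if "y \<in> {-1..1}" for y
  proof -
    have "\<beta> * y \<ge> \<beta> * (-1)" using that \<beta> by (intro mult_left_mono) auto
    then show ?thesis using \<beta> by simp
  qed
  show ?thesis unfolding semicircle_antideriv_def Let_def \<beta>_def[symmetric]
    using nz by (intro continuous_intros) auto
qed

text \<open>The relation \<open>1 + \<beta>\<^sup>2 = 2 * K * \<beta>\<close> turns the Poisson
  denominator \<open>(1 + \<beta> y)^2 + \<beta>^2 w^2\<close> into
  \<open>2 \<beta> (K + y)\<close>. Over the common denominator \<open>w (K + y)\<close> the three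
  derivatives then add up to the numerator \<open>1 - y^2 = w^2\<close>.\<close>

lemma semicircle_antideriv_deriv:
  assumes K: "K \<ge> 1" and y: "-1 < y" "y < 1"
  shows "(semicircle_antideriv K has_real_derivative sqrt (1 - y\<^sup>2) / (K + y)) (at y)"
proof -
  define s where "s = sqrt (K\<^sup>2 - 1)"
  define \<beta> where "\<beta> = K - s"
  have \<beta>: "0 < \<beta>" "\<beta> \<le> 1" using semicircle_beta_bounds[OF K] by (auto simp: \<beta>_def s_def)
  have s2: "s\<^sup>2 = K\<^sup>2 - 1" using K by (simp add: s_def one_le_power)
  have \<beta>2: "1 + \<beta>\<^sup>2 = 2 * K * \<beta>" using s2 by (simp add: \<beta>_def power2_eq_square algebra_simps)
  have \<beta>s: "\<beta> * (K + s) = 1" using s2 by (simp add: \<beta>_def power2_eq_square algebra_simps)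
  have y2: "1 - y\<^sup>2 > 0" using y by (simp add: abs_square_less_1 abs_less_iff)
  define w where "w = sqrt (1 - y\<^sup>2)"
  have w: "w > 0" "w\<^sup>2 = 1 - y\<^sup>2" using y2 by (auto simp: w_def)
  have bpos: "1 + \<beta> * y > 0"
  proof -
    have "\<beta> * y > \<beta> * (-1)" using y \<beta> by (intro mult_strict_left_mono) auto
    then show ?thesis using \<beta> by simp
  qed
  have Ky: "K + y > 0" using K y by simp
  have dw: "((\<lambda>y. sqrt (1 - y\<^sup>2)) has_real_derivative - y / w) (at y)"
    using y2 by (auto intro!: derivative_eq_intros simp: w_def field_simps)
  have dac: "(arccos has_real_derivative - 1 / w) (at y)"
    using DERIV_arccos[OF y] by (simp add: w_def divide_inverse)
  define q where "q = (\<beta> * (- y / w) * (1 + \<beta> * y) - (\<beta> * w) * \<beta>) / (1 + \<beta> * y)\<^sup>2"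
  have dq: "((\<lambda>y. \<beta> * sqrt (1 - y\<^sup>2) / (1 + \<beta> * y)) has_real_derivative q) (at y)"
  proof -
    have "((\<lambda>y. 1 + \<beta> * y) has_real_derivative \<beta>) (at y)" by (auto intro!: derivative_eq_intros)
    from DERIV_divide[OF DERIV_cmult[OF dw] this, of \<beta>] bpos show ?thesis
      unfolding q_def w_def power2_eq_square by simp
  qed
  have da: "((\<lambda>y. arctan (\<beta> * sqrt (1 - y\<^sup>2) / (1 + \<beta> * y))) has_real_derivative
      inverse (1 + (\<beta> * w / (1 + \<beta> * y))\<^sup>2) * q) (at y)"
    using DERIV_chain2[OF DERIV_arctan dq] by (simp add: w_def)
  have div: "b = c / w" if "w * b = c" for b c using that w(1) by auto
  have num: "\<beta> * (- y / w) * (1 + \<beta> * y) - (\<beta> * w) * \<beta> = - \<beta> * (y + \<beta>) / w"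
  proof -
    have "w * (\<beta> * (- y / w) * (1 + \<beta> * y) - (\<beta> * w) * \<beta>) = - \<beta> * y * (1 + \<beta> * y) - \<beta> * \<beta> * w\<^sup>2"
      using w(1) by (simp add: field_simps power2_eq_square)
    also have "\<dots> = - \<beta> * (y + \<beta>)" unfolding w(2) by (simp add: algebra_simps power2_eq_square)
    finally show ?thesis by (rule div)
  qed
  have den: "1 + (\<beta> * w / (1 + \<beta> * y))\<^sup>2 = 2 * \<beta> * (K + y) / (1 + \<beta> * y)\<^sup>2"
  proof -
    have "1 + (\<beta> * w / (1 + \<beta> * y))\<^sup>2 = ((1 + \<beta> * y)\<^sup>2 + \<beta>\<^sup>2 * w\<^sup>2) / (1 + \<beta> * y)\<^sup>2"
      using bpos by (simp add: power_divide power_mult_distrib add_divide_distrib)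
    also have "(1 + \<beta> * y)\<^sup>2 + \<beta>\<^sup>2 * w\<^sup>2 = (1 + \<beta>\<^sup>2) + 2 * \<beta> * y"
      unfolding w(2) by (simp add: algebra_simps power2_eq_square)
    also have "\<dots> = 2 * \<beta> * (K + y)" unfolding \<beta>2 by (simp add: algebra_simps)
    finally show ?thesis .
  qed
  have aq: "inverse (1 + (\<beta> * w / (1 + \<beta> * y))\<^sup>2) * q = - (y + \<beta>) / (2 * w * (K + y))"
  proof -
    have "inverse (2 * \<beta> * k / e) * ((- \<beta> * g / w) / e) = - g / (2 * w * k)" if "e > 0" "k > 0" for e k g
      using that \<beta>(1) w(1) by (simp add: field_simps)
    note gen = this
    show ?thesis unfolding den q_def num by (rule gen) (use bpos Ky in auto)
  qed
  have "((\<lambda>y. sqrt (1 - y\<^sup>2) - \<beta> * arccos y - 2 * s * arctan (\<beta> * sqrt (1 - y\<^sup>2) / (1 + \<beta> * y))) has_real_derivative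
     (- y / w - \<beta> * (- 1 / w) - 2 * s * (- (y + \<beta>) / (2 * w * (K + y))))) (at y)"
    by (intro DERIV_diff DERIV_cmult dw dac da[unfolded aq])
  moreover have "- y / w - \<beta> * (- 1 / w) - 2 * s * (- (y + \<beta>) / (2 * w * (K + y))) = w / (K + y)"
  proof -
    have "- y / w - \<beta> * (- 1 / w) - 2 * s * (- (y + \<beta>) / (2 * w * (K + y))) = ((\<beta> - y) * (K + y) + s * (y + \<beta>)) / (w * (K + y))"
    proof -
      have "- y / w - \<beta> * (- 1 / w) - 2 * s * (- g / (2 * w * k)) = ((\<beta> - y) * k + s * g) / (w * k)" if "k > 0" for k g
        using that w(1) by (simp add: field_simps)
      from this[OF Ky] show ?thesis .
    qed
    also have "(\<beta> - y) * (K + y) + s * (y + \<beta>) = \<beta> * (K + s) + (\<beta> + s - K) * y - y\<^sup>2"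
      by (simp add: algebra_simps power2_eq_square)
    also have "\<dots> = w\<^sup>2" unfolding \<beta>s w(2) by (simp add: \<beta>_def)
    finally show ?thesis using w Ky by (simp add: power2_eq_square)
  qed
  moreover have "semicircle_antideriv K = (\<lambda>y. sqrt (1 - y\<^sup>2) - \<beta> * arccos y - 2 * s * arctan (\<beta> * sqrt (1 - y\<^sup>2) / (1 + \<beta> * y)))"
    by (rule ext) (simp add: semicircle_antideriv_def Let_def \<beta>_def s_def)
  ultimately show ?thesis by (simp add: w_def)
qed

text \<open>The substitution \<open>y = (x - c) / r\<close> with \<open>K = C / r\<close> reduces to
  the unit semicircle. Root and arccosine are not differentiable at the end points, hence the
  fundamental theorem with derivatives in the interior and continuity up to the boundary.\<close>

lemma semicircle_stieltjes:
  fixes c r C :: real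
  assumes r: "r > 0" and C: "C \<ge> r"
  shows "((\<lambda>x. sqrt (r\<^sup>2 - (x - c)\<^sup>2) / (C + (x - c))) has_integral pi * (C - sqrt (C\<^sup>2 - r\<^sup>2))) {c - r..c + r}"
proof -
  let ?F = "\<lambda>x. r * semicircle_antideriv (C / r) ((x - c) / r)"
  have K: "C / r \<ge> 1" using r C by simp
  have "((\<lambda>x. sqrt (r\<^sup>2 - (x - c)\<^sup>2) / (C + (x - c))) has_integral (?F (c + r) - ?F (c - r))) {c - r..c + r}"
  proof (rule fundamental_theorem_of_calculus_interior)
    show "continuous_on {c - r..c + r} ?F"
      using r by (intro continuous_intros continuous_on_compose2[OF semicircle_antideriv_continuous[OF K]])
        (auto simp: field_simps)
    fix x assume x: "x \<in> {c - r<..<c + r}"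
    let ?y = "(x - c) / r"
    have y: "-1 < ?y" "?y < 1" using x r by (auto simp: field_simps)
    have "(?F has_real_derivative r * (sqrt (1 - ?y\<^sup>2) / (C / r + ?y) * (1 / r))) (at x)"
      by (intro DERIV_cmult DERIV_chain2[where f = "semicircle_antideriv (C / r)" and g = "\<lambda>x. (x - c) / r", OF semicircle_antideriv_deriv[OF K y]]) (use r in \<open>auto intro!: derivative_eq_intros\<close>)
    also have "r * (sqrt (1 - ?y\<^sup>2) / (C / r + ?y) * (1 / r)) = sqrt (r\<^sup>2 - (x - c)\<^sup>2) / (C + (x - c))"
    proof -
      have "sqrt (r\<^sup>2 - (x - c)\<^sup>2) = sqrt (r\<^sup>2 * (1 - ?y\<^sup>2))" using r by (simp add: power_divide algebra_simps)
      also have "\<dots> = r * sqrt (1 - ?y\<^sup>2)" using r by (simp add: real_sqrt_mult)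
      finally have e: "sqrt (r\<^sup>2 - (x - c)\<^sup>2) = r * sqrt (1 - ?y\<^sup>2)" .
      have d: "C + (x - c) = r * (C / r + ?y)" using r by (simp add: field_simps)
      show ?thesis unfolding e d using r by simp
    qed
    finally show "(?F has_vector_derivative sqrt (r\<^sup>2 - (x - c)\<^sup>2) / (C + (x - c))) (at x)"
      by (simp add: has_real_derivative_iff_has_vector_derivative)
  qed (use r in simp)
  moreover have "?F (c + r) - ?F (c - r) = pi * (C - sqrt (C\<^sup>2 - r\<^sup>2))"
  proof -
    have "r * sqrt ((C / r)\<^sup>2 - 1) = sqrt (r\<^sup>2 * ((C / r)\<^sup>2 - 1))" using r by (simp add: real_sqrt_mult)
    also have "r\<^sup>2 * ((C / r)\<^sup>2 - 1) = C\<^sup>2 - r\<^sup>2" using r by (simp add: power_divide algebra_simps)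
    finally have e: "r * sqrt ((C / r)\<^sup>2 - 1) = sqrt (C\<^sup>2 - r\<^sup>2)" .
    have "?F (c + r) - ?F (c - r) = r * (C / r - sqrt ((C / r)\<^sup>2 - 1)) * pi"
    proof -
      have "(c + r - c) / r = 1" "(c - r - c) / r = -1" using r by auto
      then show ?thesis by (simp add: semicircle_antideriv_ends algebra_simps)
    qed
    also have "r * (C / r - sqrt ((C / r)\<^sup>2 - 1)) = C - r * sqrt ((C / r)\<^sup>2 - 1)" using r by (simp add: right_diff_distrib)
    finally show ?thesis unfolding e by simp
  qed
  ultimately show ?thesis by simp
qed

context
  fixes lam :: real
  assumes lam: "lam > 0"
begin

definition mp_lo where "mp_lo = (1 - sqrt lam)\<^sup>2"
definition mp_hi where "mp_hi = (1 + sqrt lam)\<^sup>2"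
text \<open>The root of the discriminant of \<open>lam t s^2 + (t + 1 - lam) s - 1\<close>, the
  quadratic equation solved by the transform of the law.\<close>

definition mp_disc where "mp_disc t = sqrt ((t + 1 - lam)\<^sup>2 + 4 * lam * t)"

text \<open>The support is the interval with centre \<open>1 + lam\<close> and radius
  \<open>2 * sqrt lam\<close>, so the constant of \<open>semicircle_stieltjes\<close> is
  \<open>1 + lam + t\<close>. The value \<open>t = 0\<close> is included since it gives the total
  mass.\<close>

lemma mp_root_stieltjes:
  assumes t: "t \<ge> 0"
  shows "((\<lambda>x. sqrt ((mp_hi - x) * (x - mp_lo)) / (x + t)) has_integral pi * (1 + lam + t - mp_disc t)) {mp_lo..mp_hi}"
proof -
  have s: "sqrt lam > 0" "(sqrt lam)\<^sup>2 = lam" using lam by auto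
  have C: "1 + lam + t \<ge> 2 * sqrt lam"
  proof -
    have "0 \<le> (1 - sqrt lam)\<^sup>2" by simp
    also have "\<dots> = 1 + lam - 2 * sqrt lam" using s by (simp add: power2_diff)
    finally show ?thesis using t by simp
  qed
  have lo: "1 + lam - 2 * sqrt lam = mp_lo" and hi: "1 + lam + 2 * sqrt lam = mp_hi"
    using s by (simp_all add: mp_lo_def mp_hi_def power2_diff power2_sum)
  have "((\<lambda>x. sqrt ((2 * sqrt lam)\<^sup>2 - (x - (1 + lam))\<^sup>2) / (1 + lam + t + (x - (1 + lam)))) has_integral
      pi * (1 + lam + t - sqrt ((1 + lam + t)\<^sup>2 - (2 * sqrt lam)\<^sup>2))) {1 + lam - 2 * sqrt lam..1 + lam + 2 * sqrt lam}"
    by (rule semicircle_stieltjes) (use s C in auto)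
  moreover have "(2 * sqrt lam)\<^sup>2 - (x - (1 + lam))\<^sup>2 = (mp_hi - x) * (x - mp_lo)" for x
    unfolding lo[symmetric] hi[symmetric] by (simp add: algebra_simps power2_eq_square)
  moreover have "(1 + lam + t)\<^sup>2 - (2 * sqrt lam)\<^sup>2 = (t + 1 - lam)\<^sup>2 + 4 * lam * t"
    using s by (simp add: power_mult_distrib) (simp add: algebra_simps power2_eq_square)
  ultimately show ?thesis unfolding lo hi mp_disc_def by (simp add: add.commute)
qed

lemma mp_lo_nonneg: "0 \<le> mp_lo" by (simp add: mp_lo_def)

lemma mp_lo_le_hi: "mp_lo \<le> mp_hi"
  using lam by (simp add: mp_lo_def mp_hi_def power2_diff power2_sum)

text \<open>Outside the support the product under the root is not positive. For
  \<open>lam = 1\<close> the support contains 0, where division by zero gives 0 in agreement with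
  \<open>mp_density\<close>.\<close>

lemma mp_density_eq:
  "mp_density lam x = (if x \<in> {mp_lo..mp_hi} then sqrt ((mp_hi - x) * (x - mp_lo)) / x / (2 * pi * lam) else 0)"
proof (cases "x \<in> {mp_lo..mp_hi}")
  case True
  then have "max 0 ((mp_hi - x) * (x - mp_lo)) = (mp_hi - x) * (x - mp_lo)" by (simp add: max_def)
  then show ?thesis using True mp_lo_nonneg
    by (auto simp: mp_density_def mp_hi_def[symmetric] mp_lo_def[symmetric] field_simps)
next
  case False
  then have "(mp_hi - x) * (x - mp_lo) \<le> 0"
    using mp_lo_le_hi by (auto simp: mult_nonneg_nonpos mult_nonpos_nonneg)
  then have "max 0 ((mp_hi - x) * (x - mp_lo)) = 0" by simp
  then show ?thesis using False
    unfolding mp_density_def mp_hi_def[symmetric] mp_lo_def[symmetric] by (simp only: if_False) simp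
qed

lemma mp_density_nonneg: "0 \<le> mp_density lam x"
  using lam by (simp add: mp_density_def)

lemma mp_density_measurable [measurable]: "mp_density lam \<in> borel_measurable borel"
  unfolding mp_density_def by measurable

lemma mp_disc_0: "mp_disc 0 = \<bar>1 - lam\<bar>"
  by (simp add: mp_disc_def)

lemma has_bochner_integral_lborel_nonneg:
  fixes f :: "real \<Rightarrow> real"
  assumes "f \<in> borel_measurable borel" "\<And>x. 0 \<le> f x" "(f has_integral I) UNIV"
  shows "has_bochner_integral lborel f I"
proof (rule has_bochner_integral_nn_integral)
  show "0 \<le> I" using assms(3) by (rule has_integral_nonneg) (use assms in auto)
qed (use assms nn_integral_has_integral_lborel[OF assms] in auto)

text \<open>The case \<open>t = 0\<close> of \<open>mp_root_stieltjes\<close>: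
  \<open>1 + lam - \<bar>1 - lam\<bar>\<close> is twice the minimum of 1 and
  \<open>lam\<close>.\<close>

lemma mp_density_integral:
  "has_bochner_integral lborel (mp_density lam) (if lam > 1 then 1 / lam else 1)"
proof (rule has_bochner_integral_lborel_nonneg)
  have "((\<lambda>x. sqrt ((mp_hi - x) * (x - mp_lo)) / (x + 0) / (2 * pi * lam)) has_integral pi * (1 + lam + 0 - mp_disc 0) / (2 * pi * lam)) {mp_lo..mp_hi}"
    by (intro has_integral_divide mp_root_stieltjes) simp
  then have "((\<lambda>x. if x \<in> {mp_lo..mp_hi} then sqrt ((mp_hi - x) * (x - mp_lo)) / x / (2 * pi * lam) else 0) has_integral
      pi * (1 + lam + 0 - mp_disc 0) / (2 * pi * lam)) UNIV"
    unfolding has_integral_restrict_UNIV by simp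
  moreover have "pi * (1 + lam + 0 - mp_disc 0) / (2 * pi * lam) = (if lam > 1 then 1 / lam else 1)"
    using lam by (auto simp: mp_disc_0 field_simps)
  ultimately show "(mp_density lam has_integral (if lam > 1 then 1 / lam else 1)) UNIV"
    by (simp add: mp_density_eq[abs_def])
qed (auto simp: mp_density_nonneg)

text \<open>Partial fractions: \<open>1 / (x (x + t))\<close> is the difference of
  \<open>1 / x\<close> and \<open>1 / (x + t)\<close> divided by \<open>t\<close>, so
  \<open>mp_root_stieltjes\<close> is used at 0 and at \<open>t\<close>. The absolute value changes
  nothing on the support and keeps the integrand nonnegative on the whole line.\<close>

lemma mp_density_stieltjes:
  assumes t: "t > 0"
  shows "has_bochner_integral lborel (\<lambda>x. mp_density lam x / (\<bar>x\<bar> + t))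
     ((2 * min 1 lam - (1 + lam + t) + mp_disc t) / (2 * lam * t))"
proof (rule has_bochner_integral_lborel_nonneg)
  let ?w = "\<lambda>x. sqrt ((mp_hi - x) * (x - mp_lo))"
  have "((\<lambda>x. (?w x / (x + 0) - ?w x / (x + t)) / (2 * pi * lam * t)) has_integral
      (pi * (1 + lam + 0 - mp_disc 0) - pi * (1 + lam + t - mp_disc t)) / (2 * pi * lam * t)) {mp_lo..mp_hi}"
    using t by (intro has_integral_divide has_integral_diff mp_root_stieltjes) auto
  then have "((\<lambda>x. if x \<in> {mp_lo..mp_hi} then (?w x / x - ?w x / (x + t)) / (2 * pi * lam * t) else 0) has_integral
      (pi * (1 + lam + 0 - mp_disc 0) - pi * (1 + lam + t - mp_disc t)) / (2 * pi * lam * t)) UNIV"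
    unfolding has_integral_restrict_UNIV by simp
  moreover have "(pi * (1 + lam + 0 - mp_disc 0) - pi * (1 + lam + t - mp_disc t)) / (2 * pi * lam * t) = (2 * min 1 lam - (1 + lam + t) + mp_disc t) / (2 * lam * t)"
  proof -
    have "1 + lam + 0 - mp_disc 0 = 2 * min 1 lam" by (auto simp: mp_disc_0 min_def)
    then have "pi * (1 + lam + 0 - mp_disc 0) - pi * (1 + lam + t - mp_disc t) = pi * (2 * min 1 lam - (1 + lam + t) + mp_disc t)"
      by (simp add: algebra_simps)
    then show ?thesis by simp
  qed
  moreover have "(if x \<in> {mp_lo..mp_hi} then (?w x / x - ?w x / (x + t)) / (2 * pi * lam * t) else 0) = mp_density lam x / (\<bar>x\<bar> + t)" for x
  proof (cases "x \<in> {mp_lo..mp_hi}")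
    case True
    then have x: "x \<ge> 0" using mp_lo_nonneg by auto
    show ?thesis
    proof (cases "x = 0")
      case True
      with \<open>x \<in> _\<close> have "mp_lo = 0" using mp_lo_nonneg by auto
      then show ?thesis using True by (simp add: mp_density_eq)
    next
      case False
      with x have "x > 0" by simp
      then have "?w x / x - ?w x / (x + t) = t * (?w x / x / (x + t))" using t by (simp add: field_simps)
      then show ?thesis using True t x by (simp add: mp_density_eq)
    qed
  next
    case False
    then show ?thesis by (auto simp: mp_density_eq)
  qed
  ultimately show "((\<lambda>x. mp_density lam x / (\<bar>x\<bar> + t)) has_integral (2 * min 1 lam - (1 + lam + t) + mp_disc t) / (2 * lam * t)) UNIV"
    by simp
next
  show "0 \<le> mp_density lam x / (\<bar>x\<bar> + t)" for x using t mp_density_nonneg by simp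
qed measurable

text \<open>The atom of mass \<open>1 - 1/\<lambda>\<close> at the origin is obtained by spreading it uniformly
  over \<open>[-1, 0)\<close> and pushing the resulting density forward along \<open>max 0\<close>.\<close>

definition mp_lift where
  "mp_lift x = mp_density lam x + (if lam > 1 then 1 - 1 / lam else 0) * indicator {-1..<0} x"

definition mp_measure :: "real measure" where
  "mp_measure = distr (density lborel mp_lift) borel (max 0)"

lemma mp_lift_nonneg: "0 \<le> mp_lift x"
  using lam by (simp add: mp_lift_def mp_density_nonneg)

lemma mp_lift_measurable [measurable]: "mp_lift \<in> borel_measurable borel"
  unfolding mp_lift_def by measurable

text \<open>On \<open>[-1, 0)\<close> the map \<open>max 0\<close> is constantly 0, so the spread
  mass contributes exactly what an atom at 0 would.\<close>

lemma mp_lift_weighted_integral: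
  assumes "has_bochner_integral lborel (\<lambda>x. mp_density lam x * g (max 0 x)) I"
  shows "has_bochner_integral lborel (\<lambda>x. mp_lift x * g (max 0 x)) (I + (if lam > 1 then 1 - 1 / lam else 0) * g 0)"
proof -
  have "has_bochner_integral lborel (indicator {-1..<0} :: real \<Rightarrow> real) (measure lborel {-1..<0::real})"
    by (rule has_bochner_integral_real_indicator) auto
  then have "has_bochner_integral lborel (\<lambda>x::real. ((if lam > 1 then 1 - 1 / lam else 0) * g 0) * indicator {-1..<0} x)
      ((if lam > 1 then 1 - 1 / lam else 0) * g 0 * 1)"
    by (intro has_bochner_integral_mult_right) auto
  from has_bochner_integral_add[OF assms this]
  have *: "has_bochner_integral lborel (\<lambda>x. mp_density lam x * g (max 0 x) + (if lam > 1 then 1 - 1 / lam else 0) * g 0 * indicator {-1..<0} x)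
     (I + (if lam > 1 then 1 - 1 / lam else 0) * g 0)" by simp
  have "(\<lambda>x. mp_density lam x * g (max 0 x) + (if lam > 1 then 1 - 1 / lam else 0) * g 0 * indicator {-1..<0} x)
     = (\<lambda>x. mp_lift x * g (max 0 x))"
    by (rule ext) (auto simp: mp_lift_def indicator_def algebra_simps max_def)
  with * show ?thesis by simp
qed

lemma mp_lift_integral: "has_bochner_integral lborel mp_lift 1"
proof -
  have "has_bochner_integral lborel (\<lambda>x. mp_lift x * (\<lambda>_. 1) (max 0 x)) ((if lam > 1 then 1 / lam else 1) + (if lam > 1 then 1 - 1 / lam else 0) * 1)"
    by (rule mp_lift_weighted_integral[where g = "\<lambda>_. 1"]) (use mp_density_integral in simp)
  then show ?thesis by (auto split: if_splits)
qed

lemma real_distribution_mp: "real_distribution mp_measure"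
proof -
  have "emeasure (density lborel mp_lift) (space (density lborel mp_lift)) = (\<integral>\<^sup>+x. ennreal (mp_lift x) \<partial>lborel)"
    by (subst emeasure_density) auto
  also have "\<dots> = ennreal 1"
    using mp_lift_integral mp_lift_nonneg
    by (subst nn_integral_eq_integral) (auto simp: has_bochner_integral_iff)
  finally have "prob_space (density lborel mp_lift)" by (intro prob_spaceI) simp
  then have "prob_space mp_measure" unfolding mp_measure_def by (rule prob_space.prob_space_distr) measurable
  then show ?thesis
    by (simp add: real_distribution_def real_distribution_axioms_def mp_measure_def)
qed

lemma mp_measure_integral:
  assumes [measurable]: "g \<in> borel_measurable borel"
  shows "(\<integral>x. g x \<partial>mp_measure) = (\<integral>x. mp_lift x * g (max 0 x) \<partial>lborel)"
  unfolding mp_measure_def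
  by (subst integral_distr) (auto simp: integral_density mp_lift_nonneg)

lemma AE_mp_measure_nonneg: "AE x in mp_measure. 0 \<le> x"
  unfolding mp_measure_def by (subst AE_distr_iff) auto

lemma cdf_mp_measure: "cdf mp_measure x = mp_cdf lam x"
proof -
  interpret real_distribution mp_measure by (rule real_distribution_mp)
  have "cdf mp_measure x = (\<integral>y. indicator {..x} y \<partial>mp_measure)"
    by (simp add: cdf_def)
  also have "\<dots> = (\<integral>y. mp_lift y * indicator {..x} (max 0 y) \<partial>lborel)"
    by (rule mp_measure_integral) auto
  also have "\<dots> = (\<integral>y. mp_density lam y * indicator {..x} (max 0 y) \<partial>lborel) + (if lam > 1 then 1 - 1 / lam else 0) * indicator {..x} 0"
  proof (rule has_bochner_integral_integral_eq, rule mp_lift_weighted_integral, rule has_bochner_integral_integrable)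
    show "integrable lborel (\<lambda>y. mp_density lam y * indicator {..x} (max 0 y))"
      by (rule Bochner_Integration.integrable_bound[of _ "mp_density lam"])
         (use mp_density_integral in \<open>auto simp: has_bochner_integral_iff indicator_def\<close>)
  qed
  also have "(\<lambda>y. mp_density lam y * indicator {..x} (max 0 y)) = (\<lambda>y. indicator {0<..x} y * mp_density lam y)"
    by (rule ext) (auto simp: indicator_def mp_density_def)
  finally show ?thesis by (simp add: mp_cdf_def indicator_def)
qed

definition mp_stieltjes where "mp_stieltjes t = (\<integral>x. 1 / (x + t) \<partial>mp_measure)"

lemma mp_stieltjes_eq:
  assumes t: "t > 0"
  shows "mp_stieltjes t = (mp_disc t - (t + 1 - lam)) / (2 * lam * t)"
proof -
  have "mp_stieltjes t = (\<integral>x. mp_lift x * (\<lambda>x. 1 / (x + t)) (max 0 x) \<partial>lborel)"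
    unfolding mp_stieltjes_def by (rule mp_measure_integral) measurable
  also have "\<dots> = (2 * min 1 lam - (1 + lam + t) + mp_disc t) / (2 * lam * t) + (if lam > 1 then 1 - 1 / lam else 0) * (1 / (0 + t))"
  proof (rule has_bochner_integral_integral_eq, rule mp_lift_weighted_integral)
    have "(\<lambda>x. mp_density lam x / (\<bar>x\<bar> + t)) = (\<lambda>x. mp_density lam x * (1 / (max 0 x + t)))"
    proof
      fix x show "mp_density lam x / (\<bar>x\<bar> + t) = mp_density lam x * (1 / (max 0 x + t))"
        by (cases "x > 0") (auto simp: mp_density_def)
    qed
    then show "has_bochner_integral lborel (\<lambda>x. mp_density lam x * (1 / (max 0 x + t))) ((2 * min 1 lam - (1 + lam + t) + mp_disc t) / (2 * lam * t))"
      using mp_density_stieltjes[OF t] by (simp only:)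
  qed
  also have "\<dots> = (mp_disc t - (t + 1 - lam)) / (2 * lam * t)"
    using lam t by (auto simp: field_simps min_def)
  finally show ?thesis .
qed

text \<open>The explicit formula is the larger root of
  \<open>lam t s^2 + (t + 1 - lam) s - 1\<close>; it is positive since \<open>mp_disc\<close>
  exceeds the modulus of the linear coefficient. Dividing the quadratic equation by
  \<open>1 + lam s\<close> gives the stated form.\<close>

lemma mp_stieltjes_fixed_point:
  assumes t: "t > 0"
  shows "mp_stieltjes t > 0" "t * mp_stieltjes t + mp_stieltjes t / (1 + lam * mp_stieltjes t) = 1"
proof -
  define s where "s = mp_stieltjes t"
  have s: "2 * lam * t * s + (t + 1 - lam) = mp_disc t" using mp_stieltjes_eq[OF t] lam t by (simp add: s_def)
  have D: "(mp_disc t)\<^sup>2 = (t + 1 - lam)\<^sup>2 + 4 * lam * t" unfolding mp_disc_def using lam t by (intro real_sqrt_pow2) auto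
  have "\<bar>t + 1 - lam\<bar> < mp_disc t"
  proof (rule power2_less_imp_less)
    show "\<bar>t + 1 - lam\<bar>\<^sup>2 < (mp_disc t)\<^sup>2" unfolding D using lam t by simp
    show "0 \<le> mp_disc t" unfolding mp_disc_def using lam t by simp
  qed
  then have "2 * lam * t * s > 0" using s by linarith
  then show pos: "mp_stieltjes t > 0" unfolding s_def by (rule zero_less_mult_pos) (use lam t in simp)
  have "(2 * lam * t * s + (t + 1 - lam))\<^sup>2 = (t + 1 - lam)\<^sup>2 + 4 * lam * t" unfolding s D ..
  then have "4 * lam * t * (lam * t * s\<^sup>2 + s * (t + 1 - lam) - 1) = 0" by (simp add: power2_eq_square algebra_simps)
  then have q: "lam * t * s\<^sup>2 + s * (t + 1 - lam) = 1" using lam t by simp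
  have "1 + lam * s > 0" using pos lam by (simp add: s_def add_pos_pos)
  then have "t * s + s / (1 + lam * s) = 1" using q by (simp add: field_simps power2_eq_square)
  then show "t * mp_stieltjes t + mp_stieltjes t / (1 + lam * mp_stieltjes t) = 1" by (simp add: s_def)
qed

end

section \<open>Bounded differences\<close>

text \<open>Induction over the coordinates. Integrating out coordinate \<open>i\<close> gives
  \<open>g\<close>, which inherits the bound and the differences of \<open>f\<close>. With the other
  coordinates fixed, \<open>f\<close> stays within \<open>c\<close> of its value at a base point
  \<open>y0\<close>, an interval of length \<open>2 c\<close>, for which Hoeffding's lemma gives the
  exponent \<open>l^2 (2 c)^2 / 8 = l^2 c^2 / 2\<close>.\<close>

lemma mcdiarmid_mgf:
  fixes N :: "'i \<Rightarrow> 'b measure" and f :: "('i \<Rightarrow> 'b) \<Rightarrow> real"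
  assumes I: "finite I" and N: "\<And>i. prob_space (N i)"
    and f: "f \<in> borel_measurable (PiM I N)" and b: "\<And>x. x \<in> space (PiM I N) \<Longrightarrow> \<bar>f x\<bar> \<le> b"
    and diff: "\<And>x i y. x \<in> space (PiM I N) \<Longrightarrow> i \<in> I \<Longrightarrow> y \<in> space (N i) \<Longrightarrow> \<bar>f (x(i := y)) - f x\<bar> \<le> c"
    and l: "l > 0"
  shows "(\<integral>\<^sup>+x. ennreal (exp (l * (f x - (\<integral>x. f x \<partial>PiM I N)))) \<partial>PiM I N) \<le> ennreal (exp (real (card I) * (l\<^sup>2 * c\<^sup>2 / 2)))"
  using I f b diff
proof (induction I arbitrary: f rule: finite_induct)
  case empty
  have sp: "space (PiM {} N) = {\<lambda>_. undefined}" by (simp add: space_PiM)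
  interpret E: prob_space "PiM {} N" by (intro prob_space_PiM N)
  have "(\<integral>x. f x \<partial>PiM {} N) = (\<integral>x. f (\<lambda>_. undefined) \<partial>PiM {} N)"
    by (intro Bochner_Integration.integral_cong) (auto simp: sp)
  also have "\<dots> = f (\<lambda>_. undefined)" using E.prob_space by simp
  finally have "(\<integral>\<^sup>+x. ennreal (exp (l * (f x - (\<integral>x. f x \<partial>PiM {} N)))) \<partial>PiM {} N) = (\<integral>\<^sup>+x. 1 \<partial>PiM {} N)"
    by (intro nn_integral_cong) (auto simp: sp)
  also have "\<dots> = 1" using E.emeasure_space_1 by simp
  finally show ?case by simp
next
  case (insert i I)
  interpret Ni: prob_space "N i" by (rule N)
  interpret PiI: prob_space "PiM (insert i I) N" by (intro prob_space_PiM N)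
  interpret N: product_prob_space N by (intro product_prob_spaceI N)
  note [measurable] = insert.prems(1)
  have upd [measurable]: "(\<lambda>(x, y). x(i := y)) \<in> measurable (PiM I N \<Otimes>\<^sub>M N i) (PiM (insert i I) N)"
    by (rule measurable_add_dim)
  have sp: "x(i := y) \<in> space (PiM (insert i I) N)" if "x \<in> space (PiM I N)" "y \<in> space (N i)" for x y
    using that by (auto simp: space_PiM PiE_iff extensional_def)
  have fm2 [measurable]: "(\<lambda>(x, y). f (x(i := y))) \<in> borel_measurable (PiM I N \<Otimes>\<^sub>M N i)"
    using measurable_compose[OF upd insert.prems(1)] by (simp add: case_prod_beta')
  have fy: "(\<lambda>y. f (x(i := y))) \<in> borel_measurable (N i)" if "x \<in> space (PiM I N)" for x
    using measurable_compose[OF measurable_Pair1'[OF that] fm2] by simp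
  have fyint: "integrable (N i) (\<lambda>y. f (x(i := y)))" if "x \<in> space (PiM I N)" for x
    by (rule Ni.integrable_const_bound[where B = b, OF AE_I2 fy[OF that]])
       (unfold real_norm_def, rule insert.prems(2)[OF sp[OF that]])
  define g where "g = (\<lambda>x. \<integral>y. f (x(i := y)) \<partial>N i)"
  have gm [measurable]: "g \<in> borel_measurable (PiM I N)"
    unfolding g_def using Ni.borel_measurable_lebesgue_integral[OF fm2] by simp
  have fint: "integrable (PiM (insert i I) N) f"
    by (rule PiI.integrable_const_bound[where B = b]) (use insert.prems in auto)
  have Ef: "(\<integral>x. f x \<partial>PiM (insert i I) N) = (\<integral>x. g x \<partial>PiM I N)"
    unfolding g_def using insert.hyps fint by (intro N.product_integral_insert) auto
  have g_b: "\<bar>g x\<bar> \<le> b" if x: "x \<in> space (PiM I N)" for x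
  proof -
    have "\<bar>g x\<bar> \<le> (\<integral>y. \<bar>f (x(i := y))\<bar> \<partial>N i)" unfolding g_def by (rule integral_abs_bound)
    also have "\<dots> \<le> (\<integral>y. b \<partial>N i)" by (intro integral_mono integrable_abs fyint[OF x] Ni.integrable_const insert.prems(2)[OF sp[OF x]])
    also have "\<dots> = b" using Ni.prob_space by simp
    finally show ?thesis .
  qed
  have g_diff: "\<bar>g (x(j := z)) - g x\<bar> \<le> c" if x: "x \<in> space (PiM I N)" and j: "j \<in> I" and z: "z \<in> space (N j)" for x j z
  proof -
    have xj: "x(j := z) \<in> space (PiM I N)"
      using that by (auto simp: space_PiM PiE_iff extensional_def)
    have ji: "j \<noteq> i" using insert.hyps j by auto
    have "g (x(j := z)) - g x = (\<integral>y. f (x(j := z, i := y)) - f (x(i := y)) \<partial>N i)"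
      unfolding g_def using fyint[OF x] fyint[OF xj] by simp
    also have "\<bar>\<dots>\<bar> \<le> (\<integral>y. \<bar>f (x(j := z, i := y)) - f (x(i := y))\<bar> \<partial>N i)" by (rule integral_abs_bound)
    also have "\<dots> \<le> (\<integral>y. c \<partial>N i)"
    proof (rule integral_mono)
      fix y assume y: "y \<in> space (N i)"
      have "x(j := z, i := y) = (x(i := y))(j := z)" using ji by (simp add: fun_upd_twist)
      moreover have "\<bar>f ((x(i := y))(j := z)) - f (x(i := y))\<bar> \<le> c"
        by (rule insert.prems(3)[OF sp[OF x y]]) (use j z in auto)
      ultimately show "\<bar>f (x(j := z, i := y)) - f (x(i := y))\<bar> \<le> c" by (simp only:)
    qed (use fyint[OF x] fyint[OF xj] in auto)
    also have "\<dots> = c" using Ni.prob_space by simp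
    finally show ?thesis .
  qed
  have inner: "(\<integral>\<^sup>+y. ennreal (exp (l * (f (x(i := y)) - g x))) \<partial>N i) \<le> ennreal (exp (l\<^sup>2 * c\<^sup>2 / 2))"
    if x: "x \<in> space (PiM I N)" for x
  proof -
    obtain y0 where y0: "y0 \<in> space (N i)" using Ni.not_empty by auto
    let ?v = "f (x(i := y0))"
    interpret ib: interval_bounded_random_variable "N i" "\<lambda>y. f (x(i := y))" "?v - c" "?v + c"
    proof
      show "(\<lambda>y. f (x(i := y))) \<in> borel_measurable (N i)" by (rule fy[OF x])
      show "AE y in N i. f (x(i := y)) \<in> {?v - c..?v + c}"
      proof (rule AE_I2)
        fix y assume y: "y \<in> space (N i)"
        show "f (x(i := y)) \<in> {?v - c..?v + c}"
        proof -
          have "\<bar>f ((x(i := y0))(i := y)) - ?v\<bar> \<le> c"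
            by (rule insert.prems(3)[OF sp[OF x y0]]) (use y in auto)
          then have "\<bar>f (x(i := y)) - ?v\<bar> \<le> c" by (simp only: fun_upd_upd)
          then show ?thesis by (simp only: atLeastAtMost_iff) linarith
        qed
      qed
    qed
    have "(\<integral>\<^sup>+y. ennreal (exp (l * (f (x(i := y)) - g x))) \<partial>N i) \<le> ennreal (exp (l\<^sup>2 * (?v + c - (?v - c))\<^sup>2 / 8))"
      using ib.Hoeffdings_lemma_nn_integral[OF l] by (simp add: g_def)
    also have "l\<^sup>2 * (?v + c - (?v - c))\<^sup>2 / 8 = l\<^sup>2 * c\<^sup>2 / 2" by (simp add: power2_eq_square algebra_simps)
    finally show ?thesis .
  qed
  let ?E = "\<integral>x. g x \<partial>PiM I N"
  have "(\<integral>\<^sup>+x. ennreal (exp (l * (f x - ?E))) \<partial>PiM (insert i I) N)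
      = (\<integral>\<^sup>+x. \<integral>\<^sup>+y. ennreal (exp (l * (f (x(i := y)) - ?E))) \<partial>N i \<partial>PiM I N)"
    using insert.hyps by (intro N.product_nn_integral_insert) auto
  also have "\<dots> \<le> (\<integral>\<^sup>+x. ennreal (exp (l\<^sup>2 * c\<^sup>2 / 2)) * ennreal (exp (l * (g x - ?E))) \<partial>PiM I N)"
  proof (rule nn_integral_mono)
    fix x assume x: "x \<in> space (PiM I N)"
    have "(\<integral>\<^sup>+y. ennreal (exp (l * (f (x(i := y)) - ?E))) \<partial>N i)
       = (\<integral>\<^sup>+y. ennreal (exp (l * (g x - ?E))) * ennreal (exp (l * (f (x(i := y)) - g x))) \<partial>N i)"
      by (intro nn_integral_cong) (simp flip: ennreal_mult' exp_add add: algebra_simps)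
    also have "\<dots> = ennreal (exp (l * (g x - ?E))) * (\<integral>\<^sup>+y. ennreal (exp (l * (f (x(i := y)) - g x))) \<partial>N i)"
      using fy[OF x] by (intro nn_integral_cmult) auto
    also have "\<dots> \<le> ennreal (exp (l * (g x - ?E))) * ennreal (exp (l\<^sup>2 * c\<^sup>2 / 2))"
      by (intro mult_left_mono inner x) auto
    finally show "(\<integral>\<^sup>+y. ennreal (exp (l * (f (x(i := y)) - ?E))) \<partial>N i) \<le> ennreal (exp (l\<^sup>2 * c\<^sup>2 / 2)) * ennreal (exp (l * (g x - ?E)))"
      by (simp add: mult.commute)
  qed
  also have "\<dots> = ennreal (exp (l\<^sup>2 * c\<^sup>2 / 2)) * (\<integral>\<^sup>+x. ennreal (exp (l * (g x - ?E))) \<partial>PiM I N)"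
    by (intro nn_integral_cmult) auto
  also have "\<dots> \<le> ennreal (exp (l\<^sup>2 * c\<^sup>2 / 2)) * ennreal (exp (real (card I) * (l\<^sup>2 * c\<^sup>2 / 2)))"
    by (intro mult_left_mono insert.IH gm g_b g_diff) auto
  also have "\<dots> = ennreal (exp (real (card (insert i I)) * (l\<^sup>2 * c\<^sup>2 / 2)))"
    using insert.hyps by (simp flip: ennreal_mult' exp_add add: algebra_simps)
  finally show ?case unfolding Ef .
qed

text \<open>The constant is \<open>4 ^ 4\<close>, from the fourth power of
  \<open>y / 4 <= exp (y / 4)\<close>.\<close>

lemma power4_le_exp: "(x::real) ^ 4 \<le> 256 * (exp x + exp (- x))"
proof -
  have *: "y ^ 4 \<le> 256 * exp y" if "y \<ge> 0" for y :: real
  proof -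
    have "(y / 4) ^ 4 \<le> exp (y / 4) ^ 4"
    proof (rule power_mono)
      show "y / 4 \<le> exp (y / 4)" using exp_ge_add_one_self[of "y / 4"] by linarith
    qed (use that in simp)
    also have "exp (y / 4) ^ 4 = exp y" by (simp flip: exp_of_nat_mult)
    finally show ?thesis by (simp add: power_divide)
  qed
  show ?thesis
  proof (cases "x \<ge> 0")
    case True then show ?thesis using *[of x] exp_ge_zero[of "-x"] by (simp add: algebra_simps add_increasing2)
  next
    case False then show ?thesis using *[of "-x"] exp_ge_zero[of "x"] by (simp add: algebra_simps add_increasing)
  qed
qed

lemma mcdiarmid_fourth_moment_PiM:
  fixes N :: "'i \<Rightarrow> 'b measure" and f :: "('i \<Rightarrow> 'b) \<Rightarrow> real"
  assumes I: "finite I" "I \<noteq> {}" and N: "\<And>i. prob_space (N i)"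
    and f [measurable]: "f \<in> borel_measurable (PiM I N)" and b: "\<And>x. x \<in> space (PiM I N) \<Longrightarrow> \<bar>f x\<bar> \<le> b"
    and diff: "\<And>x i y. x \<in> space (PiM I N) \<Longrightarrow> i \<in> I \<Longrightarrow> y \<in> space (N i) \<Longrightarrow> \<bar>f (x(i := y)) - f x\<bar> \<le> c"
    and c: "c > 0"
  shows "(\<integral>\<^sup>+x. ennreal ((f x - (\<integral>x. f x \<partial>PiM I N)) ^ 4) \<partial>PiM I N) \<le> ennreal (1024 * c ^ 4 * (real (card I))\<^sup>2)"
proof -
  define k where "k = real (card I)"
  have k: "k > 0" using I by (simp add: k_def card_gt_0_iff)
  \<comment> \<open>This scale makes the exponent of \<open>mcdiarmid_mgf\<close> equal to 1/2, and
    \<open>exp (1/2) <= 2\<close>. The two exponentials then contribute at most 4, and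
    \<open>4 * 256 = 1024\<close>.\<close>
  define l where "l = 1 / (c * sqrt k)"
  have l: "l > 0" using c k by (simp add: l_def)
  have l2: "l\<^sup>2 = 1 / (c\<^sup>2 * k)" using k by (simp add: l_def power_divide power_mult_distrib)
  have "l ^ 4 = (l\<^sup>2)\<^sup>2" by simp
  then have l4: "l ^ 4 = 1 / (c ^ 4 * k\<^sup>2)" unfolding l2 by (simp add: power_divide power_mult_distrib)
  have kl: "k * (l\<^sup>2 * c\<^sup>2 / 2) = 1 / 2" using c k by (simp add: l2)
  let ?E = "\<integral>x. f x \<partial>PiM I N"
  have half: "exp (1 / 2 :: real) \<le> 2"
    using exp_bound_half[of "1 / 2 :: real"] by simp
  have p1: "(\<integral>\<^sup>+x. ennreal (exp (l * (f x - ?E))) \<partial>PiM I N) \<le> ennreal 2"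
    using mcdiarmid_mgf[OF I(1) N f b diff l] half unfolding k_def[symmetric] kl
    by (meson ennreal_leI order_trans)
  have "(\<integral>\<^sup>+x. ennreal (exp (l * ((- f x) - (\<integral>x. - f x \<partial>PiM I N)))) \<partial>PiM I N) \<le> ennreal (exp (real (card I) * (l\<^sup>2 * c\<^sup>2 / 2)))"
    by (rule mcdiarmid_mgf[OF I(1) N _ _ _ l, where b = b])
       (use b in \<open>auto simp: abs_minus_commute dest!: diff\<close>)
  then have p2: "(\<integral>\<^sup>+x. ennreal (exp (- (l * (f x - ?E)))) \<partial>PiM I N) \<le> ennreal 2"
    using ennreal_leI[OF half] unfolding k_def[symmetric] kl
    by (simp add: algebra_simps)
  have pw: "ennreal ((f x - ?E) ^ 4) \<le> ennreal (256 / l ^ 4) * (ennreal (exp (l * (f x - ?E))) + ennreal (exp (- (l * (f x - ?E)))))" for x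
  proof -
    have "(l * (f x - ?E)) ^ 4 \<le> 256 * (exp (l * (f x - ?E)) + exp (- (l * (f x - ?E))))"
      by (rule power4_le_exp)
    then have "(f x - ?E) ^ 4 \<le> 256 / l ^ 4 * (exp (l * (f x - ?E)) + exp (- (l * (f x - ?E))))"
      using l unfolding power_mult_distrib by (simp add: pos_le_divide_eq mult.commute)
    then show ?thesis
      using l by (simp flip: ennreal_mult' ennreal_plus add: ennreal_leI)
  qed
  have "(\<integral>\<^sup>+x. ennreal ((f x - ?E) ^ 4) \<partial>PiM I N)
      \<le> (\<integral>\<^sup>+x. ennreal (256 / l ^ 4) * (ennreal (exp (l * (f x - ?E))) + ennreal (exp (- (l * (f x - ?E))))) \<partial>PiM I N)"
    by (intro nn_integral_mono pw)
  also have "\<dots> = ennreal (256 / l ^ 4) * ((\<integral>\<^sup>+x. ennreal (exp (l * (f x - ?E))) \<partial>PiM I N) + (\<integral>\<^sup>+x. ennreal (exp (- (l * (f x - ?E)))) \<partial>PiM I N))"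
    by (subst nn_integral_cmult) (auto simp: nn_integral_add)
  also have "\<dots> \<le> ennreal (256 / l ^ 4) * (ennreal 2 + ennreal 2)"
    by (intro mult_left_mono add_mono p1 p2) auto
  also have "\<dots> = ennreal (256 / l ^ 4 * 4)"
    using l by (subst ennreal_mult') simp_all
  also have "\<dots> = ennreal (1024 * c ^ 4 * k\<^sup>2)"
    by (simp add: l4 mult.assoc)
  finally show ?thesis by (simp add: k_def)
qed

lemma (in prob_space) mcdiarmid_fourth_moment:
  fixes Z :: "'i \<Rightarrow> 'a \<Rightarrow> 'b" and f :: "('i \<Rightarrow> 'b) \<Rightarrow> real"
  assumes I: "finite I" "I \<noteq> {}" and ind: "indep_vars N Z I"
    and f [measurable]: "f \<in> borel_measurable (PiM I N)" and b: "\<And>x. x \<in> space (PiM I N) \<Longrightarrow> \<bar>f x\<bar> \<le> b"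
    and diff: "\<And>x i y. x \<in> space (PiM I N) \<Longrightarrow> i \<in> I \<Longrightarrow> y \<in> space (N i) \<Longrightarrow> \<bar>f (x(i := y)) - f x\<bar> \<le> c"
    and c: "c > 0"
  defines "F \<equiv> (\<lambda>\<omega>. f (\<lambda>i\<in>I. Z i \<omega>))"
  shows "(\<integral>\<^sup>+\<omega>. ennreal ((F \<omega> - expectation F) ^ 4) \<partial>M) \<le> ennreal (1024 * c ^ 4 * (real (card I))\<^sup>2)"
proof -
  have rv [measurable]: "i \<in> I \<Longrightarrow> random_variable (N i) (Z i)" for i
    using ind by (simp add: indep_vars_def)
  obtain i0 where i0: "i0 \<in> I" using I by auto
  \<comment> \<open>Outside \<open>I\<close> the law of an arbitrary \<open>i0\<close> is repeated,
    so that \<open>L i\<close> is a probability measure for every index, as the product space lemma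
    demands.\<close>
  define L where "L = (\<lambda>i. if i \<in> I then distr M (N i) (Z i) else distr M (N i0) (Z i0))"
  have L: "prob_space (L i)" for i
    unfolding L_def using i0 by (auto intro: prob_space_distr rv)
  have sets_L: "sets (PiM I L) = sets (PiM I N)"
    by (intro sets_PiM_cong) (auto simp: L_def)
  have space_L: "space (PiM I L) = space (PiM I N)"
    using sets_eq_imp_space_eq[OF sets_L] .
  have "distr M (PiM I N) (\<lambda>\<omega>. \<lambda>i\<in>I. Z i \<omega>) = PiM I (\<lambda>i. distr M (N i) (Z i))"
    using ind indep_vars_iff_distr_eq_PiM'[OF I(2) rv] by simp
  also have "\<dots> = PiM I L" by (intro PiM_cong) (auto simp: L_def)
  finally have D: "distr M (PiM I N) (\<lambda>\<omega>. \<lambda>i\<in>I. Z i \<omega>) = PiM I L" .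
  have Zm [measurable]: "(\<lambda>\<omega>. \<lambda>i\<in>I. Z i \<omega>) \<in> measurable M (PiM I N)" by (intro measurable_restrict rv)
  have EF: "expectation F = (\<integral>x. f x \<partial>PiM I L)"
    unfolding F_def D[symmetric] by (subst integral_distr) auto
  have "(\<integral>\<^sup>+\<omega>. ennreal ((F \<omega> - expectation F) ^ 4) \<partial>M) = (\<integral>\<^sup>+x. ennreal ((f x - expectation F) ^ 4) \<partial>PiM I L)"
    unfolding D[symmetric] F_def by (subst nn_integral_distr) auto
  also have "\<dots> \<le> ennreal (1024 * c ^ 4 * (real (card I))\<^sup>2)"
    unfolding EF
  proof (rule mcdiarmid_fourth_moment_PiM[OF I L _ _ _ c, where b = b])
    show "f \<in> borel_measurable (PiM I L)" using f by (simp add: measurable_cong_sets[OF sets_L refl])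
    show "\<bar>f x\<bar> \<le> b" if "x \<in> space (PiM I L)" for x using that b by (simp add: space_L)
    show "\<bar>f (x(i := y)) - f x\<bar> \<le> c" if "x \<in> space (PiM I L)" "i \<in> I" "y \<in> space (L i)" for x i y
    proof (rule diff[OF _ that(2)])
      show "x \<in> space (PiM I N)" using that(1) by (simp only: space_L)
      show "y \<in> space (N i)" using that(2,3) by (simp add: L_def)
    qed
  qed
  finally show ?thesis .
qed

section \<open>Quadratic forms of block-independent vectors\<close>

lemma integral_sum2:
  fixes f :: "'i \<Rightarrow> 'j \<Rightarrow> 'a \<Rightarrow> real"
  assumes "\<And>i j. i \<in> I \<Longrightarrow> j \<in> J \<Longrightarrow> integrable M (f i j)"
  shows "(\<integral>\<omega>. (\<Sum>i\<in>I. \<Sum>j\<in>J. f i j \<omega>) \<partial>M) = (\<Sum>i\<in>I. \<Sum>j\<in>J. \<integral>\<omega>. f i j \<omega> \<partial>M)"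
proof -
  have "(\<integral>\<omega>. (\<Sum>i\<in>I. \<Sum>j\<in>J. f i j \<omega>) \<partial>M) = (\<Sum>i\<in>I. \<integral>\<omega>. (\<Sum>j\<in>J. f i j \<omega>) \<partial>M)"
    by (rule Bochner_Integration.integral_sum) (rule Bochner_Integration.integrable_sum, rule assms)
  also have "\<dots> = (\<Sum>i\<in>I. \<Sum>j\<in>J. \<integral>\<omega>. f i j \<omega> \<partial>M)"
    by (rule sum.cong[OF refl], rule Bochner_Integration.integral_sum) (rule assms)
  finally show ?thesis .
qed

lemma integral_sum4:
  fixes f :: "nat \<Rightarrow> nat \<Rightarrow> nat \<Rightarrow> nat \<Rightarrow> 'a \<Rightarrow> real"
  assumes "\<And>i j k l. i < p \<Longrightarrow> j < p \<Longrightarrow> k < p \<Longrightarrow> l < p \<Longrightarrow> integrable M (f i j k l)"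
  shows "(\<integral>\<omega>. (\<Sum>i<p. \<Sum>j<p. \<Sum>k<p. \<Sum>l<p. f i j k l \<omega>) \<partial>M) = (\<Sum>i<p. \<Sum>j<p. \<Sum>k<p. \<Sum>l<p. \<integral>\<omega>. f i j k l \<omega> \<partial>M)"
proof -
  have "(\<integral>\<omega>. (\<Sum>i<p. \<Sum>j<p. \<Sum>k<p. \<Sum>l<p. f i j k l \<omega>) \<partial>M) = (\<Sum>i<p. \<Sum>j<p. \<integral>\<omega>. (\<Sum>k<p. \<Sum>l<p. f i j k l \<omega>) \<partial>M)"
    by (rule integral_sum2) (intro Bochner_Integration.integrable_sum assms; simp)
  also have "\<dots> = (\<Sum>i<p. \<Sum>j<p. \<Sum>k<p. \<Sum>l<p. \<integral>\<omega>. f i j k l \<omega> \<partial>M)"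
    by (rule sum.cong[OF refl], rule sum.cong[OF refl], rule integral_sum2) (intro assms; simp)
  finally show ?thesis .
qed

context prob_space
begin

text \<open>Two applications of the inequality between geometric and arithmetic means bound the
  product by the sum of the fourth powers. Constant factors 1 give the integrability of shorter
  products.\<close>

lemma integrable_prod4:
  fixes a b c d :: "'a \<Rightarrow> real"
  assumes [measurable]: "a \<in> borel_measurable M" "b \<in> borel_measurable M" "c \<in> borel_measurable M" "d \<in> borel_measurable M"
    and int: "integrable M (\<lambda>\<omega>. a \<omega> ^ 4)" "integrable M (\<lambda>\<omega>. b \<omega> ^ 4)" "integrable M (\<lambda>\<omega>. c \<omega> ^ 4)" "integrable M (\<lambda>\<omega>. d \<omega> ^ 4)"
  shows "integrable M (\<lambda>\<omega>. a \<omega> * b \<omega> * c \<omega> * d \<omega>)"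
proof (rule Bochner_Integration.integrable_bound)
  show "integrable M (\<lambda>\<omega>. a \<omega> ^ 4 + b \<omega> ^ 4 + c \<omega> ^ 4 + d \<omega> ^ 4)" using int by simp
  have "\<bar>x * y * z * w\<bar> \<le> x ^ 4 + y ^ 4 + z ^ 4 + w ^ 4" for x y z w :: real
  proof -
    have am: "\<bar>u * v\<bar> \<le> u\<^sup>2 + v\<^sup>2" for u v :: real
    proof -
      have "0 \<le> (\<bar>u\<bar> - \<bar>v\<bar>)\<^sup>2" by simp
      also have "\<dots> = u\<^sup>2 + v\<^sup>2 - 2 * \<bar>u * v\<bar>" by (simp add: power2_diff abs_mult)
      finally show ?thesis by simp
    qed
    have am4: "u\<^sup>2 * v\<^sup>2 * 2 \<le> u ^ 4 + v ^ 4" for u v :: real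
    proof -
      have "0 \<le> (u\<^sup>2 - v\<^sup>2)\<^sup>2" by simp
      also have "\<dots> = u ^ 4 + v ^ 4 - u\<^sup>2 * v\<^sup>2 * 2" by (simp add: power2_diff flip: power_mult)
      finally show ?thesis by simp
    qed
    have "\<bar>x * y * z * w\<bar> = \<bar>(x * y) * (z * w)\<bar>" by (simp add: mult_ac)
    also have "\<dots> \<le> (x * y)\<^sup>2 + (z * w)\<^sup>2" by (rule am)
    also have "\<dots> = x\<^sup>2 * y\<^sup>2 + z\<^sup>2 * w\<^sup>2" by (simp add: power_mult_distrib)
    also have "\<dots> \<le> x ^ 4 + y ^ 4 + z ^ 4 + w ^ 4"
      using am4[of x y] am4[of z w] mult_nonneg_nonneg[OF zero_le_power2[of x] zero_le_power2[of y]]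
        mult_nonneg_nonneg[OF zero_le_power2[of z] zero_le_power2[of w]] by linarith
    finally show ?thesis .
  qed
  then show "AE \<omega> in M. norm (a \<omega> * b \<omega> * c \<omega> * d \<omega>) \<le> norm (a \<omega> ^ 4 + b \<omega> ^ 4 + c \<omega> ^ 4 + d \<omega> ^ 4)"
    by (intro AE_I2) (simp only: real_norm_def, rule order_trans[OF _ abs_ge_self])
qed measurable

end

section \<open>Mixed fourth moments of a block-independent vector\<close>

locale block_vector = prob_space +
  fixes p d :: nat and B :: "nat set set" and x :: "nat \<Rightarrow> 'a \<Rightarrow> real" and C :: real
  assumes part: "partition_on {..<p} B"
    and x_meas: "\<And>i. i < p \<Longrightarrow> x i \<in> borel_measurable M"
    and ind: "indep_vars (\<lambda>J. PiM J (\<lambda>_. borel)) (\<lambda>J \<omega>. \<lambda>i\<in>J. x i \<omega>) B"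
    and mean: "\<And>i. i < p \<Longrightarrow> expectation (x i) = 0"
    and iso: "\<And>i j. i < p \<Longrightarrow> j < p \<Longrightarrow> expectation (\<lambda>\<omega>. x i \<omega> * x j \<omega>) = (if i = j then 1 else 0)"
    and int4: "\<And>i. i < p \<Longrightarrow> integrable M (\<lambda>\<omega>. x i \<omega> ^ 4)"
    and bd4: "\<And>i. i < p \<Longrightarrow> expectation (\<lambda>\<omega>. x i \<omega> ^ 4) \<le> C"
    and card_le: "\<And>J. J \<in> B \<Longrightarrow> card J \<le> d"
begin

lemma integrable_prod4_coords: "i < p \<Longrightarrow> j < p \<Longrightarrow> k < p \<Longrightarrow> l < p \<Longrightarrow> integrable M (\<lambda>\<omega>. x i \<omega> * x j \<omega> * x k \<omega> * x l \<omega>)"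
  by (intro integrable_prod4 x_meas int4)

lemma integrable_prod3_coords: "i < p \<Longrightarrow> j < p \<Longrightarrow> k < p \<Longrightarrow> integrable M (\<lambda>\<omega>. x i \<omega> * x j \<omega> * x k \<omega>)"
  using integrable_prod4[of "x i" "x j" "x k" "\<lambda>_. 1"] by (simp add: x_meas int4)

lemma integrable_prod2_coords: "i < p \<Longrightarrow> j < p \<Longrightarrow> integrable M (\<lambda>\<omega>. x i \<omega> * x j \<omega>)"
  using integrable_prod4[of "x i" "x j" "\<lambda>_. 1" "\<lambda>_. 1"] by (simp add: x_meas int4)

lemma integrable_coord: "i < p \<Longrightarrow> integrable M (x i)"
  using integrable_prod4[of "x i" "\<lambda>_. 1" "\<lambda>_. 1" "\<lambda>_. 1"] by (simp add: x_meas int4)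

definition blk :: "nat \<Rightarrow> nat set" where "blk i = (THE J. J \<in> B \<and> i \<in> J)"

lemma blk_unique: "J \<in> B \<Longrightarrow> i \<in> J \<Longrightarrow> blk i = J"
  unfolding blk_def using part
  by (intro the_equality) (auto simp: partition_on_def disjoint_def)

lemma blk: assumes "i < p" shows "blk i \<in> B" "i \<in> blk i"
proof -
  obtain J where "J \<in> B" "i \<in> J" using part assms by (auto simp: partition_on_def)
  then show "blk i \<in> B" "i \<in> blk i" using blk_unique by auto
qed

lemma block_subset: "J \<in> B \<Longrightarrow> J \<subseteq> {..<p}"
  using part by (auto simp: partition_on_def)

lemma finite_block: "J \<in> B \<Longrightarrow> finite J"
  using block_subset finite_subset by blast

lemma finite_B: "finite B"
  using part by (rule finite_elements[rotated]) simp

lemma indep_blocks: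
  fixes f g :: "(nat set \<Rightarrow> nat \<Rightarrow> real) \<Rightarrow> real"
  assumes UV: "U \<inter> V = {}" "U \<subseteq> B" "V \<subseteq> B"
    and f: "f \<in> borel_measurable (PiM U (\<lambda>J. PiM J (\<lambda>_. borel)))"
    and g: "g \<in> borel_measurable (PiM V (\<lambda>J. PiM J (\<lambda>_. borel)))"
    and F: "F = (\<lambda>\<omega>. f (\<lambda>J\<in>U. \<lambda>i\<in>J. x i \<omega>))" and G: "G = (\<lambda>\<omega>. g (\<lambda>J\<in>V. \<lambda>i\<in>J. x i \<omega>))"
    and int: "integrable M F" "integrable M G"
  shows "expectation (\<lambda>\<omega>. F \<omega> * G \<omega>) = expectation F * expectation G"
proof -
  have "indep_var borel (f \<circ> (\<lambda>\<omega>. \<lambda>J\<in>U. \<lambda>i\<in>J. x i \<omega>)) borel (g \<circ> (\<lambda>\<omega>. \<lambda>J\<in>V. \<lambda>i\<in>J. x i \<omega>))"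
    by (rule indep_var_compose[OF indep_var_restrict[OF ind UV] f g])
  then have "indep_var borel F borel G" by (simp add: F G comp_def)
  then show ?thesis using int by (rule indep_var_lebesgue_integral)
qed

lemma block_coord_measurable:
  "J \<in> U \<Longrightarrow> i \<in> J \<Longrightarrow> (\<lambda>z. z J i) \<in> borel_measurable (PiM U (\<lambda>J. PiM J (\<lambda>_. borel :: real measure)))"
  by (rule measurable_compose[OF measurable_component_singleton[of J U "\<lambda>J. PiM J (\<lambda>_. borel)"]
        measurable_component_singleton[of i J "\<lambda>_. borel"]]) auto

text \<open>The block of \<open>i\<close> contains none of the other indices, so \<open>x i\<close>
  is independent of the remaining product and its zero mean factors out.\<close>

lemma fourth_single:
  assumes "i < p" "j < p" "k < p" "l < p" "blk i \<notin> {blk j, blk k, blk l}"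
  shows "expectation (\<lambda>\<omega>. x i \<omega> * x j \<omega> * x k \<omega> * x l \<omega>) = 0"
proof -
  let ?V = "{blk j, blk k, blk l}"
  have "expectation (\<lambda>\<omega>. x i \<omega> * (x j \<omega> * x k \<omega> * x l \<omega>)) = expectation (x i) * expectation (\<lambda>\<omega>. x j \<omega> * x k \<omega> * x l \<omega>)"
  proof (rule indep_blocks[where U = "{blk i}" and V = ?V and f = "\<lambda>z. z (blk i) i"
        and g = "\<lambda>z. z (blk j) j * z (blk k) k * z (blk l) l"])
    show "(\<lambda>z. z (blk i) i) \<in> borel_measurable (PiM {blk i} (\<lambda>J. PiM J (\<lambda>_. borel :: real measure)))"
      using assms blk by (intro block_coord_measurable) auto
    show "(\<lambda>z. z (blk j) j * z (blk k) k * z (blk l) l) \<in> borel_measurable (PiM ?V (\<lambda>J. PiM J (\<lambda>_. borel :: real measure)))"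
      using assms blk by (intro borel_measurable_times block_coord_measurable) auto
  qed (use assms blk in \<open>auto intro!: integrable_coord integrable_prod3_coords\<close>)
  then show ?thesis using mean[OF assms(1)] by (simp add: mult_ac)
qed

lemma fourth_pair:
  assumes "i < p" "j < p" "k < p" "l < p" "blk i = blk k" "blk j = blk l" "blk i \<noteq> blk j"
  shows "expectation (\<lambda>\<omega>. x i \<omega> * x j \<omega> * x k \<omega> * x l \<omega>) = (if i = k \<and> j = l then 1 else 0)"
proof -
  have "expectation (\<lambda>\<omega>. (x i \<omega> * x k \<omega>) * (x j \<omega> * x l \<omega>)) = expectation (\<lambda>\<omega>. x i \<omega> * x k \<omega>) * expectation (\<lambda>\<omega>. x j \<omega> * x l \<omega>)"
  proof (rule indep_blocks[where U = "{blk i}" and V = "{blk j}" and f = "\<lambda>z. z (blk i) i * z (blk i) k"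
        and g = "\<lambda>z. z (blk j) j * z (blk j) l"])
    have mem: "i \<in> blk i" "k \<in> blk i" "j \<in> blk j" "l \<in> blk j" using assms blk by metis+
    show "(\<lambda>z. z (blk i) i * z (blk i) k) \<in> borel_measurable (PiM {blk i} (\<lambda>J. PiM J (\<lambda>_. borel :: real measure)))"
      using mem by (intro borel_measurable_times block_coord_measurable) auto
    show "(\<lambda>z. z (blk j) j * z (blk j) l) \<in> borel_measurable (PiM {blk j} (\<lambda>J. PiM J (\<lambda>_. borel :: real measure)))"
      using mem by (intro borel_measurable_times block_coord_measurable) auto
    show "(\<lambda>\<omega>. x i \<omega> * x k \<omega>) = (\<lambda>\<omega>. (\<lambda>J\<in>{blk i}. \<lambda>i\<in>J. x i \<omega>) (blk i) i * (\<lambda>J\<in>{blk i}. \<lambda>i\<in>J. x i \<omega>) (blk i) k)"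
      "(\<lambda>\<omega>. x j \<omega> * x l \<omega>) = (\<lambda>\<omega>. (\<lambda>J\<in>{blk j}. \<lambda>i\<in>J. x i \<omega>) (blk j) j * (\<lambda>J\<in>{blk j}. \<lambda>i\<in>J. x i \<omega>) (blk j) l)"
      using mem by auto
  qed (use assms blk in \<open>auto intro!: integrable_prod2_coords\<close>)
  moreover have "(\<lambda>\<omega>. (x i \<omega> * x k \<omega>) * (x j \<omega> * x l \<omega>)) = (\<lambda>\<omega>. x i \<omega> * x j \<omega> * x k \<omega> * x l \<omega>)" by (auto simp: mult_ac)
  ultimately show ?thesis using iso assms by auto
qed

text \<open>No block can hold three of the indices. Hence either one index is alone in its block and
  the moment vanishes, or the blocks match up in pairs and isotropy decides. The outcome is the one
  for fully independent coordinates, although entries within a block are dependent.\<close>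

lemma fourth_off_diagonal:
  assumes "i < p" "j < p" "k < p" "l < p" "blk i \<noteq> blk j" "blk k \<noteq> blk l"
  shows "expectation (\<lambda>\<omega>. x i \<omega> * x j \<omega> * x k \<omega> * x l \<omega>) =
    (if i = k \<and> j = l then 1 else 0) + (if i = l \<and> j = k then 1 else 0)"
proof -
  have main: "expectation (\<lambda>\<omega>. x i \<omega> * x j \<omega> * x k \<omega> * x l \<omega>) = (if i = k \<and> j = l then 1 else 0)"
    if "k < p" "l < p" "blk k \<noteq> blk l" "blk i = blk k" for k l
  proof (cases "blk j = blk l")
    case True
    then show ?thesis using fourth_pair that assms by auto
  next
    case False
    have "expectation (\<lambda>\<omega>. x j \<omega> * x i \<omega> * x k \<omega> * x l \<omega>) = 0"
      by (rule fourth_single) (use that assms False in auto)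
    then show ?thesis using False by (auto simp: mult_ac)
  qed
  consider "blk i \<notin> {blk k, blk l}" | "blk i = blk k" | "blk i = blk l" by auto
  then show ?thesis
  proof cases
    case 1
    have "expectation (\<lambda>\<omega>. x i \<omega> * x j \<omega> * x k \<omega> * x l \<omega>) = 0"
      by (rule fourth_single) (use 1 assms in auto)
    moreover have "i \<noteq> k" "i \<noteq> l" using 1 by auto
    ultimately show ?thesis by simp
  next
    case 2
    have "i \<noteq> l" using 2 assms(6) by auto
    then show ?thesis using main[OF assms(3,4,6) 2] by simp
  next
    case 3
    have "i \<noteq> k" using 3 assms(6) by auto
    moreover have "(\<lambda>\<omega>. x i \<omega> * x j \<omega> * x k \<omega> * x l \<omega>) = (\<lambda>\<omega>. x i \<omega> * x j \<omega> * x l \<omega> * x k \<omega>)" by (simp add: mult_ac)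
    ultimately show ?thesis using main[OF assms(4,3) assms(6)[symmetric] 3] by simp
  qed
qed

lemma sum_blocks: "(\<Sum>i<p. f i) = (\<Sum>J\<in>B. \<Sum>i\<in>J. (f i :: real))"
proof -
  have "(\<Sum>i\<in>\<Union>B. f i) = (\<Sum>J\<in>B. \<Sum>i\<in>J. f i)"
    using part finite_block by (subst sum.Union_disjoint) (auto simp: partition_on_def disjoint_def)
  then show ?thesis using part by (simp add: partition_on_def)
qed

lemma same_block: "J \<in> B \<Longrightarrow> i \<in> J \<Longrightarrow> j < p \<Longrightarrow> blk i = blk j \<longleftrightarrow> j \<in> J"
  using blk_unique blk by metis

lemma sum_same_block:
  "(\<Sum>i<p. \<Sum>j<p. if blk i = blk j then f i j else 0) = (\<Sum>J\<in>B. \<Sum>i\<in>J. \<Sum>j\<in>J. (f i j :: real))"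
  unfolding sum_blocks[of "\<lambda>i. \<Sum>j<p. if blk i = blk j then f i j else 0"]
proof (rule sum.cong[OF refl], rule sum.cong[OF refl])
  fix J i assume J: "J \<in> B" "i \<in> J"
  have "(\<Sum>j<p. if blk i = blk j then f i j else 0) = (\<Sum>j<p. if j \<in> J then f i j else 0)"
    by (intro sum.cong refl) (simp add: same_block[OF J])
  also have "\<dots> = (\<Sum>j\<in>{..<p} \<inter> J. f i j)" by (simp add: sum.inter_restrict)
  also have "{..<p} \<inter> J = J" using block_subset[OF J(1)] by auto
  finally show "(\<Sum>j<p. if blk i = blk j then f i j else 0) = (\<Sum>j\<in>J. f i j)" .
qed

section \<open>Second moment of a quadratic form with a fixed matrix between 0 and
  \<open>1 / t\<close>\<close>

context
  fixes A :: "nat \<Rightarrow> nat \<Rightarrow> real" and t :: real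
  assumes t: "t > 0"
    and A_sym: "\<And>i j. i < p \<Longrightarrow> j < p \<Longrightarrow> A i j = A j i"
    and A_pos: "\<And>v. 0 \<le> dot p v (mat_app p A v)"
    and A_le: "\<And>v. t * dot p v (mat_app p A v) \<le> dot p v v"
    and A_col: "\<And>j. j < p \<Longrightarrow> (\<Sum>i<p. (A i j)\<^sup>2) \<le> 1 / t\<^sup>2"
begin

text \<open>Indices from different blocks are distinct and their coordinates uncorrelated, so this
  part is centred as it stands; the identity is subtracted only in \<open>diag_part\<close>.\<close>

definition off_part :: "'a \<Rightarrow> real" where
  "off_part \<omega> = (\<Sum>i<p. \<Sum>j<p. (if blk i = blk j then 0 else A i j) * (x i \<omega> * x j \<omega>))"

definition diag_part :: "nat set \<Rightarrow> 'a \<Rightarrow> real" where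
  "diag_part J \<omega> = (\<Sum>i\<in>J. \<Sum>j\<in>J. A i j * (x i \<omega> * x j \<omega> - (if i = j then 1 else 0)))"

lemma quadratic_decomposition:
  "(\<Sum>i<p. \<Sum>j<p. A i j * (x i \<omega> * x j \<omega> - (if i = j then 1 else 0))) = off_part \<omega> + (\<Sum>J\<in>B. diag_part J \<omega>)"
proof -
  let ?z = "\<lambda>i j. A i j * (x i \<omega> * x j \<omega> - (if i = j then 1 else 0))"
  have "(\<Sum>i<p. \<Sum>j<p. ?z i j) = (\<Sum>i<p. \<Sum>j<p. (if blk i = blk j then 0 else A i j) * (x i \<omega> * x j \<omega>) + (if blk i = blk j then ?z i j else 0))"
    by (intro sum.cong refl) auto
  also have "\<dots> = off_part \<omega> + (\<Sum>i<p. \<Sum>j<p. if blk i = blk j then ?z i j else 0)"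
    by (simp add: off_part_def sum.distrib)
  finally show ?thesis unfolding sum_same_block diag_part_def .
qed

text \<open>Of the fourfold sum only the pairings \<open>(k, l) = (i, j)\<close> and
  \<open>(k, l) = (j, i)\<close> survive. This leaves twice the squared Frobenius norm of
  \<open>A\<close>, and each of its \<open>p\<close> columns has squared norm at most
  \<open>1 / t\<^sup>2\<close>.\<close>

lemma off_part_second_moment:
  "integrable M (\<lambda>\<omega>. (off_part \<omega>)\<^sup>2)" "expectation (\<lambda>\<omega>. (off_part \<omega>)\<^sup>2) \<le> 2 * real p / t\<^sup>2"
proof -
  define A' where "A' i j = (if blk i = blk j then 0 else A i j)" for i j
  have sq: "(off_part \<omega>)\<^sup>2 = (\<Sum>i<p. \<Sum>j<p. \<Sum>k<p. \<Sum>l<p. A' i j * A' k l * (x i \<omega> * x j \<omega> * x k \<omega> * x l \<omega>))" for \<omega>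
  proof -
    have "(off_part \<omega>)\<^sup>2 = (\<Sum>i<p. \<Sum>j<p. A' i j * (x i \<omega> * x j \<omega>)) * (\<Sum>k<p. \<Sum>l<p. A' k l * (x k \<omega> * x l \<omega>))"
      by (simp add: off_part_def A'_def power2_eq_square)
    also have "\<dots> = (\<Sum>i<p. \<Sum>j<p. \<Sum>k<p. \<Sum>l<p. (A' i j * (x i \<omega> * x j \<omega>)) * (A' k l * (x k \<omega> * x l \<omega>)))"
      unfolding sum_distrib_right unfolding sum_distrib_left ..
    finally show ?thesis by (simp add: mult_ac)
  qed
  have int: "integrable M (\<lambda>\<omega>. A' i j * A' k l * (x i \<omega> * x j \<omega> * x k \<omega> * x l \<omega>))" if "i < p" "j < p" "k < p" "l < p" for i j k l
    using integrable_prod4_coords[OF that] by simp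
  show "integrable M (\<lambda>\<omega>. (off_part \<omega>)\<^sup>2)"
    unfolding sq by (intro Bochner_Integration.integrable_sum int) auto
  have term4: "expectation (\<lambda>\<omega>. A' i j * A' k l * (x i \<omega> * x j \<omega> * x k \<omega> * x l \<omega>))
     = (if k = i then if l = j then A' i j * A' k l else 0 else 0) + (if k = j then if l = i then A' i j * A' k l else 0 else 0)"
    if "i < p" "j < p" "k < p" "l < p" for i j k l
  proof (cases "A' i j * A' k l = 0")
    case True
    then show ?thesis unfolding True by simp
  next
    case False
    then have "blk i \<noteq> blk j" "blk k \<noteq> blk l" by (auto simp: A'_def split: if_splits)
    from fourth_off_diagonal[OF that this]
    have "expectation (\<lambda>\<omega>. A' i j * A' k l * (x i \<omega> * x j \<omega> * x k \<omega> * x l \<omega>)) =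
        A' i j * A' k l * ((if i = k \<and> j = l then 1 else 0) + (if i = l \<and> j = k then 1 else 0))"
      by (simp only: integral_mult_right_zero)
    also have "c * ((if i = k \<and> j = l then 1 else 0) + (if i = l \<and> j = k then 1 else 0)) =
        (if k = i then if l = j then c else 0 else 0) + (if k = j then if l = i then c else 0 else 0)" for c :: real
      by auto
    finally show ?thesis .
  qed
  have "expectation (\<lambda>\<omega>. (off_part \<omega>)\<^sup>2) = (\<Sum>i<p. \<Sum>j<p. \<Sum>k<p. \<Sum>l<p. expectation (\<lambda>\<omega>. A' i j * A' k l * (x i \<omega> * x j \<omega> * x k \<omega> * x l \<omega>)))"
    unfolding sq
    by (rule integral_sum4) (rule int)
  also have "\<dots> = (\<Sum>i<p. \<Sum>j<p. \<Sum>k<p. \<Sum>l<p. (if k = i then if l = j then A' i j * A' k l else 0 else 0) + (if k = j then if l = i then A' i j * A' k l else 0 else 0))"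
    by (intro sum.cong refl term4) auto
  also have "\<dots> = (\<Sum>i<p. \<Sum>j<p. A' i j * A' i j + A' i j * A' j i)"
  proof (intro sum.cong refl)
    fix i j assume "i \<in> {..<p}" "j \<in> {..<p}"
    then have ij: "i < p" "j < p" by auto
    have s: "(\<Sum>k<p. \<Sum>l<p. if k = a then if l = b then A' i j * A' k l else 0 else 0) = A' i j * A' a b" if "a < p" "b < p" for a b
    proof -
      have "(\<Sum>k<p. \<Sum>l<p. if k = a then if l = b then A' i j * A' k l else 0 else 0) = (\<Sum>k<p. if k = a then A' i j * A' k b else 0)"
        using that by (intro sum.cong refl) (auto simp: sum.delta)
      then show ?thesis using that by (simp add: sum.delta)
    qed
    show "(\<Sum>k<p. \<Sum>l<p. (if k = i then if l = j then A' i j * A' k l else 0 else 0) + (if k = j then if l = i then A' i j * A' k l else 0 else 0)) = A' i j * A' i j + A' i j * A' j i"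
      unfolding sum.distrib by (simp only: s[OF ij] s[OF ij(2,1)])
  qed
  also have "\<dots> \<le> (\<Sum>i<p. \<Sum>j<p. 2 * (A i j)\<^sup>2)"
  proof (intro sum_mono)
    fix i j assume "i \<in> {..<p}" "j \<in> {..<p}"
    then have "A' j i = A' i j" using A_sym[of i j] by (auto simp: A'_def)
    then show "A' i j * A' i j + A' i j * A' j i \<le> 2 * (A i j)\<^sup>2" by (simp add: A'_def power2_eq_square)
  qed
  also have "\<dots> = 2 * (\<Sum>j<p. \<Sum>i<p. (A i j)\<^sup>2)"
    by (subst sum.swap) (simp add: sum_distrib_left)
  also have "\<dots> \<le> 2 * (\<Sum>j<p. 1 / t\<^sup>2)"
    by (intro mult_left_mono sum_mono A_col) auto
  finally show "expectation (\<lambda>\<omega>. (off_part \<omega>)\<^sup>2) \<le> 2 * real p / t\<^sup>2" by simp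
qed

text \<open>Inside a block nothing is known about mixed moments beyond their size, and an entrywise
  expansion would be too costly. Instead \<open>0 <= q <= |x_J|^2 / t\<close>, and Cauchy--Schwarz
  bounds the square by \<open>card J / t\<^sup>2\<close> times the sum of the fourth powers.
  Subtracting the mean \<open>c\<close> can only lower the second moment.\<close>

lemma diag_part_facts:
  assumes J: "J \<in> B"
  shows "integrable M (diag_part J)" "expectation (diag_part J) = 0"
    "integrable M (\<lambda>\<omega>. (diag_part J \<omega>)\<^sup>2)" "expectation (\<lambda>\<omega>. (diag_part J \<omega>)\<^sup>2) \<le> C * (real (card J))\<^sup>2 / t\<^sup>2"
proof -
  have lt: "i < p" if "i \<in> J" for i using block_subset[OF J] that by auto
  define q where "q \<omega> = (\<Sum>i\<in>J. \<Sum>j\<in>J. A i j * (x i \<omega> * x j \<omega>))" for \<omega>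
  define c where "c = (\<Sum>i\<in>J. \<Sum>j\<in>J. A i j * (if i = j then 1 else 0))"
  have dq: "diag_part J \<omega> = q \<omega> - c" for \<omega>
    by (simp only: diag_part_def q_def c_def right_diff_distrib sum_subtractf)
  have q_int: "integrable M q"
    unfolding q_def[abs_def] by (intro Bochner_Integration.integrable_sum integrable_mult_right integrable_prod2_coords lt)
  have q_exp: "expectation q = c"
  proof -
    have "expectation q = (\<Sum>i\<in>J. \<Sum>j\<in>J. expectation (\<lambda>\<omega>. A i j * (x i \<omega> * x j \<omega>)))"
      unfolding q_def[abs_def]
      by (rule integral_sum2) (intro integrable_mult_right integrable_prod2_coords lt)
    also have "\<dots> = c" unfolding c_def by (intro sum.cong refl) (simp add: iso lt)
    finally show ?thesis .
  qed
  show "integrable M (diag_part J)" unfolding dq[abs_def] using q_int by simp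
  show "expectation (diag_part J) = 0" unfolding dq[abs_def] using q_int q_exp by (simp add: prob_space)
  have q0: "0 \<le> q \<omega>" and qt: "t * q \<omega> \<le> (\<Sum>i\<in>J. (x i \<omega>)\<^sup>2)" for \<omega>
  proof -
    \<comment> \<open>The block padded with zeros: the bounds assumed for all vectors thereby pass
      to the principal submatrix on \<open>J\<close>.\<close>
    let ?v = "\<lambda>i. if i \<in> J then x i \<omega> else 0"
    have restr: "(\<Sum>i<p. if i \<in> J then f i else 0) = (\<Sum>i\<in>J. f i)" for f :: "nat \<Rightarrow> real"
    proof -
      have "(\<Sum>i<p. if i \<in> J then f i else 0) = (\<Sum>i\<in>{..<p} \<inter> J. f i)" by (simp add: sum.inter_restrict)
      also have "{..<p} \<inter> J = J" using block_subset[OF J] by auto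
      finally show ?thesis .
    qed
    have "dot p ?v (mat_app p A ?v) = (\<Sum>i<p. if i \<in> J then (\<Sum>j<p. if j \<in> J then A i j * (x i \<omega> * x j \<omega>) else 0) else 0)"
      unfolding dot_def mat_app_def by (intro sum.cong refl) (auto simp: sum_distrib_left intro!: sum.cong)
    also have "\<dots> = q \<omega>" unfolding restr q_def ..
    finally have e1: "dot p ?v (mat_app p A ?v) = q \<omega>" .
    have "dot p ?v ?v = (\<Sum>i<p. if i \<in> J then (x i \<omega>)\<^sup>2 else 0)"
      unfolding dot_def by (intro sum.cong refl) (auto simp: power2_eq_square)
    then have e2: "dot p ?v ?v = (\<Sum>i\<in>J. (x i \<omega>)\<^sup>2)" unfolding restr .
    show "0 \<le> q \<omega>" using A_pos[of ?v] unfolding e1 .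
    show "t * q \<omega> \<le> (\<Sum>i\<in>J. (x i \<omega>)\<^sup>2)" using A_le[of ?v] unfolding e1 e2 .
  qed
  have q2: "(q \<omega>)\<^sup>2 \<le> real (card J) / t\<^sup>2 * (\<Sum>i\<in>J. x i \<omega> ^ 4)" for \<omega>
  proof -
    have "(t * q \<omega>)\<^sup>2 \<le> (\<Sum>i\<in>J. (x i \<omega>)\<^sup>2)\<^sup>2"
      using q0 qt t by (intro power_mono) auto
    also have "\<dots> = (\<Sum>i\<in>J. 1 * (x i \<omega>)\<^sup>2)\<^sup>2" by simp
    also have "\<dots> \<le> (\<Sum>i\<in>J. 1\<^sup>2) * (\<Sum>i\<in>J. ((x i \<omega>)\<^sup>2)\<^sup>2)" by (rule Cauchy_Schwarz_ineq_sum)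
    also have "\<dots> = real (card J) * (\<Sum>i\<in>J. x i \<omega> ^ 4)" by (simp flip: power_mult)
    finally show ?thesis using t by (simp add: power_mult_distrib field_simps)
  qed
  have int_b: "integrable M (\<lambda>\<omega>. real (card J) / t\<^sup>2 * (\<Sum>i\<in>J. x i \<omega> ^ 4))"
    by (intro integrable_mult_right Bochner_Integration.integrable_sum int4 lt)
  have q2_int: "integrable M (\<lambda>\<omega>. (q \<omega>)\<^sup>2)"
  proof (rule Bochner_Integration.integrable_bound[OF int_b])
    show "(\<lambda>\<omega>. (q \<omega>)\<^sup>2) \<in> borel_measurable M" using q_int by measurable
    show "AE \<omega> in M. norm ((q \<omega>)\<^sup>2) \<le> norm (real (card J) / t\<^sup>2 * (\<Sum>i\<in>J. x i \<omega> ^ 4))"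
    proof (rule AE_I2)
      fix \<omega> show "norm ((q \<omega>)\<^sup>2) \<le> norm (real (card J) / t\<^sup>2 * (\<Sum>i\<in>J. x i \<omega> ^ 4))"
        using order_trans[OF q2[of \<omega>] abs_ge_self] by simp
    qed
  qed
  have sq: "(diag_part J \<omega>)\<^sup>2 = (q \<omega>)\<^sup>2 - 2 * c * q \<omega> + c\<^sup>2" for \<omega>
    unfolding dq by (simp add: power2_diff)
  show "integrable M (\<lambda>\<omega>. (diag_part J \<omega>)\<^sup>2)" unfolding sq using q2_int q_int by simp
  have "expectation (\<lambda>\<omega>. (diag_part J \<omega>)\<^sup>2) = expectation (\<lambda>\<omega>. (q \<omega>)\<^sup>2) - c\<^sup>2"
    unfolding sq using q2_int q_int q_exp by (simp add: prob_space power2_eq_square)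
  also have "\<dots> \<le> expectation (\<lambda>\<omega>. (q \<omega>)\<^sup>2)" by simp
  also have "\<dots> \<le> expectation (\<lambda>\<omega>. real (card J) / t\<^sup>2 * (\<Sum>i\<in>J. x i \<omega> ^ 4))"
    by (rule integral_mono[OF q2_int int_b q2])
  also have "\<dots> = real (card J) / t\<^sup>2 * (\<Sum>i\<in>J. expectation (\<lambda>\<omega>. x i \<omega> ^ 4))"
    by (simp only: integral_mult_right_zero) (subst Bochner_Integration.integral_sum, auto intro!: int4 lt)
  also have "\<dots> \<le> real (card J) / t\<^sup>2 * (\<Sum>i\<in>J. C)"
    by (intro mult_left_mono sum_mono bd4 lt) auto
  also have "\<dots> = C * (real (card J))\<^sup>2 / t\<^sup>2" by (simp add: power2_eq_square)
  finally show "expectation (\<lambda>\<omega>. (diag_part J \<omega>)\<^sup>2) \<le> C * (real (card J))\<^sup>2 / t\<^sup>2" .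
qed

lemma diag_part_uncorrelated:
  assumes "J \<in> B" "L \<in> B" "J \<noteq> L"
  shows "expectation (\<lambda>\<omega>. diag_part J \<omega> * diag_part L \<omega>) = 0"
proof -
  let ?f = "\<lambda>J z. \<Sum>i\<in>J. \<Sum>j\<in>J. A i j * (z J i * z J j - (if i = j then 1 else 0))"
  have f: "?f J \<in> borel_measurable (PiM {J} (\<lambda>J. PiM J (\<lambda>_. borel :: real measure)))" for J
    by (intro borel_measurable_sum borel_measurable_times borel_measurable_diff borel_measurable_const block_coord_measurable) auto
  have "expectation (\<lambda>\<omega>. diag_part J \<omega> * diag_part L \<omega>) = expectation (diag_part J) * expectation (diag_part L)"
  proof (rule indep_blocks[where U = "{J}" and V = "{L}", OF _ _ _ f f])
    show "diag_part J = (\<lambda>\<omega>. ?f J (\<lambda>J\<in>{J}. \<lambda>i\<in>J. x i \<omega>))" "diag_part L = (\<lambda>\<omega>. ?f L (\<lambda>J\<in>{L}. \<lambda>i\<in>J. x i \<omega>))"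
      by (rule ext, simp add: diag_part_def)+
  qed (use assms diag_part_facts in auto)
  then show ?thesis using diag_part_facts assms by simp
qed

text \<open>The block contributions are uncorrelated, so their second moments add up to at most
  \<open>C / t\<^sup>2\<close> times the sum of the squared block sizes, and that sum is at most
  \<open>d p\<close>. Splitting off the other part by \<open>(u + v)^2 <= 2 u^2 + 2 v^2\<close>
  doubles both constants.\<close>

theorem quadratic_form_second_moment:
  "integrable M (\<lambda>\<omega>. (\<Sum>i<p. \<Sum>j<p. A i j * (x i \<omega> * x j \<omega> - (if i = j then 1 else 0)))\<^sup>2)"
  "expectation (\<lambda>\<omega>. (\<Sum>i<p. \<Sum>j<p. A i j * (x i \<omega> * x j \<omega> - (if i = j then 1 else 0)))\<^sup>2)
     \<le> (4 * real p + 2 * C * real d * real p) / t\<^sup>2"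
proof -
  have [measurable]: "off_part \<in> borel_measurable M"
    unfolding off_part_def[abs_def]
    by (intro borel_measurable_sum borel_measurable_times borel_measurable_const x_meas) auto
  have [measurable]: "diag_part J \<in> borel_measurable M" if "J \<in> B" for J
    using diag_part_facts(1)[OF that] by simp
  let ?D = "\<lambda>\<omega>. \<Sum>J\<in>B. diag_part J \<omega>"
  have Dm [measurable]: "?D \<in> borel_measurable M" by (intro borel_measurable_sum) auto
  have cross_int: "integrable M (\<lambda>\<omega>. diag_part J \<omega> * diag_part L \<omega>)" if "J \<in> B" "L \<in> B" for J L
  proof (rule Bochner_Integration.integrable_bound)
    show "integrable M (\<lambda>\<omega>. (diag_part J \<omega>)\<^sup>2 + (diag_part L \<omega>)\<^sup>2)"
      using diag_part_facts that by simp
    show "AE \<omega> in M. norm (diag_part J \<omega> * diag_part L \<omega>) \<le> norm ((diag_part J \<omega>)\<^sup>2 + (diag_part L \<omega>)\<^sup>2)"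
    proof (rule AE_I2)
      fix \<omega>
      have "0 \<le> (\<bar>diag_part J \<omega>\<bar> - \<bar>diag_part L \<omega>\<bar>)\<^sup>2" by simp
      also have "\<dots> = (diag_part J \<omega>)\<^sup>2 + (diag_part L \<omega>)\<^sup>2 - 2 * \<bar>diag_part J \<omega> * diag_part L \<omega>\<bar>"
        by (simp add: power2_diff abs_mult)
      finally show "norm (diag_part J \<omega> * diag_part L \<omega>) \<le> norm ((diag_part J \<omega>)\<^sup>2 + (diag_part L \<omega>)\<^sup>2)" by simp
    qed
  qed (use that in measurable)
  have Dsq: "(?D \<omega>)\<^sup>2 = (\<Sum>J\<in>B. \<Sum>L\<in>B. diag_part J \<omega> * diag_part L \<omega>)" for \<omega>
    by (simp add: power2_eq_square sum_product)
  have D_int: "integrable M (\<lambda>\<omega>. (?D \<omega>)\<^sup>2)"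
    unfolding Dsq by (intro Bochner_Integration.integrable_sum cross_int)
  have "expectation (\<lambda>\<omega>. (?D \<omega>)\<^sup>2) = (\<Sum>J\<in>B. \<Sum>L\<in>B. expectation (\<lambda>\<omega>. diag_part J \<omega> * diag_part L \<omega>))"
    unfolding Dsq
    by (rule integral_sum2) (rule cross_int)
  also have "\<dots> = (\<Sum>J\<in>B. \<Sum>L\<in>B. if L = J then expectation (\<lambda>\<omega>. (diag_part J \<omega>)\<^sup>2) else 0)"
    by (intro sum.cong refl) (auto simp: diag_part_uncorrelated power2_eq_square)
  also have "\<dots> = (\<Sum>J\<in>B. expectation (\<lambda>\<omega>. (diag_part J \<omega>)\<^sup>2))"
    using finite_B by (simp add: sum.delta)
  also have "\<dots> \<le> (\<Sum>J\<in>B. C * (real d * real (card J)) / t\<^sup>2)"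
  proof (rule sum_mono)
    fix J assume J: "J \<in> B"
    have "J \<noteq> {}" using part J by (auto simp: partition_on_def)
    then obtain i where "i \<in> J" by auto
    then have i: "i < p" using block_subset[OF J] by auto
    have "0 \<le> expectation (\<lambda>\<omega>. x i \<omega> ^ 4)" by (intro integral_nonneg_AE) auto
    then have C0: "C \<ge> 0" using bd4[OF i] by (rule order_trans)
    have "C * (real (card J))\<^sup>2 / t\<^sup>2 \<le> C * (real d * real (card J)) / t\<^sup>2"
      using card_le[OF J] C0 by (intro divide_right_mono mult_left_mono) (auto simp: power2_eq_square intro!: mult_right_mono)
    then show "expectation (\<lambda>\<omega>. (diag_part J \<omega>)\<^sup>2) \<le> C * (real d * real (card J)) / t\<^sup>2"
      using diag_part_facts(4)[OF J] by linarith
  qed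
  also have "\<dots> = C * real d / t\<^sup>2 * (\<Sum>J\<in>B. real (card J))" by (simp add: sum_distrib_left mult.assoc)
  also have "(\<Sum>J\<in>B. real (card J)) = real p" using sum_blocks[of "\<lambda>_. 1"] by simp
  finally have D_le: "expectation (\<lambda>\<omega>. (?D \<omega>)\<^sup>2) \<le> C * real d * real p / t\<^sup>2" by simp
  note off = off_part_second_moment
  have le: "(off_part \<omega> + ?D \<omega>)\<^sup>2 \<le> 2 * (off_part \<omega>)\<^sup>2 + 2 * (?D \<omega>)\<^sup>2" for \<omega>
  proof -
    have "0 \<le> (off_part \<omega> - ?D \<omega>)\<^sup>2" by simp
    then show ?thesis by (simp add: power2_sum power2_diff)
  qed
  have bint: "integrable M (\<lambda>\<omega>. 2 * (off_part \<omega>)\<^sup>2 + 2 * (?D \<omega>)\<^sup>2)" using off D_int by simp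
  show int: "integrable M (\<lambda>\<omega>. (\<Sum>i<p. \<Sum>j<p. A i j * (x i \<omega> * x j \<omega> - (if i = j then 1 else 0)))\<^sup>2)"
    unfolding quadratic_decomposition
  proof (rule Bochner_Integration.integrable_bound[OF bint])
    show "AE \<omega> in M. norm ((off_part \<omega> + ?D \<omega>)\<^sup>2) \<le> norm (2 * (off_part \<omega>)\<^sup>2 + 2 * (?D \<omega>)\<^sup>2)"
      by (rule AE_I2) (use order_trans[OF le abs_ge_self] in simp)
  qed measurable
  have "expectation (\<lambda>\<omega>. (off_part \<omega> + ?D \<omega>)\<^sup>2) \<le> expectation (\<lambda>\<omega>. 2 * (off_part \<omega>)\<^sup>2 + 2 * (?D \<omega>)\<^sup>2)"
    by (rule integral_mono[OF int[unfolded quadratic_decomposition] bint le])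
  also have "\<dots> = 2 * expectation (\<lambda>\<omega>. (off_part \<omega>)\<^sup>2) + 2 * expectation (\<lambda>\<omega>. (?D \<omega>)\<^sup>2)"
    using off D_int by simp
  also have "\<dots> \<le> 2 * (2 * real p / t\<^sup>2) + 2 * (C * real d * real p / t\<^sup>2)"
    using off D_le by linarith
  also have "\<dots> = (4 * real p + 2 * C * real d * real p) / t\<^sup>2" by (simp add: add_divide_distrib)
  finally show "expectation (\<lambda>\<omega>. (\<Sum>i<p. \<Sum>j<p. A i j * (x i \<omega> * x j \<omega> - (if i = j then 1 else 0)))\<^sup>2)
     \<le> (4 * real p + 2 * C * real d * real p) / t\<^sup>2" unfolding quadratic_decomposition .
qed

end

end

text \<open>Expanding the square, independence of matrix and vector replaces the products of vector
  entries by their expectations, and what remains is an average of the bound for fixed matrices.\<close>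

lemma (in prob_space) indep_quadratic_form_second_moment:
  fixes a :: "nat \<Rightarrow> nat \<Rightarrow> 'b \<Rightarrow> real" and \<xi> :: "nat \<Rightarrow> 'b \<Rightarrow> real"
  assumes ind: "indep_var N1 U N2 V"
    and \<xi>m: "\<And>i. i < p \<Longrightarrow> \<xi> i \<in> borel_measurable N1"
    and am: "\<And>i j. i < p \<Longrightarrow> j < p \<Longrightarrow> a i j \<in> borel_measurable N2"
    and ab: "\<And>i j z. i < p \<Longrightarrow> j < p \<Longrightarrow> \<bar>a i j z\<bar> \<le> b"
    and int4: "\<And>i. i < p \<Longrightarrow> integrable M (\<lambda>\<omega>. \<xi> i (U \<omega>) ^ 4)"
    and bnd: "\<And>z. expectation (\<lambda>\<omega>. (\<Sum>i<p. \<Sum>j<p. a i j z * (\<xi> i (U \<omega>) * \<xi> j (U \<omega>) - (if i = j then 1 else 0)))\<^sup>2) \<le> K"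
  shows "integrable M (\<lambda>\<omega>. (\<Sum>i<p. \<Sum>j<p. a i j (V \<omega>) * (\<xi> i (U \<omega>) * \<xi> j (U \<omega>) - (if i = j then 1 else 0)))\<^sup>2)"
    "expectation (\<lambda>\<omega>. (\<Sum>i<p. \<Sum>j<p. a i j (V \<omega>) * (\<xi> i (U \<omega>) * \<xi> j (U \<omega>) - (if i = j then 1 else 0)))\<^sup>2) \<le> K"
proof -
  have UV [measurable]: "U \<in> measurable M N1" "V \<in> measurable M N2"
    using ind by (auto simp: indep_var_def indep_vars_def split: bool.splits dest: spec[of _ True] spec[of _ False])
  have xm: "(\<lambda>\<omega>. \<xi> i (U \<omega>)) \<in> borel_measurable M" if "i < p" for i
    using measurable_compose[OF UV(1) \<xi>m[OF that]] .
  have aVm: "(\<lambda>\<omega>. a i j (V \<omega>)) \<in> borel_measurable M" if "i < p" "j < p" for i j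
    using measurable_compose[OF UV(2) am[OF that]] .
  define w where "w i j u = \<xi> i u * \<xi> j u - (if i = j then 1 else 0)" for i j u
  have wm: "w i j \<in> borel_measurable N1" if "i < p" "j < p" for i j
    unfolding w_def[abs_def] by (intro borel_measurable_diff borel_measurable_times \<xi>m that borel_measurable_const)
  have w_int: "integrable M (\<lambda>\<omega>. w i j (U \<omega>) * w k l (U \<omega>))" if "i < p" "j < p" "k < p" "l < p" for i j k l
  proof -
    have i4: "integrable M (\<lambda>\<omega>. \<xi> i (U \<omega>) * \<xi> j (U \<omega>) * \<xi> k (U \<omega>) * \<xi> l (U \<omega>))"
      by (intro integrable_prod4 xm int4 that)
    have i2: "integrable M (\<lambda>\<omega>. \<xi> i (U \<omega>) * \<xi> j (U \<omega>))" if "i < p" "j < p" for i j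
      using integrable_prod4[of "\<lambda>\<omega>. \<xi> i (U \<omega>)" "\<lambda>\<omega>. \<xi> j (U \<omega>)" "\<lambda>_. 1" "\<lambda>_. 1"] that by (simp add: xm int4)
    have "integrable M (\<lambda>\<omega>. \<xi> i (U \<omega>) * \<xi> j (U \<omega>) * \<xi> k (U \<omega>) * \<xi> l (U \<omega>) - (if k = l then 1 else 0) * (\<xi> i (U \<omega>) * \<xi> j (U \<omega>))
        - (if i = j then 1 else 0) * (\<xi> k (U \<omega>) * \<xi> l (U \<omega>)) + (if i = j then 1 else 0) * (if k = l then 1 else 0))"
      by (intro Bochner_Integration.integrable_add Bochner_Integration.integrable_diff i4 integrable_mult_right i2 that integrable_const)
    then show ?thesis unfolding w_def by (simp add: algebra_simps)
  qed
  define E where "E i j k l = expectation (\<lambda>\<omega>. w i j (U \<omega>) * w k l (U \<omega>))" for i j k l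
  have aa_int: "integrable M (\<lambda>\<omega>. a i j (V \<omega>) * a k l (V \<omega>))" if "i < p" "j < p" "k < p" "l < p" for i j k l
  proof (rule integrable_const_bound[where B = "b * b"])
    show "AE \<omega> in M. norm (a i j (V \<omega>) * a k l (V \<omega>)) \<le> b * b"
      by (rule AE_I2) (auto simp: abs_mult intro!: mult_mono ab that order_trans[OF abs_ge_zero ab[OF that(1,2)]])
  qed (intro borel_measurable_times aVm that)
  have ind4: "indep_var borel (\<lambda>\<omega>. w i j (U \<omega>) * w k l (U \<omega>)) borel (\<lambda>\<omega>. a i j (V \<omega>) * a k l (V \<omega>))"
    if "i < p" "j < p" "k < p" "l < p" for i j k l
    using indep_var_compose[OF ind borel_measurable_times[OF wm wm] borel_measurable_times[OF am am], of i j k l i j k l] that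
    by (simp add: comp_def)
  have t_int: "integrable M (\<lambda>\<omega>. w i j (U \<omega>) * w k l (U \<omega>) * (a i j (V \<omega>) * a k l (V \<omega>)))"
    if "i < p" "j < p" "k < p" "l < p" for i j k l
    by (rule indep_var_integrable[OF ind4 w_int aa_int]) (use that in auto)
  have t_exp: "expectation (\<lambda>\<omega>. w i j (U \<omega>) * w k l (U \<omega>) * (a i j (V \<omega>) * a k l (V \<omega>))) = expectation (\<lambda>\<omega>. a i j (V \<omega>) * a k l (V \<omega>) * E i j k l)"
    if "i < p" "j < p" "k < p" "l < p" for i j k l
    unfolding E_def using indep_var_lebesgue_integral[OF ind4 w_int aa_int] that by simp
  have sq: "(\<Sum>i<p. \<Sum>j<p. c i j * w i j u)\<^sup>2 = (\<Sum>i<p. \<Sum>j<p. \<Sum>k<p. \<Sum>l<p. w i j u * w k l u * (c i j * c k l))" for c u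
  proof -
    have "(\<Sum>i<p. \<Sum>j<p. c i j * w i j u)\<^sup>2 = (\<Sum>i<p. \<Sum>j<p. \<Sum>k<p. \<Sum>l<p. (c i j * w i j u) * (c k l * w k l u))"
      unfolding power2_eq_square sum_distrib_right unfolding sum_distrib_left ..
    then show ?thesis by (simp add: mult_ac)
  qed
  have fixed: "(\<Sum>i<p. \<Sum>j<p. \<Sum>k<p. \<Sum>l<p. a i j z * a k l z * E i j k l) \<le> K" for z
  proof -
    have "expectation (\<lambda>\<omega>. (\<Sum>i<p. \<Sum>j<p. a i j z * w i j (U \<omega>))\<^sup>2)
      = (\<Sum>i<p. \<Sum>j<p. \<Sum>k<p. \<Sum>l<p. expectation (\<lambda>\<omega>. w i j (U \<omega>) * w k l (U \<omega>) * (a i j z * a k l z)))"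
      unfolding sq
      by (rule integral_sum4) (intro integrable_mult_left w_int)
    also have "\<dots> = (\<Sum>i<p. \<Sum>j<p. \<Sum>k<p. \<Sum>l<p. a i j z * a k l z * E i j k l)"
      by (simp add: E_def mult.commute)
    finally show ?thesis using bnd[of z] unfolding w_def by simp
  qed
  show "integrable M (\<lambda>\<omega>. (\<Sum>i<p. \<Sum>j<p. a i j (V \<omega>) * (\<xi> i (U \<omega>) * \<xi> j (U \<omega>) - (if i = j then 1 else 0)))\<^sup>2)"
    unfolding w_def[symmetric] sq by (intro Bochner_Integration.integrable_sum t_int) auto
  have "expectation (\<lambda>\<omega>. (\<Sum>i<p. \<Sum>j<p. a i j (V \<omega>) * w i j (U \<omega>))\<^sup>2)
      = (\<Sum>i<p. \<Sum>j<p. \<Sum>k<p. \<Sum>l<p. expectation (\<lambda>\<omega>. w i j (U \<omega>) * w k l (U \<omega>) * (a i j (V \<omega>) * a k l (V \<omega>))))"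
    unfolding sq
    by (rule integral_sum4) (rule t_int)
  also have "\<dots> = (\<Sum>i<p. \<Sum>j<p. \<Sum>k<p. \<Sum>l<p. expectation (\<lambda>\<omega>. a i j (V \<omega>) * a k l (V \<omega>) * E i j k l))"
    by (intro sum.cong refl t_exp) auto
  also have "\<dots> = expectation (\<lambda>\<omega>. \<Sum>i<p. \<Sum>j<p. \<Sum>k<p. \<Sum>l<p. a i j (V \<omega>) * a k l (V \<omega>) * E i j k l)"
    by (rule integral_sum4[symmetric]) (intro integrable_mult_left aa_int)
  also have "\<dots> \<le> expectation (\<lambda>\<omega>. K)"
    by (intro integral_mono fixed Bochner_Integration.integrable_sum integrable_mult_left aa_int integrable_const) auto
  also have "\<dots> = K" by (simp add: prob_space)
  finally show "expectation (\<lambda>\<omega>. (\<Sum>i<p. \<Sum>j<p. a i j (V \<omega>) * (\<xi> i (U \<omega>) * \<xi> j (U \<omega>) - (if i = j then 1 else 0)))\<^sup>2) \<le> K"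
    unfolding w_def .
qed

section \<open>Convergence of the Stieltjes transform\<close>

text \<open>A substitute for the comparison of moments: if the fourth moment of \<open>y\<close> is
  at most \<open>q ^ 4\<close>, integration bounds the first absolute moment by
  \<open>2 q\<close>.\<close>

lemma abs_le_fourth_power:
  fixes y q :: real
  assumes "q > 0"
  shows "\<bar>y\<bar> \<le> q + y ^ 4 / q ^ 3"
proof (cases "\<bar>y\<bar> \<le> q")
  case True
  then show ?thesis using assms by (simp add: add_increasing2)
next
  case False
  have "\<bar>y\<bar> * q ^ 3 \<le> \<bar>y\<bar> * \<bar>y\<bar> ^ 3"
    using False assms by (intro mult_left_mono power_mono) auto
  also have "\<dots> = \<bar>y\<bar> ^ 4" by (simp add: numeral_eq_Suc)
  also have "\<dots> = y ^ 4" by simp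
  finally have "\<bar>y\<bar> \<le> y ^ 4 / q ^ 3" using assms by (simp add: pos_le_divide_eq)
  then show ?thesis using assms by linarith
qed

text \<open>By monotone convergence the sum of the fourth powers has finite expectation. It is
  therefore finite almost surely, and the terms of a convergent series tend to 0.\<close>

lemma (in prob_space) AE_tendsto_0_fourth_moment:
  fixes f :: "nat \<Rightarrow> 'a \<Rightarrow> real"
  assumes [measurable]: "\<And>n. f n \<in> borel_measurable M"
    and le: "\<And>n. (\<integral>\<^sup>+\<omega>. ennreal (f n \<omega> ^ 4) \<partial>M) \<le> ennreal (b n)" and b: "summable b" "\<And>n. 0 \<le> b n"
  shows "AE \<omega> in M. (\<lambda>n. f n \<omega>) \<longlonglongrightarrow> 0"
proof -
  have "(\<integral>\<^sup>+\<omega>. (\<Sum>n. ennreal (f n \<omega> ^ 4)) \<partial>M) = (\<Sum>n. \<integral>\<^sup>+\<omega>. ennreal (f n \<omega> ^ 4) \<partial>M)"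
    by (rule nn_integral_suminf) measurable
  also have "\<dots> \<le> (\<Sum>n. ennreal (b n))" by (intro suminf_le le) auto
  also have "\<dots> = ennreal (\<Sum>n. b n)" using b by (intro suminf_ennreal2)
  also have "\<dots> < \<infinity>" by simp
  finally have "(\<integral>\<^sup>+\<omega>. (\<Sum>n. ennreal (f n \<omega> ^ 4)) \<partial>M) \<noteq> \<infinity>" by simp
  then have "AE \<omega> in M. (\<Sum>n. ennreal (f n \<omega> ^ 4)) \<noteq> \<infinity>"
    by (intro nn_integral_PInf_AE) measurable
  then show ?thesis
  proof (rule AE_mp, intro AE_I2 impI)
    fix \<omega> assume "(\<Sum>n. ennreal (f n \<omega> ^ 4)) \<noteq> \<infinity>"
    then have "summable (\<lambda>n. f n \<omega> ^ 4)" by (intro summable_suminf_not_top) auto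
    then have "(\<lambda>n. f n \<omega> ^ 4) \<longlonglongrightarrow> 0" by (rule summable_LIMSEQ_zero)
    have e: "root 4 (y ^ 4) = \<bar>y\<bar>" for y :: real using root_abs_power[of 4 y] by simp
    from \<open>(\<lambda>n. f n \<omega> ^ 4) \<longlonglongrightarrow> 0\<close> have "(\<lambda>n. root 4 (f n \<omega> ^ 4)) \<longlonglongrightarrow> root 4 0" by (rule tendsto_real_root)
    then have "(\<lambda>n. \<bar>f n \<omega>\<bar>) \<longlonglongrightarrow> 0" unfolding e by simp
    then show "(\<lambda>n. f n \<omega>) \<longlonglongrightarrow> 0" by (rule tendsto_rabs_zero_cancel)
  qed
qed

text \<open>The difference of the limiting equation at \<open>u\<close> and at \<open>s\<close> is
  \<open>(u - s) (t + 1 / D)\<close> with \<open>D > 0\<close>, so the error in the equation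
  controls \<open>t \<bar>u - s\<bar>\<close>. Replacing \<open>r n\<close> by \<open>lam\<close>
  costs at most \<open>u\<^sup>2 * \<bar>r n - lam\<bar>\<close>, where
  \<open>u <= 1 / t\<close>.\<close>

lemma mp_fixed_point_stable:
  fixes \<sigma> r :: "nat \<Rightarrow> real"
  assumes lam: "lam > 0" and t: "t > 0" and s: "s > 0" "t * s + s / (1 + lam * s) = 1"
    and \<sigma>: "\<And>n. 0 \<le> \<sigma> n" "\<And>n. \<sigma> n \<le> 1 / t" and r: "\<And>n. 0 \<le> r n" "r \<longlonglongrightarrow> lam"
    and lim: "(\<lambda>n. t * \<sigma> n + \<sigma> n / (1 + r n * \<sigma> n)) \<longlonglongrightarrow> 1"
  shows "\<sigma> \<longlonglongrightarrow> s"
proof -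
  let ?h = "\<lambda>n. t * \<sigma> n + \<sigma> n / (1 + r n * \<sigma> n)"
  have bound: "\<bar>\<sigma> n - s\<bar> \<le> (\<bar>?h n - 1\<bar> + \<bar>r n - lam\<bar> / t\<^sup>2) / t" for n
  proof -
    define u where "u = \<sigma> n"
    have u: "0 \<le> u" "u \<le> 1 / t" using \<sigma> by (auto simp: u_def)
    have pos: "1 + lam * u \<ge> 1" "1 + lam * s \<ge> 1" "1 + r n * u \<ge> 1"
      using lam u s r(1)[of n] by auto
    define D where "D = (1 + lam * u) * (1 + lam * s)"
    have D: "D > 0" using pos by (simp add: D_def)
    have "t * u + u / (1 + lam * u) - 1 = (u - s) * (t + 1 / D)"
    proof -
      have "u / (1 + lam * u) - s / (1 + lam * s) = (u * (1 + lam * s) - s * (1 + lam * u)) / D"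
        using pos by (simp add: D_def diff_frac_eq)
      also have "\<dots> = (u - s) / D" by (simp add: algebra_simps)
      finally have e: "u / (1 + lam * u) - s / (1 + lam * s) = (u - s) / D" .
      have "t * u + u / (1 + lam * u) - 1 = t * (u - s) + (u / (1 + lam * u) - s / (1 + lam * s))"
        using s(2) by (simp add: algebra_simps)
      then show ?thesis unfolding e by (simp add: algebra_simps)
    qed
    then have "\<bar>t * u + u / (1 + lam * u) - 1\<bar> = \<bar>u - s\<bar> * (t + 1 / D)"
      using t D by (simp add: abs_mult)
    moreover have "\<bar>u - s\<bar> * t \<le> \<bar>u - s\<bar> * (t + 1 / D)" using D by (intro mult_left_mono) auto
    ultimately have 1: "t * \<bar>u - s\<bar> \<le> \<bar>t * u + u / (1 + lam * u) - 1\<bar>" by (simp add: mult.commute)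
    define D' where "D' = (1 + lam * u) * (1 + r n * u)"
    have D': "D' \<ge> 1" using mult_mono[OF pos(1,3)] pos by (simp add: D'_def)
    have "u / (1 + lam * u) - u / (1 + r n * u) = (u * (1 + r n * u) - u * (1 + lam * u)) / D'"
      using pos by (simp add: D'_def diff_frac_eq)
    also have "\<dots> = u\<^sup>2 * (r n - lam) / D'" by (simp add: algebra_simps power2_eq_square)
    finally have "\<bar>u / (1 + lam * u) - u / (1 + r n * u)\<bar> = u\<^sup>2 * \<bar>r n - lam\<bar> / D'"
      using D' by (simp add: abs_mult)
    also have "\<dots> \<le> u\<^sup>2 * \<bar>r n - lam\<bar>" using divide_left_mono[of 1 D' "u\<^sup>2 * \<bar>r n - lam\<bar>"] D' by simp
    also have "\<dots> \<le> (1 / t)\<^sup>2 * \<bar>r n - lam\<bar>" using u by (intro mult_right_mono power_mono) auto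
    finally have 2: "\<bar>u / (1 + lam * u) - u / (1 + r n * u)\<bar> \<le> \<bar>r n - lam\<bar> / t\<^sup>2" by (simp add: power_divide)
    have "t * \<bar>u - s\<bar> \<le> \<bar>t * u + u / (1 + r n * u) - 1\<bar> + \<bar>r n - lam\<bar> / t\<^sup>2"
      using 1 2 by linarith
    then show ?thesis using t by (simp add: u_def pos_le_divide_eq mult.commute)
  qed
  have "(\<lambda>n. (\<bar>?h n - 1\<bar> + \<bar>r n - lam\<bar> / t\<^sup>2) / t) \<longlonglongrightarrow> (\<bar>1 - 1\<bar> + \<bar>lam - lam\<bar> / t\<^sup>2) / t"
    using t by (intro tendsto_intros lim r) auto
  then have "(\<lambda>n. (\<bar>?h n - 1\<bar> + \<bar>r n - lam\<bar> / t\<^sup>2) / t) \<longlonglongrightarrow> 0" by simp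
  then have "(\<lambda>n. \<sigma> n - s) \<longlonglongrightarrow> 0"
    by (rule Lim_null_comparison[rotated]) (use bound in simp)
  then show ?thesis by (simp add: LIM_zero_iff)
qed

section \<open>The Stieltjes transform of a single random matrix\<close>

locale block_matrix = prob_space +
  fixes p m d :: nat and B :: "nat set set" and X :: "'a \<Rightarrow> nat \<Rightarrow> nat \<Rightarrow> real" and C :: real
  assumes p_pos: "p > 0" and m_pos: "m > 0" and blocks: "partition_on {..<p} B"
    and X_meas: "\<And>i k. i < p \<Longrightarrow> k < m \<Longrightarrow> (\<lambda>\<omega>. X \<omega> i k) \<in> borel_measurable M"
    and cols_indep: "indep_vars (\<lambda>_. PiM {..<p} (\<lambda>_. borel)) (\<lambda>k \<omega>. \<lambda>i\<in>{..<p}. X \<omega> i k) {..<m}"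
    and blocks_indep: "\<And>k. k < m \<Longrightarrow> indep_vars (\<lambda>J. PiM J (\<lambda>_. borel)) (\<lambda>J \<omega>. \<lambda>i\<in>J. X \<omega> i k) B"
    and mean0: "\<And>i k. i < p \<Longrightarrow> k < m \<Longrightarrow> expectation (\<lambda>\<omega>. X \<omega> i k) = 0"
    and isotropic: "\<And>i j k. i < p \<Longrightarrow> j < p \<Longrightarrow> k < m \<Longrightarrow>
                  expectation (\<lambda>\<omega>. X \<omega> i k * X \<omega> j k) = (if i = j then 1 else 0)"
    and fourth_int: "\<And>i k. i < p \<Longrightarrow> k < m \<Longrightarrow> integrable M (\<lambda>\<omega>. (X \<omega> i k) ^ 4)"
    and fourth_bdd: "\<And>i k. i < p \<Longrightarrow> k < m \<Longrightarrow> expectation (\<lambda>\<omega>. (X \<omega> i k) ^ 4) \<le> C"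
    and block_size: "\<And>J. J \<in> B \<Longrightarrow> card J \<le> d"
begin

definition cols :: "'a \<Rightarrow> nat \<Rightarrow> nat \<Rightarrow> real" where
  "cols \<omega> = (\<lambda>k i. X \<omega> i k / sqrt m)"

definition emp_stieltjes :: "real \<Rightarrow> 'a \<Rightarrow> real" where
  "emp_stieltjes t \<omega> = mat_tr p (resolvent p t (cols \<omega>) m) / p"

lemma C_nonneg: "0 \<le> C"
proof -
  have "0 \<le> expectation (\<lambda>\<omega>. (X \<omega> 0 0) ^ 4)" by (intro integral_nonneg_AE) auto
  then show ?thesis using fourth_bdd[OF p_pos m_pos] by (rule order_trans)
qed

lemma mat_tr_cong: "(\<And>i. i < p \<Longrightarrow> A i i = A' i i) \<Longrightarrow> mat_tr p A = mat_tr p A'"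
  by (simp add: mat_tr_def)

lemma coord_measurable:
  "k \<in> I \<Longrightarrow> i < p \<Longrightarrow> (\<lambda>z. z k i) \<in> borel_measurable (PiM I (\<lambda>_. PiM {..<p} (\<lambda>_. borel :: real measure)))"
  by (rule measurable_compose[OF measurable_component_singleton[of k I "\<lambda>_. PiM {..<p} (\<lambda>_. borel)"]
        measurable_component_singleton[of i "{..<p}" "\<lambda>_. borel"]]) auto

context
  fixes t :: real
  assumes t: "t > 0"
begin

lemma emp_stieltjes_bounds: "0 \<le> emp_stieltjes t \<omega>" "emp_stieltjes t \<omega> \<le> 1 / t"
  using resolvent_trace_bounds[OF t is_resolvent_resolvent[OF t, of p "cols \<omega>" m]] p_pos
  by (auto simp: emp_stieltjes_def field_simps)

lemma emp_stieltjes_measurable: "emp_stieltjes t \<in> borel_measurable M"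
  unfolding emp_stieltjes_def[abs_def] mat_tr_def
  by (intro borel_measurable_divide borel_measurable_sum borel_measurable_const measurable_resolvent)
     (auto simp: cols_def intro!: borel_measurable_divide X_meas)

lemma emp_stieltjes_integrable: "integrable M (emp_stieltjes t)"
  by (rule integrable_const_bound[where B = "1 / t"]) (use emp_stieltjes_bounds emp_stieltjes_measurable in auto)

lemma emp_stieltjes_expectation_bounds: "0 \<le> expectation (emp_stieltjes t)" "expectation (emp_stieltjes t) \<le> 1 / t"
proof -
  show "0 \<le> expectation (emp_stieltjes t)" by (intro integral_nonneg_AE) (use emp_stieltjes_bounds in auto)
  have "expectation (emp_stieltjes t) \<le> expectation (\<lambda>_. 1 / t)"
    by (intro integral_mono emp_stieltjes_integrable) (use emp_stieltjes_bounds in auto)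
  then show "expectation (emp_stieltjes t) \<le> 1 / t" by (simp add: prob_space)
qed

text \<open>Bounded differences with whole columns as the independent variables: there are
  \<open>m\<close> of them, and each moves the normalized trace by at most \<open>1 / (p t)\<close>.
  With \<open>m\<close> of order \<open>p\<close> the bound is of order
  \<open>1 / p\<^sup>2\<close>.\<close>

lemma emp_stieltjes_fourth_moment:
  "(\<integral>\<^sup>+\<omega>. ennreal ((emp_stieltjes t \<omega> - expectation (emp_stieltjes t)) ^ 4) \<partial>M) \<le> ennreal (1024 * (1 / (p * t)) ^ 4 * (real m)\<^sup>2)"
proof -
  let ?N = "\<lambda>_::nat. PiM {..<p} (\<lambda>_. borel :: real measure)"
  define Y where "Y z = (\<lambda>k i. z k i / sqrt m)" for z :: "nat \<Rightarrow> nat \<Rightarrow> real"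
  define f where "f z = mat_tr p (resolvent p t (Y z) m) / p" for z
  have bnd: "0 \<le> f z" "f z \<le> 1 / t" for z
    using resolvent_trace_bounds[OF t is_resolvent_resolvent[OF t, of p "Y z" m]] p_pos
    by (auto simp: f_def field_simps)
  have "(\<integral>\<^sup>+\<omega>. ennreal ((f (\<lambda>k\<in>{..<m}. \<lambda>i\<in>{..<p}. X \<omega> i k) - expectation (\<lambda>\<omega>. f (\<lambda>k\<in>{..<m}. \<lambda>i\<in>{..<p}. X \<omega> i k))) ^ 4) \<partial>M)
      \<le> ennreal (1024 * (1 / (p * t)) ^ 4 * (real (card {..<m}))\<^sup>2)"
  proof (rule mcdiarmid_fourth_moment[OF _ _ cols_indep, where b = "1 / t"])
    show "f \<in> borel_measurable (PiM {..<m} ?N)"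
      unfolding f_def[abs_def] mat_tr_def
      by (intro borel_measurable_divide borel_measurable_sum borel_measurable_const measurable_resolvent)
         (auto simp: Y_def intro!: borel_measurable_divide coord_measurable)
    show "\<bar>f z\<bar> \<le> 1 / t" for z using bnd[of z] by simp
    show "\<bar>f (z(k := y)) - f z\<bar> \<le> 1 / (p * t)" if "k \<in> {..<m}" for z k y
    proof -
      have "Y (z(k := y)) = (Y z)(k := (\<lambda>i. y i / sqrt m))" by (auto simp: Y_def fun_eq_iff)
      then have "\<bar>mat_tr p (resolvent p t (Y (z(k := y))) m) - mat_tr p (resolvent p t (Y z) m)\<bar> \<le> 1 / t"
        using resolvent_fn_change_column_trace[OF t, of k m p "Y z" "\<lambda>i. y i / sqrt m"] that by simp
      then have "\<bar>mat_tr p (resolvent p t (Y (z(k := y))) m) - mat_tr p (resolvent p t (Y z) m)\<bar> / p \<le> 1 / t / p"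
        by (intro divide_right_mono) auto
      moreover have "f (z(k := y)) - f z = (mat_tr p (resolvent p t (Y (z(k := y))) m) - mat_tr p (resolvent p t (Y z) m)) / p"
        by (simp add: f_def diff_divide_distrib)
      ultimately show ?thesis by (simp add: mult.commute)
    qed
    show "0 < 1 / (p * t)" using p_pos t by simp
  qed (use m_pos in auto)
  moreover have "f (\<lambda>k\<in>{..<m}. \<lambda>i\<in>{..<p}. X \<omega> i k) = emp_stieltjes t \<omega>" for \<omega>
    unfolding f_def emp_stieltjes_def
    by (intro arg_cong2[where f = "(/)"] mat_tr_cong refl resolvent_fn_cong[OF t]) (auto simp: Y_def cols_def)
  ultimately show ?thesis by simp
qed

lemma emp_stieltjes_abs_deviation:
  "integrable M (\<lambda>\<omega>. \<bar>emp_stieltjes t \<omega> - expectation (emp_stieltjes t)\<bar>)"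
  "expectation (\<lambda>\<omega>. \<bar>emp_stieltjes t \<omega> - expectation (emp_stieltjes t)\<bar>) \<le> 12 * sqrt m / (p * t)"
proof -
  let ?y = "\<lambda>\<omega>. emp_stieltjes t \<omega> - expectation (emp_stieltjes t)"
  note [measurable] = emp_stieltjes_measurable
  show int: "integrable M (\<lambda>\<omega>. \<bar>?y \<omega>\<bar>)" using emp_stieltjes_integrable by simp
  have yb: "\<bar>?y \<omega>\<bar> \<le> 1 / t" for \<omega> using emp_stieltjes_bounds[of \<omega>] emp_stieltjes_expectation_bounds by (auto simp: abs_le_iff)
  have int4: "integrable M (\<lambda>\<omega>. ?y \<omega> ^ 4)"
  proof (rule integrable_const_bound[where B = "(1 / t) ^ 4"])
    show "AE \<omega> in M. norm (?y \<omega> ^ 4) \<le> (1 / t) ^ 4"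
      by (rule AE_I2) (simp only: real_norm_def power_abs, rule power_mono[OF yb], simp)
  qed measurable
  \<comment> \<open>Chosen so that \<open>q ^ 4\<close> exceeds the fourth moment bound:
    \<open>6 ^ 4 = 1296\<close> is at least 1024. The result is then \<open>2 q\<close>.\<close>
  define q where "q = 6 * sqrt m / (p * t)"
  have q: "q > 0" using p_pos m_pos t by (simp add: q_def)
  have q4: "q ^ 4 = 1296 * (1 / (p * t)) ^ 4 * (real m)\<^sup>2"
  proof -
    have "sqrt (real m) ^ 4 = (sqrt (real m) ^ 2) ^ 2" by (subst power_mult[symmetric]) simp
    also have "\<dots> = (real m)\<^sup>2" by (simp only: real_sqrt_pow2[OF of_nat_0_le_iff])
    finally show ?thesis by (simp add: q_def power_divide power_mult_distrib)
  qed
  have "ennreal (expectation (\<lambda>\<omega>. ?y \<omega> ^ 4)) = (\<integral>\<^sup>+\<omega>. ennreal (?y \<omega> ^ 4) \<partial>M)"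
    by (rule nn_integral_eq_integral[symmetric, OF int4]) simp
  also have "\<dots> \<le> ennreal (1024 * (1 / (p * t)) ^ 4 * (real m)\<^sup>2)" by (rule emp_stieltjes_fourth_moment)
  also have "\<dots> \<le> ennreal (q ^ 4)" unfolding q4 by (intro ennreal_leI mult_right_mono) auto
  finally have E4: "expectation (\<lambda>\<omega>. ?y \<omega> ^ 4) \<le> q ^ 4" using q by (simp add: ennreal_le_iff)
  have "expectation (\<lambda>\<omega>. \<bar>?y \<omega>\<bar>) \<le> expectation (\<lambda>\<omega>. q + ?y \<omega> ^ 4 / q ^ 3)"
    by (intro integral_mono int abs_le_fourth_power q) (use int4 in auto)
  also have "\<dots> = q + expectation (\<lambda>\<omega>. ?y \<omega> ^ 4) / q ^ 3" using int4 by (simp add: prob_space)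
  also have "\<dots> \<le> q + q ^ 4 / q ^ 3" using E4 q by (intro add_left_mono divide_right_mono) auto
  also have "q + q ^ 4 / q ^ 3 = 12 * sqrt m / (p * t)" using q by (simp add: q_def numeral_eq_Suc)
  finally show "expectation (\<lambda>\<omega>. \<bar>?y \<omega>\<bar>) \<le> 12 * sqrt m / (p * t)" .
qed

definition loo_resolvent :: "nat \<Rightarrow> 'a \<Rightarrow> nat \<Rightarrow> nat \<Rightarrow> real" where
  "loo_resolvent k \<omega> = resolvent p t ((cols \<omega>)(k := \<lambda>_. 0)) m"

text \<open>For the unnormalized column \<open>x\<close> and its leave-one-out resolvent
  \<open>R\<close> this is \<open>x^T R x - tr R\<close>. The columns in \<open>cols\<close> are
  divided by \<open>sqrt m\<close>, so \<open>loo_dev\<close> is \<open>m\<close> times the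
  deviation of \<open>a_k\<close> from \<open>tr R / m\<close>.\<close>

definition loo_dev :: "nat \<Rightarrow> 'a \<Rightarrow> real" where
  "loo_dev k \<omega> = (\<Sum>i<p. \<Sum>j<p. loo_resolvent k \<omega> i j * (X \<omega> i k * X \<omega> j k - (if i = j then 1 else 0)))"

text \<open>Column \<open>k\<close> is taken as \<open>U\<close> and all other columns as
  \<open>V\<close>. The leave-one-out resolvent is a function of \<open>V\<close> alone, hence
  independent of the column, and the bound for fixed matrices transfers.\<close>

lemma loo_dev_second_moment:
  assumes k: "k < m"
  defines "K \<equiv> (4 * real p + 2 * C * real d * real p) / t\<^sup>2"
  shows "integrable M (\<lambda>\<omega>. (loo_dev k \<omega>)\<^sup>2)" "expectation (\<lambda>\<omega>. (loo_dev k \<omega>)\<^sup>2) \<le> K"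
proof -
  let ?N = "\<lambda>_::nat. PiM {..<p} (\<lambda>_. borel :: real measure)"
  let ?I = "{..<m} - {k}"
  define Z where "Z l \<omega> = (\<lambda>i\<in>{..<p}. X \<omega> i l)" for l \<omega>
  define U where "U \<omega> = (\<lambda>l\<in>{k}. Z l \<omega>)" for \<omega>
  define V where "V \<omega> = (\<lambda>l\<in>?I. Z l \<omega>)" for \<omega>
  \<comment> \<open>Written as a resolvent for every argument \<open>z\<close>, not only for actual
    values of \<open>V\<close>, so that the entry bounds and the second moment bound hold uniformly
    in \<open>z\<close>.\<close>
  define a where "a i j z = resolvent p t (\<lambda>l i. if l = k then 0 else z l i / sqrt m) m i j" for i j and z :: "nat \<Rightarrow> nat \<Rightarrow> real"
  have isR: "is_resolvent p t (\<lambda>l i. if l = k then 0 else z l i / sqrt m) m (\<lambda>i j. a i j z)" for z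
    unfolding a_def by (rule is_resolvent_resolvent[OF t])
  interpret bv: block_vector M p d B "\<lambda>i \<omega>. X \<omega> i k" C
    by standard (use k blocks X_meas blocks_indep mean0 isotropic fourth_int fourth_bdd block_size in auto)
  have Uk: "U \<omega> k i = X \<omega> i k" if "i < p" for \<omega> i using that by (simp add: U_def Z_def)
  have aV: "a i j (V \<omega>) = loo_resolvent k \<omega> i j" if "i < p" "j < p" for i j \<omega>
    unfolding a_def loo_resolvent_def using that
    by (intro resolvent_fn_cong[OF t]) (auto simp: V_def Z_def cols_def)
  have dev: "loo_dev k \<omega> = (\<Sum>i<p. \<Sum>j<p. a i j (V \<omega>) * (U \<omega> k i * U \<omega> k j - (if i = j then 1 else 0)))" for \<omega>
    unfolding loo_dev_def by (intro sum.cong refl) (simp add: aV Uk)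
  have ind: "indep_var (PiM {k} ?N) U (PiM ?I ?N) V"
    unfolding U_def[abs_def] V_def[abs_def] Z_def
    by (rule indep_var_restrict[OF cols_indep]) (use k in auto)
  have 1: "(\<lambda>u. u k i) \<in> borel_measurable (PiM {k} ?N)" if "i < p" for i
    using that by (intro coord_measurable) auto
  have 2: "a i j \<in> borel_measurable (PiM ?I ?N)" if "i < p" "j < p" for i j
    unfolding a_def[abs_def]
  proof (rule measurable_resolvent[OF _ that])
    fix l i assume "l < m" "i < p"
    then show "(\<lambda>z. if l = k then 0 else z l i / sqrt m) \<in> borel_measurable (PiM ?I ?N)"
      by (cases "l = k") (auto intro!: borel_measurable_divide coord_measurable)
  qed
  have 3: "\<bar>a i j z\<bar> \<le> 1 / t" if "i < p" "j < p" for i j z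
    by (rule resolvent_entry_bound[OF t isR that])
  have 4: "integrable M (\<lambda>\<omega>. U \<omega> k i ^ 4)" if "i < p" for i
    unfolding Uk[OF that] by (rule fourth_int[OF that k])
  have 5: "expectation (\<lambda>\<omega>. (\<Sum>i<p. \<Sum>j<p. a i j z * (U \<omega> k i * U \<omega> k j - (if i = j then 1 else 0)))\<^sup>2) \<le> K" for z
  proof -
    have "(\<Sum>i<p. \<Sum>j<p. a i j z * (U \<omega> k i * U \<omega> k j - (if i = j then 1 else 0)))
        = (\<Sum>i<p. \<Sum>j<p. a i j z * (X \<omega> i k * X \<omega> j k - (if i = j then 1 else 0)))" for \<omega>
      by (intro sum.cong refl) (simp add: Uk)
    then show ?thesis unfolding K_def
      using bv.quadratic_form_second_moment(2)[OF t resolvent_sym[OF t isR] resolvent_quadratic_nonneg[OF t isR]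
          resolvent_quadratic_le[OF t isR] resolvent_col_norm[OF t isR]] by simp
  qed
  show "integrable M (\<lambda>\<omega>. (loo_dev k \<omega>)\<^sup>2)"
    unfolding dev
    by (rule indep_quadratic_form_second_moment(1)[where a = a and \<xi> = "\<lambda>i u. u k i" and b = "1 / t", OF ind 1 2 3 4 5])
  show "expectation (\<lambda>\<omega>. (loo_dev k \<omega>)\<^sup>2) \<le> K"
    unfolding dev
    by (rule indep_quadratic_form_second_moment(2)[where a = a and \<xi> = "\<lambda>i u. u k i" and b = "1 / t", OF ind 1 2 3 4 5])
qed

text \<open>The first moment is bounded by the root of the second moment bound, obtained by
  integrating \<open>\<bar>y\<bar> <= (y\<^sup>2 / r + r) / 2\<close> with \<open>r\<close> equal to
  that root.\<close>

lemma loo_dev_abs: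
  assumes k: "k < m"
  shows "integrable M (\<lambda>\<omega>. \<bar>loo_dev k \<omega>\<bar>)"
    "expectation (\<lambda>\<omega>. \<bar>loo_dev k \<omega>\<bar>) \<le> sqrt (4 * real p + 2 * C * real d * real p) / t"
proof -
  define K where "K = (4 * real p + 2 * C * real d * real p) / t\<^sup>2"
  define r where "r = sqrt (4 * real p + 2 * C * real d * real p) / t"
  have pos: "4 * real p + 2 * C * real d * real p > 0"
    using p_pos C_nonneg by (intro add_pos_nonneg) auto
  have r: "r > 0" "r\<^sup>2 = K" using pos t by (auto simp: r_def K_def power_divide)
  have m2: "integrable M (\<lambda>\<omega>. (loo_dev k \<omega>)\<^sup>2)" "expectation (\<lambda>\<omega>. (loo_dev k \<omega>)\<^sup>2) \<le> K"
    unfolding K_def by (rule loo_dev_second_moment[OF k])+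
  have loo_meas: "(\<lambda>\<omega>. loo_resolvent k \<omega> i j) \<in> borel_measurable M" if "i < p" "j < p" for i j
    unfolding loo_resolvent_def
  proof (rule measurable_resolvent[OF _ that])
    fix l i assume "l < m" "i < p"
    then show "(\<lambda>\<omega>. ((cols \<omega>)(k := \<lambda>_. 0)) l i) \<in> borel_measurable M"
      by (cases "l = k") (auto simp: cols_def intro!: borel_measurable_divide X_meas)
  qed
  have meas: "loo_dev k \<in> borel_measurable M"
    unfolding loo_dev_def[abs_def]
    by (intro borel_measurable_sum borel_measurable_times borel_measurable_diff borel_measurable_const loo_meas X_meas k) auto
  have le: "\<bar>y\<bar> \<le> (y\<^sup>2 / r + r) / 2" for y :: real
  proof -
    have "0 \<le> (\<bar>y\<bar> - r)\<^sup>2" by simp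
    then have "2 * r * \<bar>y\<bar> \<le> y\<^sup>2 + r\<^sup>2" by (simp add: power2_diff algebra_simps)
    then show ?thesis using r by (simp add: field_simps power2_eq_square)
  qed
  have bint: "integrable M (\<lambda>\<omega>. ((loo_dev k \<omega>)\<^sup>2 / r + r) / 2)" using m2 by simp
  show int: "integrable M (\<lambda>\<omega>. \<bar>loo_dev k \<omega>\<bar>)"
  proof (rule Bochner_Integration.integrable_bound[OF bint])
    show "AE \<omega> in M. norm \<bar>loo_dev k \<omega>\<bar> \<le> norm (((loo_dev k \<omega>)\<^sup>2 / r + r) / 2)"
      by (rule AE_I2) (use order_trans[OF le abs_ge_self] in simp)
  qed (use meas in measurable)
  have "expectation (\<lambda>\<omega>. \<bar>loo_dev k \<omega>\<bar>) \<le> expectation (\<lambda>\<omega>. ((loo_dev k \<omega>)\<^sup>2 / r + r) / 2)"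
    by (rule integral_mono[OF int bint le])
  also have "\<dots> = (expectation (\<lambda>\<omega>. (loo_dev k \<omega>)\<^sup>2) / r + r) / 2" using m2 by (simp add: prob_space)
  also have "\<dots> \<le> (r\<^sup>2 / r + r) / 2"
    using m2(2) r by (intro divide_right_mono add_right_mono) auto
  also have "\<dots> = r" using r(1) by (simp add: power2_eq_square)
  finally show "expectation (\<lambda>\<omega>. \<bar>loo_dev k \<omega>\<bar>) \<le> sqrt (4 * real p + 2 * C * real d * real p) / t"
    unfolding r_def .
qed

text \<open>On the nonnegative reals \<open>a -> a / (1 + a)\<close> has Lipschitz constant 1. The
  three errors come from the fluctuation of the quadratic form, from restoring the removed column in
  the trace, and from replacing the random transform by the constant
  \<open>\<theta>\<close>.\<close>

lemma column_quadratic_estimate: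
  assumes k: "k < m" and \<theta>: "\<theta> \<ge> 0"
  shows "\<bar>\<theta> / (1 + \<theta>) - dot p (cols \<omega> k) (mat_app p (resolvent p t (cols \<omega>) m) (cols \<omega> k))\<bar>
    \<le> \<bar>loo_dev k \<omega>\<bar> / m + 1 / (t * m) + \<bar>p / m * emp_stieltjes t \<omega> - \<theta>\<bar>"
proof -
  define R where "R = loo_resolvent k \<omega>"
  define a where "a = dot p (cols \<omega> k) (mat_app p R (cols \<omega> k))"
  have a0: "a \<ge> 0" unfolding a_def R_def loo_resolvent_def by (rule resolvent_quadratic_nonneg[OF t is_resolvent_resolvent[OF t]])
  have b: "dot p (cols \<omega> k) (mat_app p (resolvent p t (cols \<omega>) m) (cols \<omega> k)) = a / (1 + a)"
    unfolding a_def R_def loo_resolvent_def by (rule resolvent_fn_drop_column_quadratic[OF t k])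
  have "\<theta> / (1 + \<theta>) - a / (1 + a) = (\<theta> - a) / ((1 + \<theta>) * (1 + a))"
    using \<theta> a0 by (simp add: diff_frac_eq algebra_simps)
  also have "\<bar>\<dots>\<bar> = \<bar>\<theta> - a\<bar> / ((1 + \<theta>) * (1 + a))" using \<theta> a0 by simp
  also have "\<dots> \<le> \<bar>\<theta> - a\<bar> / 1"
  proof (rule divide_left_mono)
    show "1 \<le> (1 + \<theta>) * (1 + a)" using mult_mono[of 1 "1 + \<theta>" 1 "1 + a"] \<theta> a0 by simp
    then show "0 < (1 + \<theta>) * (1 + a) * 1" by linarith
  qed simp
  finally have lip: "\<bar>\<theta> / (1 + \<theta>) - a / (1 + a)\<bar> \<le> \<bar>\<theta> - a\<bar>" by simp
  have am: "a = loo_dev k \<omega> / m + mat_tr p R / m"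
  proof -
    have cc: "cols \<omega> k i * cols \<omega> k j = X \<omega> i k * X \<omega> j k / m" for i j
      by (simp add: cols_def)
    have "a = (\<Sum>i<p. \<Sum>j<p. R i j * (cols \<omega> k i * cols \<omega> k j))"
      unfolding a_def dot_def mat_app_def sum_distrib_left by (intro sum.cong refl) (simp add: mult_ac)
    also have "\<dots> = (\<Sum>i<p. \<Sum>j<p. R i j * (X \<omega> i k * X \<omega> j k)) / m"
      unfolding cc by (simp add: sum_divide_distrib)
    also have "(\<Sum>i<p. \<Sum>j<p. R i j * (X \<omega> i k * X \<omega> j k)) = loo_dev k \<omega> + (\<Sum>i<p. \<Sum>j<p. R i j * (if i = j then 1 else 0))"
      unfolding loo_dev_def R_def by (simp only: right_diff_distrib sum_subtractf)
    also have "(\<Sum>i<p. \<Sum>j<p. R i j * (if i = j then 1 else 0)) = mat_tr p R"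
      unfolding mat_tr_def by (intro sum.cong refl) (simp add: if_distrib sum.delta cong: if_cong)
    finally show ?thesis by (simp add: add_divide_distrib)
  qed
  have tr: "0 \<le> mat_tr p R - mat_tr p (resolvent p t (cols \<omega>) m)" "mat_tr p R - mat_tr p (resolvent p t (cols \<omega>) m) \<le> 1 / t"
    unfolding R_def loo_resolvent_def by (rule resolvent_fn_drop_column_trace[OF t k])+
  have st: "p / m * emp_stieltjes t \<omega> = mat_tr p (resolvent p t (cols \<omega>) m) / m" using p_pos by (simp add: emp_stieltjes_def)
  have tri: "\<bar>\<theta> - (u + v)\<bar> \<le> \<bar>u\<bar> + \<bar>v - z\<bar> + \<bar>z - \<theta>\<bar>" for u v z :: real by arith
  have "\<bar>mat_tr p R / m - p / m * emp_stieltjes t \<omega>\<bar> \<le> 1 / (t * m)"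
  proof -
    have "\<bar>mat_tr p R / m - p / m * emp_stieltjes t \<omega>\<bar> = \<bar>mat_tr p R - mat_tr p (resolvent p t (cols \<omega>) m)\<bar> / m"
      unfolding st by (simp flip: diff_divide_distrib)
    also have "\<dots> \<le> 1 / t / m" using tr by (intro divide_right_mono) auto
    finally show ?thesis by simp
  qed
  moreover have "\<bar>\<theta> - a\<bar> \<le> \<bar>loo_dev k \<omega> / m\<bar> + \<bar>mat_tr p R / m - p / m * emp_stieltjes t \<omega>\<bar> + \<bar>p / m * emp_stieltjes t \<omega> - \<theta>\<bar>"
    unfolding am by (rule tri)
  ultimately show ?thesis using lip unfolding b by simp
qed

text \<open>The defect \<open>L\<close> is compared with the exact trace identity for each outcome.
  The only remaining linear term, \<open>t\<close> times the deviation of the transform from its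
  mean, has expectation 0, so \<open>\<bar>L\<bar>\<close> is at most the expected column
  error.\<close>

theorem emp_stieltjes_approx_fixed_point:
  defines "\<sigma> \<equiv> expectation (emp_stieltjes t)"
  shows "\<bar>t * \<sigma> + \<sigma> / (1 + p / m * \<sigma>) - 1\<bar>
    \<le> sqrt (4 * real p + 2 * C * real d * real p) / (t * p) + 1 / (t * p) + 12 * sqrt m / (p * t)"
proof -
  define \<theta> where "\<theta> = p / m * \<sigma>"
  have \<sigma>: "0 \<le> \<sigma>" using emp_stieltjes_expectation_bounds by (simp add: \<sigma>_def)
  have \<theta>: "\<theta> \<ge> 0" using \<sigma> by (simp add: \<theta>_def)
  define L where "L = t * \<sigma> + \<sigma> / (1 + \<theta>) - 1"
  define G where "G \<omega> = (\<Sum>k<m. \<bar>loo_dev k \<omega>\<bar> / m + 1 / (t * m) + p / m * \<bar>emp_stieltjes t \<omega> - \<sigma>\<bar>) / p" for \<omega>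
  define b where "b k \<omega> = dot p (cols \<omega> k) (mat_app p (resolvent p t (cols \<omega>) m) (cols \<omega> k))" for k \<omega>
  have ptw: "\<bar>L - t * (\<sigma> - emp_stieltjes t \<omega>)\<bar> \<le> G \<omega>" for \<omega>
  proof -
    have "t * mat_tr p (resolvent p t (cols \<omega>) m) + (\<Sum>k<m. b k \<omega>) = real p"
      unfolding b_def by (rule resolvent_trace_identity[OF t is_resolvent_resolvent[OF t]])
    then have one: "1 = t * emp_stieltjes t \<omega> + (\<Sum>k<m. b k \<omega>) / p"
      using p_pos by (simp add: emp_stieltjes_def field_simps)
    \<comment> \<open>Since \<open>\<sigma> = (m / p) \<theta>\<close>, this term is an average of
      \<open>m\<close> equal summands and can be matched column by column with the trace
      identity.\<close>
    have "\<sigma> / (1 + \<theta>) = (\<Sum>k<m. \<theta> / (1 + \<theta>)) / p"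
      using p_pos m_pos by (simp add: \<theta>_def)
    then have "L - t * (\<sigma> - emp_stieltjes t \<omega>) = (\<Sum>k<m. \<theta> / (1 + \<theta>) - b k \<omega>) / p"
      unfolding L_def sum_subtractf diff_divide_distrib using one by (simp add: algebra_simps)
    also have "\<bar>\<dots>\<bar> \<le> (\<Sum>k<m. \<bar>\<theta> / (1 + \<theta>) - b k \<omega>\<bar>) / p"
      by (simp add: divide_right_mono)
    also have "\<dots> \<le> G \<omega>"
      unfolding G_def
    proof (intro divide_right_mono sum_mono)
      fix k assume "k \<in> {..<m}"
      then have k: "k < m" by simp
      have "\<bar>p / m * emp_stieltjes t \<omega> - \<theta>\<bar> = p / m * \<bar>emp_stieltjes t \<omega> - \<sigma>\<bar>"
        unfolding \<theta>_def right_diff_distrib[symmetric] abs_mult by simp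
      then show "\<bar>\<theta> / (1 + \<theta>) - b k \<omega>\<bar> \<le> \<bar>loo_dev k \<omega>\<bar> / m + 1 / (t * m) + p / m * \<bar>emp_stieltjes t \<omega> - \<sigma>\<bar>"
        using column_quadratic_estimate[OF k \<theta>, of \<omega>] unfolding b_def by simp
    qed simp
    finally show ?thesis .
  qed
  let ?e = "sqrt (4 * real p + 2 * C * real d * real p)"
  have term_int: "integrable M (\<lambda>\<omega>. \<bar>loo_dev k \<omega>\<bar> / m + 1 / (t * m) + p / m * \<bar>emp_stieltjes t \<omega> - \<sigma>\<bar>)" if "k < m" for k
    using loo_dev_abs(1)[OF that] emp_stieltjes_abs_deviation(1) unfolding \<sigma>_def
    by (intro Bochner_Integration.integrable_add integrable_divide integrable_mult_right integrable_const)
  have G_int: "integrable M G"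
    unfolding G_def[abs_def] by (intro integrable_divide Bochner_Integration.integrable_sum term_int) simp
  have EG: "expectation G \<le> ?e / (t * p) + 1 / (t * p) + 12 * sqrt m / (p * t)"
  proof -
    have "expectation G = (\<Sum>k<m. expectation (\<lambda>\<omega>. \<bar>loo_dev k \<omega>\<bar> / m + 1 / (t * m) + p / m * \<bar>emp_stieltjes t \<omega> - \<sigma>\<bar>)) / p"
      unfolding G_def[abs_def] by (simp only: integral_divide_zero) (subst Bochner_Integration.integral_sum, rule term_int, auto)
    also have "\<dots> \<le> (\<Sum>k<m. ?e / t / m + 1 / (t * m) + p / m * (12 * sqrt m / (p * t))) / p"
    proof (intro divide_right_mono sum_mono)
      fix k assume "k \<in> {..<m}"
      then have k: "k < m" by simp
      have "expectation (\<lambda>\<omega>. \<bar>loo_dev k \<omega>\<bar> / m + 1 / (t * m) + p / m * \<bar>emp_stieltjes t \<omega> - \<sigma>\<bar>)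
          = expectation (\<lambda>\<omega>. \<bar>loo_dev k \<omega>\<bar>) / m + 1 / (t * m) + p / m * expectation (\<lambda>\<omega>. \<bar>emp_stieltjes t \<omega> - \<sigma>\<bar>)"
        using loo_dev_abs(1)[OF k] emp_stieltjes_abs_deviation(1) unfolding \<sigma>_def by (simp add: prob_space)
      also have "\<dots> \<le> ?e / t / m + 1 / (t * m) + p / m * (12 * sqrt m / (p * t))"
        using loo_dev_abs(2)[OF k] emp_stieltjes_abs_deviation(2) unfolding \<sigma>_def
        by (intro add_mono divide_right_mono mult_left_mono order_refl) auto
      finally show "expectation (\<lambda>\<omega>. \<bar>loo_dev k \<omega>\<bar> / m + 1 / (t * m) + p / m * \<bar>emp_stieltjes t \<omega> - \<sigma>\<bar>)
          \<le> ?e / t / m + 1 / (t * m) + p / m * (12 * sqrt m / (p * t))" .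
    qed simp
    also have "\<dots> = ?e / (t * p) + 1 / (t * p) + 12 * sqrt m / (p * t)"
    proof -
      have "(\<Sum>k<m. ?e / t / m + 1 / (t * m) + p / m * (12 * sqrt m / (p * t))) = real m * (?e / t / m + 1 / (t * m) + p / m * (12 * sqrt m / (p * t)))"
        by simp
      also have "\<dots> = ?e / t + 1 / t + p * (12 * sqrt m / (p * t))"
        using m_pos by (simp add: distrib_left)
      finally show ?thesis using p_pos by (simp add: add_divide_distrib)
    qed
    finally show ?thesis .
  qed
  have Lint: "integrable M (\<lambda>\<omega>. L - t * (\<sigma> - emp_stieltjes t \<omega>))" using emp_stieltjes_integrable by simp
  have "L = expectation (\<lambda>\<omega>. L - t * (\<sigma> - emp_stieltjes t \<omega>))"
    using emp_stieltjes_integrable by (simp add: prob_space \<sigma>_def)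
  then have "\<bar>L\<bar> = \<bar>expectation (\<lambda>\<omega>. L - t * (\<sigma> - emp_stieltjes t \<omega>))\<bar>" by simp
  also have "\<dots> \<le> expectation (\<lambda>\<omega>. \<bar>L - t * (\<sigma> - emp_stieltjes t \<omega>)\<bar>)" by (rule integral_abs_bound)
  also have "\<dots> \<le> expectation G"
    by (rule integral_mono[OF _ G_int ptw]) (use Lint in simp)
  also note EG
  finally show ?thesis unfolding L_def \<theta>_def .
qed

end

end

section \<open>Passage to the limit along the dimensions\<close>

theorem theorem1p3:
  fixes M :: "'a measure"
    and p m :: "nat \<Rightarrow> nat"
    and B :: "nat \<Rightarrow> nat set set"
    and X :: "nat \<Rightarrow> 'a \<Rightarrow> nat \<Rightarrow> nat \<Rightarrow> real"
    and lam :: real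
  assumes prob: "prob_space M"
    and p_mono: "strict_mono p"
    and p_pos: "\<And>n. p n > 0"
    and m_pos: "\<And>n. m n > 0"
    and blocks: "\<And>n. partition_on {..<p n} (B n)"
    and meas: "\<And>n i k. i < p n \<Longrightarrow> k < m n \<Longrightarrow> (\<lambda>\<omega>. X n \<omega> i k) \<in> borel_measurable M"
    and cols_indep: "\<And>n. prob_space.indep_vars M (\<lambda>_. PiM {..<p n} (\<lambda>_. borel))
                         (\<lambda>k \<omega>. \<lambda>i\<in>{..<p n}. X n \<omega> i k) {..<m n}"
    and blocks_indep: "\<And>n k. k < m n \<Longrightarrow> prob_space.indep_vars M (\<lambda>J. PiM J (\<lambda>_. borel))
                         (\<lambda>J \<omega>. \<lambda>i\<in>J. X n \<omega> i k) (B n)"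
    and mean0: "\<And>n i k. i < p n \<Longrightarrow> k < m n \<Longrightarrow>
                  prob_space.expectation M (\<lambda>\<omega>. X n \<omega> i k) = 0"
    and isotropic: "\<And>n i j k. i < p n \<Longrightarrow> j < p n \<Longrightarrow> k < m n \<Longrightarrow>
                  prob_space.expectation M (\<lambda>\<omega>. X n \<omega> i k * X n \<omega> j k) = (if i = j then 1 else 0)"
    and ratio: "(\<lambda>n. real (p n) / real (m n)) \<longlonglongrightarrow> lam"
    and lam_pos: "lam > 0"
    and max_block: "(\<lambda>n. real (Max (card ` B n)) / real (p n)) \<longlonglongrightarrow> 0"
    and fourth_int: "\<And>n i k. i < p n \<Longrightarrow> k < m n \<Longrightarrow> integrable M (\<lambda>\<omega>. (X n \<omega> i k)^4)"
    and fourth_bdd: "\<exists>C. \<forall>n i k. i < p n \<longrightarrow> k < m n \<longrightarrow>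
                  prob_space.expectation M (\<lambda>\<omega>. (X n \<omega> i k)^4) \<le> C"
  shows "AE \<omega> in M. weak_conv (\<lambda>n. esd (sample_cov (p n) (m n) (X n \<omega>))) (mp_cdf lam)"
proof -
  interpret prob_space M by (rule prob)
  obtain C where C: "\<And>n i k. i < p n \<Longrightarrow> k < m n \<Longrightarrow> expectation (\<lambda>\<omega>. (X n \<omega> i k)^4) \<le> C"
    using fourth_bdd by blast
  define d where "d n = Max (card ` B n)" for n
  have bm: "block_matrix M (p n) (m n) (d n) (B n) (X n) C" for n
  proof unfold_locales
    fix J assume J: "J \<in> B n"
    have "finite (B n)" by (rule finite_elements[OF _ blocks]) simp
    then show "card J \<le> d n" unfolding d_def using J by (intro Max_ge) auto
  qed (fact p_pos m_pos blocks meas cols_indep blocks_indep mean0 isotropic fourth_int C)+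
  define s where "s n t \<omega> = mat_tr (p n) (resolvent (p n) t (\<lambda>k i. X n \<omega> i k / sqrt (m n)) (m n)) / p n" for n t \<omega>
  have s_eq: "block_matrix.emp_stieltjes (p n) (m n) (X n) t = s n t" for n t
    unfolding s_def[abs_def] block_matrix.emp_stieltjes_def[OF bm, abs_def] block_matrix.cols_def[OF bm] ..
  \<comment> \<open>Strictly increasing positive dimensions dominate \<open>n + 1\<close>, so that
    sums of \<open>1 / p\<^sup>2\<close> are controlled by the inverse squares.\<close>
  have p_ge: "Suc n \<le> p n" for n
  proof (induction n)
    case 0
    then show ?case using p_pos[of 0] by simp
  next
    case (Suc n)
    then show ?case using strict_monoD[OF p_mono, of n "Suc n"] by simp
  qed
  have inv_p: "(\<lambda>n. 1 / real (p n)) \<longlonglongrightarrow> 0"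
    using LIMSEQ_subseq_LIMSEQ[OF lim_1_over_n p_mono] by (simp add: comp_def)
  have inv_ratio: "(\<lambda>n. real (m n) / real (p n)) \<longlonglongrightarrow> 1 / lam"
    using tendsto_inverse[OF ratio] lam_pos by (simp add: inverse_eq_divide)
  have mean_conv: "(\<lambda>n. expectation (s n t)) \<longlonglongrightarrow> mp_stieltjes lam t" if t: "t > 0" for t
  proof (rule mp_fixed_point_stable[OF lam_pos t mp_stieltjes_fixed_point[OF lam_pos t]])
    show "0 \<le> expectation (s n t)" "expectation (s n t) \<le> 1 / t" for n
      using block_matrix.emp_stieltjes_expectation_bounds[OF bm t] by (simp_all add: s_eq)
    show "0 \<le> real (p n) / real (m n)" for n by simp
    show "(\<lambda>n. real (p n) / real (m n)) \<longlonglongrightarrow> lam" by (rule ratio)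
    let ?h = "\<lambda>n. t * expectation (s n t) + expectation (s n t) / (1 + real (p n) / real (m n) * expectation (s n t))"
    \<comment> \<open>The fixed point error rearranged into quantities with known limits:
      \<open>1 / p\<close>, the relative size of the largest block, and \<open>m / p\<close>. This
      is where the assumption on the block sizes enters.\<close>
    let ?e = "\<lambda>n. sqrt (4 * (1 / real (p n)) + 2 * C * (real (d n) / real (p n))) / t + (1 / real (p n)) / t
        + 12 * sqrt (real (m n) / real (p n) * (1 / real (p n))) / t"
    have "\<bar>?h n - 1\<bar> \<le> ?e n" for n
    proof -
      have p: "real (p n) > 0" using p_pos by simp
      have "sqrt (4 * real (p n) + 2 * C * real (d n) * real (p n)) / real (p n)
          = sqrt ((4 * real (p n) + 2 * C * real (d n) * real (p n)) / (real (p n))\<^sup>2)"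
        using p by (simp add: real_sqrt_divide)
      also have "(4 * real (p n) + 2 * C * real (d n) * real (p n)) / (real (p n))\<^sup>2
          = 4 * (1 / real (p n)) + 2 * C * (real (d n) / real (p n))"
        using p by (simp add: power2_eq_square field_simps)
      finally have 1: "sqrt (4 * real (p n) + 2 * C * real (d n) * real (p n)) / real (p n)
          = sqrt (4 * (1 / real (p n)) + 2 * C * (real (d n) / real (p n)))" .
      have "sqrt (real (m n)) / real (p n) = sqrt (real (m n) / (real (p n))\<^sup>2)"
        using p by (simp add: real_sqrt_divide)
      then have 2: "sqrt (real (m n)) / real (p n) = sqrt (real (m n) / real (p n) * (1 / real (p n)))"
        by (simp add: power2_eq_square)
      have "\<bar>?h n - 1\<bar> \<le> sqrt (4 * real (p n) + 2 * C * real (d n) * real (p n)) / (t * real (p n)) + 1 / (t * real (p n)) + 12 * sqrt (real (m n)) / (real (p n) * t)"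
        using block_matrix.emp_stieltjes_approx_fixed_point[OF bm t] unfolding s_eq .
      also have "\<dots> = (sqrt (4 * real (p n) + 2 * C * real (d n) * real (p n)) / real (p n)) / t + (1 / real (p n)) / t + 12 * (sqrt (real (m n)) / real (p n)) / t"
        by (simp add: mult.commute)
      finally show ?thesis unfolding 1 2 .
    qed
    moreover have "?e \<longlonglongrightarrow> sqrt (4 * 0 + 2 * C * 0) / t + 0 / t + 12 * sqrt (1 / lam * 0) / t"
      using t by (intro tendsto_intros inv_p inv_ratio max_block[folded d_def]) auto
    ultimately have "(\<lambda>n. ?h n - 1) \<longlonglongrightarrow> 0"
      by (intro Lim_null_comparison[where f = "\<lambda>n. ?h n - 1" and g = ?e]) auto
    then show "?h \<longlonglongrightarrow> 1" by (simp add: LIM_zero_iff)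
  qed
  have AE_conv: "AE \<omega> in M. (\<lambda>n. s n t \<omega>) \<longlonglongrightarrow> mp_stieltjes lam t" if t: "t > 0" for t
  proof -
    define b where "b n = 1024 * (1 / (real (p n) * t)) ^ 4 * (real (m n))\<^sup>2" for n
    have "Bseq (\<lambda>n. real (m n) / real (p n))"
      using inv_ratio convergentI convergent_imp_Bseq by blast
    then obtain K where K: "\<And>n. real (m n) / real (p n) \<le> K" "K > 0"
      unfolding Bseq_def by auto
    \<comment> \<open>Separates the bounded factor \<open>m / p\<close> from the summable factor
      \<open>1 / p\<^sup>2\<close>.\<close>
    have b_eq: "b n = 1024 / t ^ 4 * (real (m n) / real (p n))\<^sup>2 * (1 / real (p n))\<^sup>2" for n
      by (simp add: b_def power_divide power_mult_distrib power2_eq_square power4_eq_xxxx)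
    have b_le: "b n \<le> 1024 / t ^ 4 * K\<^sup>2 * (1 / (real n + 1)\<^sup>2)" for n
    proof -
      have "1 / real (p n) \<le> 1 / (real n + 1)"
        using p_ge[of n] by (intro divide_left_mono) auto
      then have "(1 / real (p n))\<^sup>2 \<le> (1 / (real n + 1))\<^sup>2" by (intro power_mono) auto
      moreover have "(real (m n) / real (p n))\<^sup>2 \<le> K\<^sup>2" by (intro power_mono K) auto
      ultimately show ?thesis unfolding b_eq power_one_over[symmetric]
        by (intro mult_mono) auto
    qed
    have "summable b"
    proof (rule summable_comparison_test')
      show "summable (\<lambda>n. 1024 / t ^ 4 * K\<^sup>2 * (1 / (real n + 1)\<^sup>2))"
        using inverse_squares_sums by (intro summable_mult) (simp add: sums_iff add.commute)
      show "norm (b n) \<le> 1024 / t ^ 4 * K\<^sup>2 * (1 / (real n + 1)\<^sup>2)" if "n \<ge> 0" for n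
        using b_le[of n] by (simp add: b_def)
    qed
    have "AE \<omega> in M. (\<lambda>n. s n t \<omega> - expectation (s n t)) \<longlonglongrightarrow> 0"
    proof (rule AE_tendsto_0_fourth_moment[OF _ _ \<open>summable b\<close>])
      show "(\<lambda>\<omega>. s n t \<omega> - expectation (s n t)) \<in> borel_measurable M" for n
        using block_matrix.emp_stieltjes_measurable[OF bm t, of n] unfolding s_eq by (intro borel_measurable_diff) auto
      show "(\<integral>\<^sup>+\<omega>. ennreal ((s n t \<omega> - expectation (s n t)) ^ 4) \<partial>M) \<le> ennreal (b n)" for n
        using block_matrix.emp_stieltjes_fourth_moment[OF bm t, of n] unfolding s_eq b_def .
      show "0 \<le> b n" for n by (simp add: b_def)
    qed
    then show ?thesis
    proof (rule AE_mp, intro AE_I2 impI)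
      fix \<omega> assume "(\<lambda>n. s n t \<omega> - expectation (s n t)) \<longlonglongrightarrow> 0"
      from tendsto_add[OF this mean_conv[OF t]] show "(\<lambda>n. s n t \<omega>) \<longlonglongrightarrow> mp_stieltjes lam t" by simp
    qed
  qed
  \<comment> \<open>The exceptional null set depends on \<open>t\<close>; restricting to positive
    rationals gives one null set for all \<open>t\<close> that
    \<open>stieltjes_conv_imp_weak_conv\<close> asks for.\<close>
  have "countable {t \<in> \<rat>. (t::real) > 0}" by (rule countable_subset[OF _ countable_rat]) auto
  then have "AE \<omega> in M. \<forall>t\<in>{t \<in> \<rat>. t > 0}. (\<lambda>n. s n t \<omega>) \<longlonglongrightarrow> mp_stieltjes lam t"
    by (subst AE_ball_countable) (auto intro: AE_conv)
  then show ?thesis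
  proof (rule AE_mp, intro AE_I2 impI)
    fix \<omega> assume conv: "\<forall>t\<in>{t \<in> \<rat>. t > 0}. (\<lambda>n. s n t \<omega>) \<longlonglongrightarrow> mp_stieltjes lam t"
    have "\<exists>\<mu>. real_distribution \<mu> \<and> (AE x in \<mu>. 0 \<le> x) \<and> (\<forall>x. cdf \<mu> x = esd (sample_cov (p n) (m n) (X n \<omega>)) x) \<and>
        (\<forall>t>0. (\<integral>x. 1 / (x + t) \<partial>\<mu>) = s n t \<omega>)" for n
      using empirical_measure_sample_cov[OF p_pos, of n "m n" "X n \<omega>"] unfolding s_def by metis
    then obtain \<mu> where \<mu>: "\<And>n. real_distribution (\<mu> n)" "\<And>n. AE x in \<mu> n. 0 \<le> x"
      "\<And>n x. cdf (\<mu> n) x = esd (sample_cov (p n) (m n) (X n \<omega>)) x"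
      "\<And>n t. t > 0 \<Longrightarrow> (\<integral>x. 1 / (x + t) \<partial>\<mu> n) = s n t \<omega>" by metis
    have "weak_conv_m \<mu> (mp_measure lam)"
      by (rule stieltjes_conv_imp_weak_conv[OF \<mu>(1) real_distribution_mp[OF lam_pos] \<mu>(2) AE_mp_measure_nonneg[OF lam_pos]])
         (use conv in \<open>simp add: \<mu>(4) flip: mp_stieltjes_def[OF lam_pos]\<close>)
    moreover have "(\<lambda>n. cdf (\<mu> n)) = (\<lambda>n. esd (sample_cov (p n) (m n) (X n \<omega>)))"
      by (intro ext) (rule \<mu>(3))
    moreover have "cdf (mp_measure lam) = mp_cdf lam" by (rule ext) (rule cdf_mp_measure[OF lam_pos])
    ultimately show "weak_conv (\<lambda>n. esd (sample_cov (p n) (m n) (X n \<omega>))) (mp_cdf lam)"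
      by (simp add: weak_conv_m_def)
  qed
qed

end
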